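(* Let $f$ be a Schwarz-Christoffel mapping of the unit disk $\mathbb{D}$ onto the complement of a bounded convex $(n+2)$-gon with $f(0)=\infty$, with $$z\frac{f''}{f'}(z)=\frac{2}{z^2B(z)-1},\qquad B(z)=\prod_{k=1}^n\frac{z-a_k}{1-\overline{a_k}z},$$ so that the pre-vertices $z_1,\dots,z_{n+2}\in\partial\mathbb{D}$ are the roots of $z^2B(z)=1$. Suppose that $|a_k|\leq r<1$ for all $k$. Then the following hold. (i) The minimum separation in argument of consecutive pre-vertices is given by $2\theta$, where $\theta$ is the unique root in $(0,\pi/2)$ of the equation $$\pi=2\theta+2n\arctan\left\{\frac{1+r}{1-r}\tan\left(\frac{\theta}{2}\right)\right\}.$$ The result is sharp. The optimal configuration occurs when $a_1=\cdots=a_n=rc$ for some root $c$ of the equation $c^{n+2}=-1$, and the lower bound is attained for the pre-vertices $e^{i\theta}c,\ e^{-i\theta}c$. The distance between any other pair of consecutive pre-vertices will be larger. (ii) The maximum separation in argument of consecutive pre-vertices is given by $2\psi$, where $\psi$ is the unique root in $(0,\pi/2)$ of the equation $$\pi=2\psi+2n\arctan\left\{\frac{1-r}{1+r}\tan\left(\frac{\psi}{2}\right)\right\}.$$ The result is sharp. The optimal configuration occurs when $a_1=\cdots=a_n=rd$ for some root $d$ of the equation $d^{n+2}=(-1)^{n+1}$, and the upper bound is attained for the pre-vertices $-e^{i\psi}d,\ -e^{-i\psi}d$. The distance between any other pair of consecutive pre-vertices will be smaller.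
   Context: $\mathbb{D}=\{|z|<1\}$. Every Schwarz-Christoffel mapping $f$ of $\mathbb{D}$ onto the complement (in the extended plane) of a bounded convex $(n+2)$-gon with $f(0)=\infty$ satisfies $z\frac{f''}{f'}(z)=\frac{2}{z^2B(z)-1}$ with a Blaschke product $B(z)=c_0\prod_{k=1}^n\frac{z-a_k}{1-\overline{a_k}z}$, $|c_0|=1$, $|a_k|<1$, of degree $n$; after a rotation of $f$ one may assume $c_0=1$, and this normalization is in force. Conversely, any such $B$ yields a univalent mapping. The pre-vertices are the points of $\partial\mathbb{D}$ mapped to the vertices; they are exactly the roots of $z^2B(z)=1$. The separation of two consecutive pre-vertices $z_k,z_{k+1}$ is understood as $\arg\{\overline{z_k}z_{k+1}\}\in(0,2\pi)$. The minimum and maximum are over all such mappings with $|a_k|\le r$ for all $k$.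
   Formalization: The claims that the distance between any other pair of consecutive pre-vertices is larger (i) or smaller (ii) are stated for r > 0 only; for r = 0 all a_k = 0, B(z) = z^n, and all separations equal 2π/(n+2), so they fail. *)

theory Defs
  imports "HOL-Complex_Analysis.Complex_Analysis"
begin

definition convex_polygon :: "nat \<Rightarrow> complex set \<Rightarrow> bool" where
  "convex_polygon m P \<longleftrightarrow>
     polytope P \<and> interior P \<noteq> {} \<and> card {v. v extreme_point_of P} = m"

text \<open>The complement of the polygon is taken in the extended plane. The value infinity is
  taken at 0 only, which is expressed by the pole of \<open>f\<close> at 0 (simple, by injectivity);
  the junk value \<open>f 0\<close> is never used.\<close>

definition sc_exterior_map :: "nat \<Rightarrow> (complex \<Rightarrow> complex) \<Rightarrow> bool" where
  "sc_exterior_map m f \<longleftrightarrow>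
     f holomorphic_on (ball 0 1 - {0}) \<and> is_pole f 0 \<and> inj_on f (ball 0 1 - {0}) \<and>
     (\<exists>P. convex_polygon m P \<and> f ` (ball 0 1 - {0}) = - P)"

definition blaschke :: "nat \<Rightarrow> (nat \<Rightarrow> complex) \<Rightarrow> complex \<Rightarrow> complex" where
  "blaschke n a z = (\<Prod>k=1..n. (z - a k) / (1 - cnj (a k) * z))"

definition sc_mapping :: "nat \<Rightarrow> (nat \<Rightarrow> complex) \<Rightarrow> (complex \<Rightarrow> complex) \<Rightarrow> bool" where
  "sc_mapping n a f \<longleftrightarrow>
     sc_exterior_map (n + 2) f \<and> (\<forall>k\<in>{1..n}. norm (a k) < 1) \<and>
     (\<forall>z\<in>ball 0 1 - {0}.
        z * (deriv (deriv f) z / deriv f z) = 2 / (z\<^sup>2 * blaschke n a z - 1))"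

text \<open>The omitted set of \<open>f\<close> is the polygon, so its extreme points are the vertices. Boundary
  values are limits from inside the disk.\<close>

definition pre_vertices :: "(complex \<Rightarrow> complex) \<Rightarrow> complex set" where
  "pre_vertices f =
     {z \<in> sphere 0 1. \<exists>v. v extreme_point_of (- (f ` (ball 0 1 - {0}))) \<and>
        (f \<longlongrightarrow> v) (at z within ball 0 1)}"

definition separation :: "complex \<Rightarrow> complex \<Rightarrow> real" where
  "separation z w = Arg2pi (cnj z * w)"

text \<open>\<open>w\<close> is the next point of \<open>S\<close> after \<open>z\<close> in the counterclockwise direction.\<close>

definition consecutive :: "complex set \<Rightarrow> complex \<Rightarrow> complex \<Rightarrow> bool" where
  "consecutive S z w \<longleftrightarrow>
     z \<in> S \<and> w \<in> S \<and> z \<noteq> w \<and> (\<forall>u\<in>S - {z}. separation z w \<le> separation z u)"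

definition separations :: "nat \<Rightarrow> real \<Rightarrow> real set" where
  "separations n r =
     {separation z w | z w. \<exists>f a. sc_mapping n a f \<and> (\<forall>k\<in>{1..n}. norm (a k) \<le> r) \<and>
        consecutive (pre_vertices f) z w}"

definition is_minimum :: "real set \<Rightarrow> real \<Rightarrow> bool" where
  "is_minimum S m \<longleftrightarrow> m \<in> S \<and> (\<forall>s\<in>S. m \<le> s)"

definition is_maximum :: "real set \<Rightarrow> real \<Rightarrow> bool" where
  "is_maximum S m \<longleftrightarrow> m \<in> S \<and> (\<forall>s\<in>S. s \<le> m)"

definition min_root :: "nat \<Rightarrow> real \<Rightarrow> real \<Rightarrow> bool" where
  "min_root n r \<theta> \<longleftrightarrow> \<theta> \<in> {0<..<pi/2} \<and>
     pi = 2 * \<theta> + 2 * real n * arctan ((1 + r) / (1 - r) * tan (\<theta> / 2))"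

definition max_root :: "nat \<Rightarrow> real \<Rightarrow> real \<Rightarrow> bool" where
  "max_root n r \<psi> \<longleftrightarrow> \<psi> \<in> {0<..<pi/2} \<and>
     pi = 2 * \<psi> + 2 * real n * arctan ((1 - r) / (1 + r) * tan (\<psi> / 2))"

end

theory Submission
  imports Defs "HOL-Computational_Algebra.Fundamental_Theorem_Algebra"
begin

text \<open>
  On the circle, \<open>z\<^sup>2 B(z)\<close> has unit modulus, and for a fixed base point \<open>z\<close> its argument at
  \<open>z e\<^sup>2\<^sup>i\<^sup>\<delta>\<close> has grown by \<open>4\<delta>\<close> plus one contribution per zero of \<open>B\<close>. Two consecutive
  pre-vertices are separated by \<open>2\<delta>\<close> exactly when this growth is \<open>2\<pi>\<close>. The contribution of a zero
  in \<open>|a| \<le> r\<close> is largest when it sits at radius \<open>r\<close> behind the midpoint of the arc and smallest at the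
  antipodal position, which gives the two extremal equations.

  Every \<open>B\<close> is realised by a mapping \<open>F\<close>: partial fractions turn the differential equation into
  \<open>F'(z) = z\<^sup>-\<^sup>2 \<Prod> (1 - z/\<zeta>)\<^sup>\<beta>\<close> over the roots \<open>\<zeta>\<close> of \<open>z\<^sup>2 B(z) = 1\<close>, with \<open>\<beta> > 0\<close> of sum 2. The
  boundary curve of \<open>F\<close> is straight between roots and turns clockwise by \<open>\<pi>\<beta>\<close> at each of them, so
  it bounds a convex polygon lying on one side of each of its tangents. By the argument principle the
  number of preimages of \<open>w\<close> is 1 plus the winding number of this curve about \<open>w\<close>, hence 1 outside the
  polygon and 0 inside. Every other solution of the differential equation is an affine image of \<open>F\<close>,
  so its pre-vertices are the same roots.
\<close>

section \<open>The phase of a Blaschke factor\<close>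

text \<open>Increments of argument must be free of branch jumps. Half the increment of a Blaschke
  factor is therefore written as an arccotangent, with values in (0, pi). A zero at signed radius
  \<rho> on the ray of the midpoint contributes \<open>2 * arctan ((1 + \<rho>) / (1 - \<rho>) * tan
  (\<delta> / 2))\<close>, so \<rho> = r and \<rho> = -r give both root equations from one
  computation. If all zeros equal \<rho> c, then z^2 B(z) = c^(n+2) at z = c, and the way from c to
  the end of the extremal arc adds a factor -1. This is the origin of c^(n+2) = -1; the equation for
  d arises from d = -c. On the geometric side, holomorphy of \<open>F\<close> is at hand only inside
  the disk, so the argument principle is applied on a slightly smaller circle. Heights along the
  boundary curve are merely quasiconvex, which yields weak support by tangents; strict support at a
  vertex needs a tangent tilted by half the exterior angle. For interior points a winding number
  with negative real part is enough, since the number of preimages is a natural number.\<close>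

definition half_phase :: "complex \<Rightarrow> complex \<Rightarrow> real \<Rightarrow> real" where
  "half_phase a z \<delta> = pi / 2 - arctan
     (((1 + (norm a)\<^sup>2) * cos \<delta> - 2 * Re (a * cnj z * cis (-\<delta>))) / ((1 - (norm a)\<^sup>2) * sin \<delta>))"

lemma cis_double_arccot:
  "cis (2 * (pi / 2 - arctan x)) = (of_real x + \<i>) / (of_real x - \<i>)"
proof -
  have "cis (2 * (pi / 2 - arctan x)) = cis (pi / 2 - arctan x) ^ 2"
    by (simp add: power2_eq_square cis_mult)
  also have "cis (pi / 2 - arctan x) = (of_real x + \<i>) / of_real (sqrt (1 + x\<^sup>2))"
    by (simp add: complex_eq_iff cos_diff sin_diff sin_arctan cos_arctan)
  also have "\<dots> ^ 2 = (of_real x + \<i>)^2 / of_real ((sqrt (1 + x\<^sup>2))^2)"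
    by (simp only: power_divide of_real_power)
  also have "(sqrt (1 + x\<^sup>2))^2 = 1 + x^2"
    by simp
  also have "complex_of_real (1 + x^2) = (of_real x + \<i>) * (of_real x - \<i>)"
    by (simp add: complex_eq_iff power2_eq_square)
  finally show ?thesis
    by (simp add: power2_eq_square complex_eq_iff)
qed

lemma cnj_unit_mult: "norm (z::complex) = 1 \<Longrightarrow> cnj z * z = 1"
  using complex_norm_square[of z] by (simp add: mult.commute)

lemma norm_less_1_sq: "norm (a::complex) < 1 \<Longrightarrow> (norm a)\<^sup>2 < 1"
  by (simp add: power_less_one_iff)

lemma blaschke_factor_ne0:
  assumes "norm (a::complex) < 1" "norm z = 1"
  shows "1 - cnj a * z \<noteq> 0" "z - a \<noteq> 0"
proof -
  have "norm (cnj a * z) < 1"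
    using assms by (simp add: norm_mult)
  then show "1 - cnj a * z \<noteq> 0"
    by auto
  show "z - a \<noteq> 0"
    using assms by auto
qed

text \<open>With c = e^(i \<delta>), the quotient of the two factors is Q / cnj Q for
  \<open>Q = (1 - cnj a * z) * c * (1 - a * cnj z * cnj c * cnj c)\<close>. Its argument is twice
  that of Q, and the quotient inside \<open>half_phase\<close> is Re Q / Im Q.\<close>

lemma blaschke_factor_rotate:
  fixes a z :: complex
  assumes a: "norm a < 1" and z: "norm z = 1" and d: "0 < \<delta>" "\<delta> < pi"
  shows "(z * cis (2 * \<delta>) - a) / (1 - cnj a * (z * cis (2 * \<delta>))) =
         (z - a) / (1 - cnj a * z) * cis (2 * half_phase a z \<delta>)"
proof -
  define c where "c = cis \<delta>"
  define X where "X = (1 + (norm a)\<^sup>2) * cos \<delta> - 2 * Re (a * cnj z * cis (-\<delta>))"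
  define Y where "Y = (1 - (norm a)\<^sup>2) * sin \<delta>"
  have Y: "Y > 0"
    unfolding Y_def using norm_less_1_sq[OF a] d by (intro mult_pos_pos sin_gt_zero) auto
  have c1: "cnj c * c = 1" and z1: "cnj z * z = 1"
    using cnj_unit_mult z by (auto simp: c_def cis_mult cis_cnj)
  have c2: "cis (2 * \<delta>) = c * c"
    by (simp add: c_def cis_mult)
  have Q: "Complex X Y = (1 - cnj a * z) * c * (1 - a * cnj z * cnj c * cnj c)"
  proof -
    have "(1 - cnj a * z) * c * (1 - a * cnj z * cnj c * cnj c) =
        c - cnj a * z * c - a * cnj z * cnj c * (cnj c * c) + (a * cnj a) * (cnj z * z) * cnj c * (cnj c * c)"
      by (simp add: algebra_simps)
    also have "\<dots> = c + (norm a)^2 * cnj c - (a * cnj z * cnj c + cnj (a * cnj z * cnj c))"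
      by (simp add: c1 z1 complex_norm_square[symmetric])
    also have "\<dots> = Complex X Y"
      unfolding complex_add_cnj by (simp add: X_def Y_def c_def complex_eq_iff algebra_simps cis_cnj)
    finally show ?thesis ..
  qed
  have QQ: "Complex X (-Y) = (1 - a * cnj z) * cnj c * (1 - cnj a * z * c * c)"
    using arg_cong[OF Q, of cnj] by (simp add: complex_cnj)
  have "cis (2 * half_phase a z \<delta>) = (of_real (X / Y) + \<i>) / (of_real (X / Y) - \<i>)"
    unfolding half_phase_def X_def[symmetric] Y_def[symmetric] by (rule cis_double_arccot)
  also have "\<dots> = ((of_real (X / Y) + \<i>) * Y) / ((of_real (X / Y) - \<i>) * Y)"
    using Y by simp
  also have "(of_real (X / Y) + \<i>) * Y = Complex X Y"
    using Y by (simp add: complex_eq_iff)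
  also have "(of_real (X / Y) - \<i>) * Y = Complex X (-Y)"
    using Y by (simp add: complex_eq_iff)
  finally have 1: "cis (2 * half_phase a z \<delta>) = Complex X Y / Complex X (-Y)" .
  have n0: "1 - cnj a * z \<noteq> 0" "z - a \<noteq> 0" "1 - cnj a * (z * c * c) \<noteq> 0" "Complex X (-Y) \<noteq> 0"
    using Y blaschke_factor_ne0[OF a z] blaschke_factor_ne0[OF a, of "z * c * c"] z
    by (auto simp: norm_mult c_def complex_eq_iff)
  have "(z * c * c - a) * (1 - cnj a * z) * Complex X (-Y)
      = (z - a) * (1 - cnj a * (z * c * c)) * Complex X Y"
  proof -
    have e1: "z * c * c - a = z * c * c * (1 - a * cnj z * cnj c * cnj c)"
    proof -
      have "z * c * c * (1 - a * cnj z * cnj c * cnj c) = z * c * c - a * (cnj z * z) * (cnj c * c) * (cnj c * c)"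
        by (simp add: algebra_simps)
      then show ?thesis by (simp add: c1 z1)
    qed
    have e2: "z - a = z * (1 - a * cnj z)"
    proof -
      have "z * (1 - a * cnj z) = z - a * (cnj z * z)"
        by (simp add: algebra_simps)
      then show ?thesis by (simp add: z1)
    qed
    have "(z * c * c - a) * (1 - cnj a * z) * Complex X (-Y) = 
       z * (c * cnj c) * c * (1 - a * cnj z * cnj c * cnj c) * (1 - cnj a * z) * (1 - a * cnj z) * (1 - cnj a * z * c * c)"
      unfolding QQ e1 by (simp add: mult_ac)
    also have "c * cnj c = 1"
      using c1 by (simp add: mult.commute)
    finally show ?thesis
      unfolding Q e2 by (simp add: mult_ac)
  qed
  then show ?thesis
    unfolding 1 c2 using n0 by (simp add: field_simps)
qed

text \<open>The argument of arctan is affine in cot \<delta>, and for |z| = 1 its slope |z - a|^2 /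
  (1 - |a|^2) is positive. Monotonicity in \<delta> and the limit at 0 are thereby inherited from
  cot.\<close>

lemma half_phase_cot_form:
  assumes d: "0 < \<delta>" "\<delta> < pi"
  shows "half_phase a z \<delta> = pi / 2 - arctan
     ((1 + (norm a)\<^sup>2 - 2 * Re (a * cnj z)) / (1 - (norm a)\<^sup>2) * cot \<delta> 
        - 2 * Im (a * cnj z) / (1 - (norm a)\<^sup>2))"
proof -
  have s: "sin \<delta> \<noteq> 0"
    using sin_gt_zero[OF d] by simp
  have "Re (a * cnj z * cis (-\<delta>)) = Re (a * cnj z) * cos \<delta> + Im (a * cnj z) * sin \<delta>"
    by simp
  then have "((1 + (norm a)\<^sup>2) * cos \<delta> - 2 * Re (a * cnj z * cis (-\<delta>))) / ((1 - (norm a)\<^sup>2) * sin \<delta>)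
    = ((1 + (norm a)\<^sup>2 - 2 * Re (a * cnj z)) * cos \<delta> - 2 * Im (a * cnj z) * sin \<delta>) / ((1 - (norm a)\<^sup>2) * sin \<delta>)"
    by (simp add: algebra_simps)
  also have "\<dots> = (1 + (norm a)\<^sup>2 - 2 * Re (a * cnj z)) / (1 - (norm a)\<^sup>2) * cot \<delta> 
        - 2 * Im (a * cnj z) / (1 - (norm a)\<^sup>2)"
    using s by (subst diff_divide_distrib, subst mult_divide_mult_cancel_right) (simp_all add: cot_def)
  finally show ?thesis
    unfolding half_phase_def by simp
qed

lemma half_phase_slope_pos:
  assumes "norm (a::complex) < 1" "norm z = 1"
  shows "(1 + (norm a)\<^sup>2 - 2 * Re (a * cnj z)) / (1 - (norm a)\<^sup>2) > 0"
proof -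
  have "Re (a * cnj z) \<le> norm (a * cnj z)"
    by (rule complex_Re_le_cmod)
  then have "Re (a * cnj z) \<le> norm a"
    using assms by (simp add: norm_mult)
  moreover have "(1 - norm a)^2 > 0"
    using assms by simp
  ultimately have "1 + (norm a)\<^sup>2 - 2 * Re (a * cnj z) > 0"
    by (simp add: power2_eq_square algebra_simps)
  then show ?thesis
    using norm_less_1_sq[OF assms(1)] by simp
qed

lemma half_phase_bounds: "0 < half_phase a z \<delta>" "half_phase a z \<delta> < pi"
  unfolding half_phase_def
  using arctan_ubound[of "((1 + (norm a)\<^sup>2) * cos \<delta> - 2 * Re (a * cnj z * cis (-\<delta>))) / ((1 - (norm a)\<^sup>2) * sin \<delta>)"]
    arctan_lbound[of "((1 + (norm a)\<^sup>2) * cos \<delta> - 2 * Re (a * cnj z * cis (-\<delta>))) / ((1 - (norm a)\<^sup>2) * sin \<delta>)"]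
  by linarith+

lemma cot_strict_antimono:
  fixes x y :: real
  assumes "0 < x" "x < y" "y < pi"
  shows "cot y < cot x"
proof -
  have s: "sin x > 0" "sin y > 0"
    using assms by (auto intro: sin_gt_zero)
  have "cot x - cot y = sin (y - x) / (sin x * sin y)"
    using s by (simp add: cot_def sin_diff field_simps)
  also have "\<dots> > 0"
    using s assms by (intro divide_pos_pos mult_pos_pos sin_gt_zero) auto
  finally show ?thesis by simp
qed

lemma half_phase_strict_mono:
  assumes "norm a < 1" "norm z = 1" "0 < x" "x < y" "y < pi"
  shows "half_phase a z x < half_phase a z y"
  using mult_strict_left_mono[OF cot_strict_antimono[OF assms(3-5)] half_phase_slope_pos[OF assms(1,2)]] assms(3-5)
  by (simp add: half_phase_cot_form arctan_less_iff)

lemma continuous_on_half_phase: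
  assumes "norm a < 1"
  shows "continuous_on {0<..<pi} (half_phase a z)"
proof -
  have "(1 - (norm a)\<^sup>2) * sin x \<noteq> 0" if "x \<in> {0<..<pi}" for x
    using that norm_less_1_sq[OF assms] sin_gt_zero[of x] by simp
  then show ?thesis
    unfolding half_phase_def by (intro continuous_intros) auto
qed

lemma half_phase_tendsto_0:
  assumes "norm a < 1" "norm z = 1"
  shows "(half_phase a z \<longlongrightarrow> 0) (at_right 0)"
proof -
  define p where "p = (1 + (norm a)\<^sup>2 - 2 * Re (a * cnj z)) / (1 - (norm a)\<^sup>2)"
  define q where "q = 2 * Im (a * cnj z) / (1 - (norm a)\<^sup>2)"
  have p: "p > 0"
    unfolding p_def by (rule half_phase_slope_pos[OF assms])
  have "filterlim (\<lambda>x. p * cot x - q) at_top (at_right 0)"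
    unfolding cot_def using p by real_asymp
  then have "((\<lambda>x. pi/2 - arctan (p * cot x - q)) \<longlongrightarrow> pi/2 - pi/2) (at_right 0)"
    by (intro tendsto_intros filterlim_compose[OF tendsto_arctan_at_top])
  moreover have "eventually (\<lambda>x. pi/2 - arctan (p * cot x - q) = half_phase a z x) (at_right 0)"
    using eventually_at_right_less[of 0] eventually_at_right_real[OF pi_gt_zero]
    by eventually_elim (auto simp: half_phase_cot_form p_def q_def)
  ultimately show ?thesis
    using tendsto_cong by force
qed

section \<open>The extremal positions of a zero\<close>

definition extremal_phase :: "real \<Rightarrow> real \<Rightarrow> real" where
  "extremal_phase \<rho> \<delta> = 2 * arctan ((1 + \<rho>) / (1 - \<rho>) * tan (\<delta> / 2))"

lemma double_arctan_eq_arccot: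
  assumes "T > 0"
  shows "2 * arctan T = pi / 2 - arctan ((1 - T\<^sup>2) / (2 * T))"
proof -
  have "arctan ((1 - T\<^sup>2) / (2 * T)) = pi / 2 - 2 * arctan T"
  proof (rule arctan_unique)
    show "- (pi / 2) < pi / 2 - 2 * arctan T" "pi / 2 - 2 * arctan T < pi / 2"
      using arctan_ubound[of T] assms by auto
    have "tan (pi / 2 - 2 * arctan T) = cot (2 * arctan T)"
      by (simp add: tan_def cot_def sin_diff cos_diff)
    also have "\<dots> = (1 - T\<^sup>2) / (2 * T)"
    proof -
      define R where "R = sqrt (1 + T\<^sup>2)"
      have R: "R > 0"
        by (simp add: R_def add_pos_nonneg)
      have "cos (2 * arctan T) = (1 - T\<^sup>2) / R\<^sup>2" "sin (2 * arctan T) = 2 * T / R\<^sup>2"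
        unfolding cos_double sin_double cos_arctan sin_arctan R_def[symmetric]
        by (simp_all add: power_divide diff_divide_distrib power2_eq_square)
      then show ?thesis
        using R assms by (simp add: cot_def)
    qed
    finally show "tan (pi / 2 - 2 * arctan T) = (1 - T\<^sup>2) / (2 * T)" .
  qed
  then show ?thesis by simp
qed

text \<open>Half-angle formulas bring the arctangent of the root equations into the arccotangent
  form of \<open>half_phase\<close>, so that the two can be compared through their
  quotients.\<close>

lemma extremal_phase_arccot:
  assumes r: "\<bar>\<rho>\<bar> < 1" and d: "0 < \<delta>" "\<delta> < pi"
  shows "extremal_phase \<rho> \<delta> = pi / 2 - arctan (((1 + \<rho>\<^sup>2) * cos \<delta> - 2 * \<rho>) / ((1 - \<rho>\<^sup>2) * sin \<delta>))"
proof -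
  define S C where "S = sin (\<delta>/2)" and "C = cos (\<delta>/2)"
  define T where "T = (1 + \<rho>) / (1 - \<rho>) * tan (\<delta> / 2)"
  have S: "S > 0" and C: "C > 0"
    unfolding S_def C_def using d by (auto intro!: sin_gt_zero cos_gt_zero)
  have SC: "S^2 + C^2 = 1"
    by (simp add: S_def C_def)
  have T: "T = (1 + \<rho>) * S / ((1 - \<rho>) * C)"
    by (simp add: T_def S_def C_def tan_def)
  have T0: "T > 0"
    unfolding T using S C r by auto
  have sd: "sin \<delta> = 2 * S * C" "cos \<delta> = C^2 - S^2"
    using sin_double[of "\<delta>/2"] cos_double[of "\<delta>/2"] by (auto simp: S_def C_def)
  have "(1 - T\<^sup>2) / (2 * T) = (((1-\<rho>)*C)^2 - ((1+\<rho>)*S)^2) / (2 * (1+\<rho>) * S * ((1-\<rho>)*C))"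
  proof -
    have "(1 - (u / v)\<^sup>2) / (2 * (u / v)) = (v\<^sup>2 - u\<^sup>2) / (2 * u * v)" if "u > 0" "v > 0" for u v :: real
      using that by (simp add: field_simps power2_eq_square)
    from this[of "(1+\<rho>)*S" "(1-\<rho>)*C"] show ?thesis
      unfolding T using S C r by (simp add: mult.assoc)
  qed
  also have "((1-\<rho>)*C)^2 - ((1+\<rho>)*S)^2 = (1 + \<rho>\<^sup>2) * (C^2 - S^2) - 2 * \<rho> * (S^2 + C^2)"
    by (simp add: power2_eq_square algebra_simps)
  also have "2 * (1+\<rho>) * S * ((1-\<rho>)*C) = (1 - \<rho>\<^sup>2) * (2 * S * C)"
    by (simp add: power2_eq_square algebra_simps)
  finally have "(1 - T\<^sup>2) / (2 * T) = ((1 + \<rho>\<^sup>2) * cos \<delta> - 2 * \<rho>) / ((1 - \<rho>\<^sup>2) * sin \<delta>)"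
    unfolding sd SC by simp
  then show ?thesis
    unfolding extremal_phase_def T_def[symmetric] using double_arctan_eq_arccot[OF T0] by simp
qed

lemma half_phase_extremal:
  assumes z: "norm z = 1" and r: "\<bar>\<rho>\<bar> < 1" and d: "0 < \<delta>" "\<delta> < pi"
  shows "half_phase (of_real \<rho> * (z * cis \<delta>)) z \<delta> = extremal_phase \<rho> \<delta>"
proof -
  have "of_real \<rho> * (z * cis \<delta>) * cnj z * cis (-\<delta>) = of_real \<rho> * (cnj z * z) * (cis \<delta> * cis (-\<delta>))"
    by simp
  also have "\<dots> = of_real \<rho>"
    by (simp add: cnj_unit_mult[OF z] cis_mult)
  finally have "of_real \<rho> * (z * cis \<delta>) * cnj z * cis (-\<delta>) = of_real \<rho>" .
  moreover have "norm (of_real \<rho> * (z * cis \<delta>)) ^ 2 = \<rho>\<^sup>2"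
    by (simp add: norm_mult z)
  ultimately show ?thesis
    unfolding half_phase_def extremal_phase_arccot[OF r d] by (simp only: Re_complex_of_real)
qed

text \<open>Here s stands for |a|, A for the component of a along the midpoint and C for cos
  \<delta>. Over a common denominator the difference is a sum of two nonnegative terms, one
  vanishing only for A = s and the other only for s = r; this settles the case of equality
  too.\<close>

lemma extremal_quotient_le:
  fixes s A r C :: real
  assumes "A \<le> s" "0 \<le> s" "s \<le> r" "r < 1" "C < 1"
  shows "((1 + r\<^sup>2) * C - 2 * r) / (1 - r\<^sup>2) \<le> ((1 + s\<^sup>2) * C - 2 * A) / (1 - s\<^sup>2)"
    and "((1 + r\<^sup>2) * C - 2 * r) / (1 - r\<^sup>2) = ((1 + s\<^sup>2) * C - 2 * A) / (1 - s\<^sup>2) \<Longrightarrow> s = r \<and> A = r"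
proof -
  have rs: "r\<^sup>2 < 1" "s\<^sup>2 < 1"
    using assms by (auto simp: power_less_one_iff abs_square_less_1)
  \<comment> \<open>The factor that multiplies r - s in the difference is bounded below by its value
    at C = 1.\<close>
  have "(1 + r * s) - C * (r + s) \<ge> (1 + r * s) - 1 * (r + s)"
    using assms by (intro diff_left_mono mult_right_mono) auto
  also have "(1 + r * s) - 1 * (r + s) = (1 - r) * (1 - s)"
    by (simp add: algebra_simps)
  finally have "(1 + r * s) - C * (r + s) \<ge> (1 - r) * (1 - s)" .
  moreover have "(1 - r) * (1 - s) > 0"
    using assms by auto
  ultimately have pos: "(1 + r * s) - C * (r + s) > 0"
    by linarith
  have "((1 + s\<^sup>2) * C - 2 * A) / (1 - s\<^sup>2) - ((1 + r\<^sup>2) * C - 2 * r) / (1 - r\<^sup>2) =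
     (2 * (s - A) * (1 - r\<^sup>2) + 2 * (r - s) * ((1 + r * s) - C * (r + s))) / ((1 - s\<^sup>2) * (1 - r\<^sup>2))" (is "?L = (?u + ?v) / ?w")
    using rs by (simp add: diff_frac_eq) (simp add: algebra_simps power2_eq_square)
  moreover have u: "?u \<ge> 0" and v: "?v \<ge> 0" and w: "?w > 0"
    using assms rs pos by auto
  ultimately show "((1 + r\<^sup>2) * C - 2 * r) / (1 - r\<^sup>2) \<le> ((1 + s\<^sup>2) * C - 2 * A) / (1 - s\<^sup>2)"
    using divide_nonneg_pos[of "?u + ?v" ?w] by linarith
  assume "((1 + r\<^sup>2) * C - 2 * r) / (1 - r\<^sup>2) = ((1 + s\<^sup>2) * C - 2 * A) / (1 - s\<^sup>2)"
  then have "(?u + ?v) / ?w = 0"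
    using \<open>?L = (?u + ?v) / ?w\<close> by simp
  then have "?u = 0" "?v = 0"
    using u v w by (auto simp: add_nonneg_eq_0_iff)
  then show "s = r \<and> A = r"
    using rs pos by auto
qed

lemma half_phase_le:
  assumes z: "norm z = 1" and a: "norm a \<le> r" and r: "r < 1" and d: "0 < \<delta>" "\<delta> < pi"
  shows "half_phase a z \<delta> \<le> extremal_phase r \<delta>"
    and "half_phase a z \<delta> = extremal_phase r \<delta> \<Longrightarrow> a = of_real r * (z * cis \<delta>)"
    and "extremal_phase (-r) \<delta> \<le> half_phase a z \<delta>"
    and "half_phase a z \<delta> = extremal_phase (-r) \<delta> \<Longrightarrow> a = of_real (-r) * (z * cis \<delta>)"
proof -
  \<comment> \<open>The zero in the frame in which the midpoint z e^(i \<delta>) is 1; the bounds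
    involve only |v| and Re v.\<close>
  define v where "v = a * cnj z * cis (-\<delta>)"
  have v: "norm v = norm a" "a = v * (z * cis \<delta>)"
  proof -
    show "norm v = norm a"
      by (simp add: v_def norm_mult z)
    have "v * (z * cis \<delta>) = a * (cnj z * z) * (cis (-\<delta>) * cis \<delta>)"
      unfolding v_def by (simp only: mult_ac)
    also have "\<dots> = a"
      unfolding cnj_unit_mult[OF z] cis_mult by simp
    finally show "a = v * (z * cis \<delta>)" ..
  qed
  have vre: "Re v \<le> norm a" "- Re v \<le> norm a"
    using abs_Re_le_cmod[of v] v(1) by auto
  have s: "sin \<delta> > 0"
    using d by (rule sin_gt_zero)
  have C: "cos \<delta> < 1" "- cos \<delta> < 1"
    using cos_monotone_0_pi[of 0 \<delta>] cos_monotone_0_pi[of \<delta> pi] d by auto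
  have r0: "\<bar>r\<bar> < 1" "\<bar>-r\<bar> < 1"
    using a r norm_ge_zero[of a] by linarith+
  \<comment> \<open>Equality in the quotient bound gives |Re v| = |v|, which forces v to be real and
    thus fixes a.\<close>
  have vr: "v = of_real (Re v)" if "\<bar>Re v\<bar> = norm v"
  proof -
    have "(Im v)\<^sup>2 = (norm v)\<^sup>2 - \<bar>Re v\<bar>\<^sup>2"
      by (simp add: cmod_power2)
    then show ?thesis
      unfolding that by (simp add: complex_eq_iff)
  qed
  have eq: "pi / 2 - arctan (x / (y * sin \<delta>)) \<le> pi / 2 - arctan (x' / (y' * sin \<delta>)) \<longleftrightarrow> x' / y' \<le> x / y"
    for x y x' y'
  proof -
    have "x / (y * sin \<delta>) = x / y / sin \<delta>" "x' / (y' * sin \<delta>) = x' / y' / sin \<delta>"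
      by simp_all
    then have "(x / (y * sin \<delta>) \<ge> x' / (y' * sin \<delta>)) = (x / y \<ge> x' / y')"
      using s by (simp only: divide_le_cancel) auto
    then show ?thesis
      using arctan_le_iff[of "x' / (y' * sin \<delta>)" "x / (y * sin \<delta>)"] by linarith
  qed
  have eq': "pi / 2 - arctan (x / (y * sin \<delta>)) = pi / 2 - arctan (x' / (y' * sin \<delta>)) \<longleftrightarrow> x' / y' = x / y"
    for x y x' y'
    using eq[of x y x' y'] eq[of x' y' x y] by linarith
  note P = extremal_quotient_le[OF vre(1) norm_ge_zero a r C(1)]
  \<comment> \<open>Changing the signs of Re v and cos \<delta> negates the quotient, so the lower
    bound is the upper bound for reflected data.\<close>
  have neg: "(p * (- cos \<delta>) - 2 * q) / y = - ((p * cos \<delta> - 2 * (- q)) / y)" for p q y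
    by (simp add: minus_divide_left)
  note N = extremal_quotient_le[OF vre(2) norm_ge_zero a r C(2), unfolded neg neg_le_iff_le neg_equal_iff_equal minus_minus]
  show "half_phase a z \<delta> \<le> extremal_phase r \<delta>"
    using P(1) unfolding half_phase_def extremal_phase_arccot[OF r0(1) d] v_def[symmetric] eq by simp
  show "extremal_phase (-r) \<delta> \<le> half_phase a z \<delta>"
    using N(1) unfolding half_phase_def extremal_phase_arccot[OF r0(2) d] v_def[symmetric] eq
    by simp
  show "a = of_real r * (z * cis \<delta>)" if "half_phase a z \<delta> = extremal_phase r \<delta>"
  proof -
    have "norm a = r \<and> Re v = r"
      using that unfolding half_phase_def extremal_phase_arccot[OF r0(1) d] eq' v_def[symmetric]
      by (intro P(2)) simp
    then have "v = of_real r"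
      using vr v(1) r0 by (metis abs_norm_cancel)
    then show ?thesis
      using v(2) by simp
  qed
  show "a = of_real (-r) * (z * cis \<delta>)" if "half_phase a z \<delta> = extremal_phase (-r) \<delta>"
  proof -
    have "norm a = r \<and> - Re v = r"
      using that unfolding half_phase_def extremal_phase_arccot[OF r0(2) d] eq' v_def[symmetric]
      by (intro N(2)) simp
    then have "v = of_real (-r)"
      using vr v(1) by (metis abs_minus_cancel abs_norm_cancel add.inverse_inverse)
    then show ?thesis
      using v(2) by simp
  qed
qed

section \<open>The roots of \<open>z\<^sup>2 B(z) = 1\<close> and partial fractions\<close>

lemma card_roots_rsquarefree:
  fixes p :: "complex poly"
  assumes "rsquarefree p" "p \<noteq> 0"
  shows "card {z. poly p z = 0} = degree p"
proof -
  have "degree p = degree (\<Prod>z | poly p z = 0. [:-z, 1:])"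
    using complex_poly_decompose_rsquarefree[OF assms(1)] assms(2)
    by (metis degree_smult_eq leading_coeff_0_iff)
  also have "\<dots> = card {z. poly p z = 0}"
    by (subst degree_prod_sum_eq) auto
  finally show ?thesis ..
qed

text \<open>Lagrange interpolation: q has smaller degree than p, which has as many roots as its
  degree, so q equals its interpolation polynomial at these roots. \<open>P \<zeta>\<close> is p
  with the factor at \<zeta> removed, and its value at \<zeta> is p'(\<zeta>).\<close>

lemma partial_fractions_simple_roots:
  fixes p q :: "complex poly"
  assumes p: "rsquarefree p" and deg: "degree q < degree p" and z: "poly p z \<noteq> 0"
  shows "poly q z / poly p z =
    (\<Sum>\<zeta> | poly p \<zeta> = 0. poly q \<zeta> / (poly (pderiv p) \<zeta> * (z - \<zeta>)))"
proof -
  define R where "R = {\<zeta>. poly p \<zeta> = 0}"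
  define l where "l = lead_coeff p"
  define P where "P \<zeta> = smult l (\<Prod>\<xi>\<in>R - {\<zeta>}. [:-\<xi>, 1:])" for \<zeta>
  have p0: "p \<noteq> 0"
    using deg by auto
  have fin: "finite R"
    unfolding R_def using p0 by (rule poly_roots_finite)
  have card: "card R = degree p"
    unfolding R_def using p p0 by (rule card_roots_rsquarefree)
  have split: "p = [:-\<zeta>, 1:] * P \<zeta>" if "\<zeta> \<in> R" for \<zeta>
  proof -
    have "p = smult l (\<Prod>\<xi>\<in>R. [:-\<xi>, 1:])"
      using complex_poly_decompose_rsquarefree[OF p] by (simp add: R_def l_def)
    also have "(\<Prod>\<xi>\<in>R. [:-\<xi>, 1:]) = [:-\<zeta>, 1:] * (\<Prod>\<xi>\<in>R - {\<zeta>}. [:-\<xi>, 1:])"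
      using that fin by (simp add: prod.remove)
    finally show ?thesis
      by (simp add: P_def)
  qed
  have deriv: "poly (pderiv p) \<zeta> = poly (P \<zeta>) \<zeta>" if "\<zeta> \<in> R" for \<zeta>
    by (subst split[OF that], subst pderiv_mult) (simp add: pderiv_pCons)
  have deriv0: "poly (P \<zeta>) \<zeta> \<noteq> 0" if "\<zeta> \<in> R" for \<zeta>
    using that p p0 deriv[OF that] by (auto simp: rsquarefree_roots R_def)
  have off: "poly (P \<zeta>) \<xi> = 0" if "\<xi> \<in> R" "\<zeta> \<noteq> \<xi>" for \<zeta> \<xi>
    using that fin by (auto simp: P_def poly_prod)
  define L where "L = (\<Sum>\<zeta>\<in>R. smult (poly q \<zeta> / poly (P \<zeta>) \<zeta>) (P \<zeta>))"
  have degP: "degree (P \<zeta>) < card R" if "\<zeta> \<in> R" for \<zeta>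
  proof -
    have "degree p = degree [:-\<zeta>, 1:] + degree (P \<zeta>)"
      using p0 split[OF that] by (metis degree_mult_eq mult_eq_0_iff)
    then show ?thesis
      using card by simp
  qed
  have "degree L \<le> card R - 1"
    unfolding L_def using degP by (intro degree_sum_le fin order.trans[OF degree_smult_le]) fastforce
  then have degL: "degree L < card R"
    using deg card by linarith
  have "poly L \<xi> = poly q \<xi>" if "\<xi> \<in> R" for \<xi>
  proof -
    have "poly L \<xi> = (\<Sum>\<zeta>\<in>R. if \<zeta> = \<xi> then poly q \<xi> else 0)"
      unfolding L_def poly_sum using off[OF that] deriv0[OF that] by (intro sum.cong) auto
    then show ?thesis
      using that fin by simp
  qed
  then have "q = L"
    using degL deg card by (intro poly_eqI_degree[of R]) auto
  then have "poly q z / poly p z = poly L z / poly p z"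
    by simp
  also have "\<dots> = (\<Sum>\<zeta>\<in>R. poly q \<zeta> / poly (P \<zeta>) \<zeta> * poly (P \<zeta>) z / poly p z)"
    by (simp add: L_def poly_sum sum_divide_distrib)
  also have "\<dots> = (\<Sum>\<zeta>\<in>R. poly q \<zeta> / (poly (pderiv p) \<zeta> * (z - \<zeta>)))"
  proof (rule sum.cong)
    fix \<zeta> assume \<zeta>: "\<zeta> \<in> R"
    have "poly p z = (z - \<zeta>) * poly (P \<zeta>) z"
      by (subst split[OF \<zeta>]) (simp add: algebra_simps)
    then show "poly q \<zeta> / poly (P \<zeta>) \<zeta> * poly (P \<zeta>) z / poly p z = poly q \<zeta> / (poly (pderiv p) \<zeta> * (z - \<zeta>))"
      using z by (simp add: deriv[OF \<zeta>])
  qed auto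
  finally show ?thesis
    by (simp add: R_def)
qed

text \<open>One identity serves both sides of the circle: the sign of 1 - |z|^2 decides whether a
  Blaschke factor has modulus below or above 1.\<close>

lemma blaschke_factor_norm_diff:
  "(norm (1 - cnj a * z))\<^sup>2 - (norm (z - a))\<^sup>2 = (1 - (norm a)\<^sup>2) * (1 - (norm z)\<^sup>2)"
  by (simp only: cmod_power2) (simp add: power2_eq_square algebra_simps)

locale blaschke_zeros =
  fixes n :: nat and a :: "nat \<Rightarrow> complex"
  assumes zeros_in_disk: "k \<in> {1..n} \<Longrightarrow> norm (a k) < 1"
begin

text \<open>Not restricted to the circle, so that it can be identified with the full zero set of a
  polynomial. Poles of B do not enter: division by 0 makes the product 0 there.\<close>

definition R :: "complex set" where
  "R = {z. z\<^sup>2 * blaschke n a z = 1}"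

definition num :: "complex poly" where
  "num = monom 1 2 * (\<Prod>k=1..n. [:- a k, 1:])"

definition den :: "complex poly" where
  "den = (\<Prod>k=1..n. [:1, - cnj (a k):])"

text \<open>The angular derivative of \<open>z\<^sup>2 B(z)\<close> on the unit circle.\<close>
definition speed :: "complex \<Rightarrow> real" where
  "speed z = 2 + (\<Sum>k=1..n. (1 - (norm (a k))\<^sup>2) / (norm (z - a k))\<^sup>2)"

text \<open>The exponents of the Schwarz-Christoffel integral: \<open>\<pi> * \<beta> z\<close> is the exterior angle at the
  vertex with pre-vertex \<open>z\<close>.\<close>
definition \<beta> :: "complex \<Rightarrow> real" where
  "\<beta> z = 2 / speed z"

lemma poly_num: "poly num z = z\<^sup>2 * (\<Prod>k=1..n. z - a k)"
  by (simp add: num_def poly_prod poly_monom)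

lemma poly_den: "poly den z = (\<Prod>k=1..n. 1 - cnj (a k) * z)"
  by (simp add: den_def poly_prod mult.commute)

lemma blaschke_eq_quotient: "z\<^sup>2 * blaschke n a z = poly num z / poly den z"
  by (simp add: blaschke_def poly_num poly_den prod_dividef)

lemma den_nonzero:
  assumes "norm z \<le> 1"
  shows "poly den z \<noteq> 0"
proof -
  have "cnj (a k) * z \<noteq> 1" if "k \<in> {1..n}" for k
  proof
    assume "cnj (a k) * z = 1"
    then have "norm (a k) * norm z = 1"
      by (metis complex_mod_cnj norm_mult norm_one)
    moreover have "norm (a k) * norm z \<le> norm (a k) * 1"
      using assms by (intro mult_left_mono) auto
    ultimately show False
      using zeros_in_disk[OF that] by linarith
  qed
  then show ?thesis
    by (auto simp: poly_den)
qed

lemma blaschke_norm_le: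
  assumes "norm z \<le> 1"
  shows "norm (blaschke n a z) \<le> 1"
proof -
  have "norm ((z - a k) / (1 - cnj (a k) * z)) \<le> 1" if "k \<in> {1..n}" for k
  proof -
    have "(1 - (norm (a k))\<^sup>2) * (1 - (norm z)\<^sup>2) \<ge> 0"
      using norm_less_1_sq[OF zeros_in_disk[OF that]] assms by (intro mult_nonneg_nonneg) (auto simp: power_le_one)
    then have "(norm (z - a k))\<^sup>2 \<le> (norm (1 - cnj (a k) * z))\<^sup>2"
      using blaschke_factor_norm_diff[of "a k" z] by linarith
    then have "norm (z - a k) \<le> norm (1 - cnj (a k) * z)"
      by (rule power2_le_imp_le) simp
    then show ?thesis
      by (simp add: norm_divide divide_le_eq_1)
  qed
  then show ?thesis
    unfolding blaschke_def prod_norm[symmetric] by (intro prod_le_1) auto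
qed

lemma norm_sq_blaschke_less:
  assumes "norm z < 1"
  shows "norm (z\<^sup>2 * blaschke n a z) < 1"
proof -
  have "norm (z\<^sup>2 * blaschke n a z) \<le> (norm z)\<^sup>2 * 1"
    unfolding norm_mult norm_power using blaschke_norm_le[of z] assms by (intro mult_left_mono) auto
  also have "\<dots> < 1"
    using norm_less_1_sq[OF assms] by simp
  finally show ?thesis .
qed

text \<open>Inside the disk |z^2 B(z)| is below 1, outside it exceeds 1.\<close>

lemma R_unit:
  assumes "z \<in> R"
  shows "norm z = 1"
proof (rule ccontr)
  assume "norm z \<noteq> 1"
  moreover have "\<not> norm z < 1"
    using norm_sq_blaschke_less[of z] assms by (auto simp: R_def)
  ultimately have z: "norm z > 1"
    by simp
  have B: "blaschke n a z \<noteq> 0"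
    using assms by (auto simp: R_def)
  have "norm ((z - a k) / (1 - cnj (a k) * z)) \<ge> 1" if "k \<in> {1..n}" for k
  proof -
    have "1 - (norm z)\<^sup>2 < 0"
      using z by (simp add: less_1_mult power2_eq_square)
    then have "(1 - (norm (a k))\<^sup>2) * (1 - (norm z)\<^sup>2) < 0"
      using norm_less_1_sq[OF zeros_in_disk[OF that]] by (simp add: mult_pos_neg)
    then have "(norm (z - a k))\<^sup>2 > (norm (1 - cnj (a k) * z))\<^sup>2"
      using blaschke_factor_norm_diff[of "a k" z] by linarith
    then have "norm (z - a k) > norm (1 - cnj (a k) * z)"
      by (rule power_less_imp_less_base) simp
    \<comment> \<open>A vanishing denominator would make this factor 0, against B(z) \<noteq>
      0.\<close>
    moreover have "1 - cnj (a k) * z \<noteq> 0"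
      using B that by (auto simp: blaschke_def)
    ultimately show ?thesis
      by (simp add: norm_divide)
  qed
  then have "norm (blaschke n a z) \<ge> 1"
    unfolding blaschke_def prod_norm[symmetric] by (intro prod_ge_1) auto
  then have "1 * 1 < (norm z)\<^sup>2 * norm (blaschke n a z)"
    using z by (intro mult_less_le_imp_less) (auto simp: one_less_power)
  moreover have "(norm z)\<^sup>2 * norm (blaschke n a z) = 1"
    using assms by (simp add: R_def norm_mult[symmetric] norm_power[symmetric])
  ultimately show False
    by simp
qed

lemma R_eq_roots: "R = {z. poly (num - den) z = 0}"
proof -
  have "z \<in> R \<longleftrightarrow> poly num z = poly den z" for z
  proof
    assume "z \<in> R"
    then show "poly num z = poly den z"
      using den_nonzero[of z] R_unit[of z] by (simp add: R_def blaschke_eq_quotient)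
  next
    assume eq: "poly num z = poly den z"
    \<comment> \<open>A common zero of \<open>num\<close> and \<open>den\<close> is 0 or some
      \<open>a k\<close>, hence in the disk, where \<open>den\<close> has no zeros.\<close>
    have "poly den z \<noteq> 0"
    proof
      assume "poly den z = 0"
      then have "norm z \<le> 1"
        using eq zeros_in_disk by (fastforce simp: poly_num)
      then show False
        using den_nonzero \<open>poly den z = 0\<close> by blast
    qed
    then show "z \<in> R"
      using eq by (simp add: R_def blaschke_eq_quotient)
  qed
  then show ?thesis
    by auto
qed

lemma speed_ge: "speed z \<ge> 2"
proof -
  have "(\<Sum>k=1..n. (1 - (norm (a k))\<^sup>2) / (norm (z - a k))\<^sup>2) \<ge> 0"
    using norm_less_1_sq[OF zeros_in_disk] by (intro sum_nonneg) (simp add: less_imp_le)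
  then show ?thesis
    by (simp add: speed_def)
qed

lemma beta_pos: "\<beta> z > 0"
  using speed_ge[of z] by (simp add: \<beta>_def)

text \<open>On the circle 1 - cnj a z = z cnj (z - a), which makes z times the logarithmic
  derivative of each factor real and positive. Positivity of the sum is what makes all roots
  simple.\<close>

lemma pderiv_num_den:
  assumes z: "norm z = 1"
  shows "z * poly (pderiv num) z / poly num z - z * poly (pderiv den) z / poly den z = speed z"
proof -
  have nz: "z - a k \<noteq> 0" "1 - cnj (a k) * z \<noteq> 0" if "k \<in> {1..n}" for k
    using blaschke_factor_ne0[OF zeros_in_disk[OF that] z] by auto
  have z0: "z \<noteq> 0"
    using z by auto
  have P: "poly (pderiv (prod f {1..m})) z = (\<Sum>k=1..m. poly (pderiv (f k)) z / poly (f k) z) * poly (prod f {1..m}) z"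
    if "\<And>k. k \<in> {1..m} \<Longrightarrow> poly (f k) z \<noteq> 0" for f :: "nat \<Rightarrow> complex poly" and m
    using that
  proof (induction m)
    case (Suc m)
    then show ?case
      by (simp add: pderiv_mult algebra_simps)
  qed simp
  have cancel: "z * (x * y) / y = z * x" if "y \<noteq> 0" for x y :: complex
    using that by simp
  have 1: "poly (pderiv num) z = (2 / z + (\<Sum>k=1..n. 1 / (z - a k))) * poly num z"
    unfolding num_def pderiv_mult using z0 nz
    by (subst poly_add, subst (1 2) poly_mult, subst P)
       (auto simp: pderiv_monom poly_monom pderiv_pCons poly_prod field_simps power2_eq_square)
  have 2: "poly (pderiv den) z = (\<Sum>k=1..n. - cnj (a k) / (1 - cnj (a k) * z)) * poly den z"
    unfolding den_def using nz
    by (subst P) (auto simp: pderiv_pCons mult.commute)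
  have 3: "z / (z - a k) + cnj (a k) * z / (1 - cnj (a k) * z) = (1 - (norm (a k))\<^sup>2) / (norm (z - a k))\<^sup>2"
    if "k \<in> {1..n}" for k
  proof -
    have ck: "1 - cnj (a k) * z = z * cnj (z - a k)"
      using cnj_unit_mult[OF z] by (simp add: algebra_simps)
    have "z / (z - a k) + cnj (a k) * z / (1 - cnj (a k) * z) = z * (1 - a k * cnj (a k)) / ((z - a k) * (1 - cnj (a k) * z))"
      using nz[OF that] by (simp add: field_simps)
    also have "\<dots> = z * (1 - a k * cnj (a k)) / ((z - a k) * (z * cnj (z - a k)))"
      unfolding ck ..
    also have "z * (1 - a k * cnj (a k)) / ((z - a k) * (z * cnj (z - a k))) = (1 - a k * cnj (a k)) / ((z - a k) * cnj (z - a k))"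
      using z0 by simp
    finally show ?thesis
      by (simp only: complex_norm_square[symmetric] of_real_diff of_real_divide of_real_1)
  qed
  have "poly num z \<noteq> 0" "poly den z \<noteq> 0"
    using nz z0 by (auto simp: poly_num poly_den)
  then have "z * poly (pderiv num) z / poly num z - z * poly (pderiv den) z / poly den z
     = 2 + (\<Sum>k=1..n. z / (z - a k) + cnj (a k) * z / (1 - cnj (a k) * z))"
    unfolding 1 2 using z0 by (simp only: cancel simp_thms) (simp add: distrib_left sum_distrib_left sum.distrib sum_negf mult.commute)
  also have "\<dots> = speed z"
    unfolding speed_def using 3 by simp
  finally show ?thesis .
qed

lemma pderiv_at_root:
  assumes "\<zeta> \<in> R"
  shows "\<zeta> * poly (pderiv (num - den)) \<zeta> = poly den \<zeta> * speed \<zeta>"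
proof -
  have 1: "norm \<zeta> = 1" and 2: "poly num \<zeta> = poly den \<zeta>"
    using assms R_unit R_eq_roots by auto
  have 3: "poly den \<zeta> \<noteq> 0"
    using 1 den_nonzero by simp
  show ?thesis
    using pderiv_num_den[OF 1] 3 unfolding 2 by (simp add: pderiv_diff field_simps)
qed

lemma degree_den: "degree den \<le> n"
proof -
  have "degree den \<le> (\<Sum>k=1..n. degree [:1, - cnj (a k):])"
    unfolding den_def using degree_prod_sum_le[of "{1..n}" "\<lambda>k. [:1, - cnj (a k):]"] by (simp add: o_def)
  also have "\<dots> \<le> (\<Sum>k=1..n. 1)"
    by (intro sum_mono) auto
  finally show ?thesis by simp
qed

lemma degree_num_den: "degree (num - den) = n + 2"
proof -
  have "degree num = n + 2"
    unfolding num_def by (subst degree_mult_eq) (auto simp: degree_monom_eq degree_prod_sum_eq)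
  then show ?thesis
    using degree_den degree_add_eq_left[of "- den" num] by simp
qed

lemma rsquarefree_num_den: "rsquarefree (num - den)"
proof -
  have "poly (pderiv (num - den)) \<zeta> \<noteq> 0" if "\<zeta> \<in> R" for \<zeta>
  proof
    assume "poly (pderiv (num - den)) \<zeta> = 0"
    then have "poly den \<zeta> * speed \<zeta> = 0"
      using pderiv_at_root[OF that] by simp
    then show False
      using den_nonzero R_unit[OF that] speed_ge[of \<zeta>] by auto
  qed
  then show ?thesis
    unfolding rsquarefree_roots R_eq_roots by auto
qed

lemma card_R: "card R = n + 2"
  unfolding R_eq_roots using rsquarefree_num_den degree_num_den
  by (subst card_roots_rsquarefree) auto

lemma finite_R: "finite R"
  using card_R card.infinite by fastforce

text \<open>The residue at \<zeta> is den / (num - den)' = \<zeta> / speed, which explains the value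
  2 / speed of the exponent.\<close>

lemma partial_fractions_B:
  assumes z: "norm z < 1"
  shows "1 / (z\<^sup>2 * blaschke n a z - 1) = (\<Sum>\<zeta>\<in>R. of_real (\<beta> \<zeta>) * \<zeta> / 2 / (z - \<zeta>))"
proof -
  have d: "poly den z \<noteq> 0" and p: "poly (num - den) z \<noteq> 0"
    using den_nonzero z R_unit[of z] R_eq_roots by auto
  have "1 / (z\<^sup>2 * blaschke n a z - 1) = poly den z / poly (num - den) z"
    unfolding blaschke_eq_quotient using d p by (simp add: divide_simps)
  also have "\<dots> = (\<Sum>\<zeta>\<in>R. poly den \<zeta> / (poly (pderiv (num - den)) \<zeta> * (z - \<zeta>)))"
    unfolding R_eq_roots using degree_den degree_num_den p
    by (intro partial_fractions_simple_roots rsquarefree_num_den) auto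
  also have "\<dots> = (\<Sum>\<zeta>\<in>R. of_real (\<beta> \<zeta>) * \<zeta> / 2 / (z - \<zeta>))"
  proof (rule sum.cong)
    fix \<zeta> assume \<zeta>: "\<zeta> \<in> R"
    have nz: "\<zeta> \<noteq> 0" "poly den \<zeta> \<noteq> 0" "speed \<zeta> > 0"
      using R_unit[OF \<zeta>] den_nonzero[of \<zeta>] speed_ge[of \<zeta>] by auto
    have "poly (pderiv (num - den)) \<zeta> = poly den \<zeta> * speed \<zeta> / \<zeta>"
      using pderiv_at_root[OF \<zeta>] nz by (simp add: field_simps)
    then show "poly den \<zeta> / (poly (pderiv (num - den)) \<zeta> * (z - \<zeta>)) = of_real (\<beta> \<zeta>) * \<zeta> / 2 / (z - \<zeta>)"
      using nz by (simp add: \<beta>_def)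
  qed auto
  finally show ?thesis .
qed

text \<open>Evaluation of the partial fractions at 0, where the left side is -1. Geometrically it
  says that the exterior angles add up to 2 pi.\<close>

lemma sum_beta: "(\<Sum>\<zeta>\<in>R. \<beta> \<zeta>) = 2"
proof -
  have "- 1 = (\<Sum>\<zeta>\<in>R. of_real (\<beta> \<zeta>) * \<zeta> / 2 / (0 - \<zeta>))"
    using partial_fractions_B[of 0] by simp
  also have "\<dots> = (\<Sum>\<zeta>\<in>R. - (of_real (\<beta> \<zeta>) / 2))"
    using R_unit by (intro sum.cong) (fastforce simp: field_simps)+
  also have "\<dots> = - (of_real (\<Sum>\<zeta>\<in>R. \<beta> \<zeta>) / 2)"
    by (simp add: sum_negf sum_divide_distrib)
  finally have "of_real (\<Sum>\<zeta>\<in>R. \<beta> \<zeta>) = (2 :: complex)"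
    by simp
  then show ?thesis
    by (metis of_real_eq_iff of_real_numeral)
qed

text \<open>The left side is the logarithmic derivative of the product \<open>g\<close>. The right
  side vanishes at 0, so g'(0) = 0 and g / z^2 has no residue that would make its primitive
  multivalued.\<close>

lemma partial_fractions_zB:
  assumes z: "norm z < 1"
  shows "(\<Sum>\<zeta>\<in>R. of_real (\<beta> \<zeta>) / (z - \<zeta>)) = 2 * z * blaschke n a z / (z\<^sup>2 * blaschke n a z - 1)"
proof -
  define l where "l = (\<lambda>z. \<Sum>\<zeta>\<in>R. of_real (\<beta> \<zeta>) / (z - \<zeta>))"
  define r where "r = (\<lambda>z. 2 * z * blaschke n a z / (z\<^sup>2 * blaschke n a z - 1))"
  have ne: "w\<^sup>2 * blaschke n a w - 1 \<noteq> 0" "w \<notin> R" if "norm w < 1" for w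
    using norm_sq_blaschke_less[OF that] R_unit[of w] that by auto
  have off: "l w = r w" if "norm w < 1" "w \<noteq> 0" for w
  proof -
    have "w * l w = (\<Sum>\<zeta>\<in>R. of_real (\<beta> \<zeta>) * (1 + \<zeta> / (w - \<zeta>)))"
      unfolding l_def sum_distrib_left
    proof (rule sum.cong)
      fix \<zeta> assume "\<zeta> \<in> R"
      then have "w - \<zeta> \<noteq> 0"
        using ne(2)[OF that(1)] by auto
      then show "w * (of_real (\<beta> \<zeta>) / (w - \<zeta>)) = of_real (\<beta> \<zeta>) * (1 + \<zeta> / (w - \<zeta>))"
        by (simp add: field_simps)
    qed auto
    also have "\<dots> = of_real (\<Sum>\<zeta>\<in>R. \<beta> \<zeta>) + 2 * (\<Sum>\<zeta>\<in>R. of_real (\<beta> \<zeta>) * \<zeta> / 2 / (w - \<zeta>))"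
      by (simp add: distrib_left sum.distrib sum_distrib_left del: divide_divide_eq_left)
    also have "\<dots> = 2 + 2 * (1 / (w\<^sup>2 * blaschke n a w - 1))"
      unfolding sum_beta partial_fractions_B[OF that(1)] by simp
    also have "\<dots> = w * r w"
      using ne(1)[OF that(1)] by (simp add: r_def divide_simps) (simp add: power2_eq_square)
    finally show ?thesis
      using that by simp
  qed
  \<comment> \<open>The identity was obtained after multiplication by w, so the value at 0 has to
    come from continuity.\<close>
  have "l 0 = r 0"
  proof (rule LIM_unique)
    have "isCont l 0"
      unfolding l_def using R_unit[of 0] by (intro continuous_intros) auto
    then show "l \<midarrow>0\<rightarrow> l 0"
      by (simp add: isCont_def)
    have "isCont r 0"
      unfolding r_def blaschke_def by (intro continuous_intros) auto
    then have "r \<midarrow>0\<rightarrow> r 0"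
      by (simp add: isCont_def)
    moreover have "eventually (\<lambda>w. r w = l w) (at 0)"
      unfolding eventually_at using off by (intro exI[of _ 1]) auto
    ultimately show "l \<midarrow>0\<rightarrow> r 0"
      using tendsto_cong by fast
  qed
  then show ?thesis
    using off[OF z] by (cases "z = 0") (auto simp: l_def r_def)
qed

end

section \<open>The Schwarz-Christoffel integral\<close>

context blaschke_zeros
begin

text \<open>Principal powers are continuous up to the circle here, because 1 - z / \<zeta> stays in
  the closed right half plane and the exponents are positive.\<close>

definition g :: "complex \<Rightarrow> complex" where
  "g z = (\<Prod>\<zeta>\<in>R. (1 - z / \<zeta>) powr of_real (\<beta> \<zeta>))"

lemma g_factor:
  assumes "\<zeta> \<in> R"
  shows "norm z \<le> 1 \<Longrightarrow> Re (1 - z / \<zeta>) \<ge> 0" "norm z < 1 \<Longrightarrow> Re (1 - z / \<zeta>) > 0"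
  using complex_Re_le_cmod[of "z / \<zeta>"] R_unit[OF assms] by (auto simp: norm_divide)

lemma continuous_on_g: "continuous_on (cball 0 1) g"
  unfolding g_def
proof (rule continuous_on_prod)
  fix \<zeta> assume \<zeta>: "\<zeta> \<in> R"
  show "continuous_on (cball 0 1) (\<lambda>z. (1 - z / \<zeta>) powr of_real (\<beta> \<zeta>))"
  proof (rule continuous_on_powr_complex)
    show "cball 0 1 \<subseteq> {z. 0 \<le> Re (1 - z / \<zeta>) \<or> Im (1 - z / \<zeta>) \<noteq> 0}"
      using g_factor(1)[OF \<zeta>] by auto
    show "continuous_on (cball 0 1) (\<lambda>z. 1 - z / \<zeta>)"
      using R_unit[OF \<zeta>] by (intro continuous_intros) auto
  qed (use beta_pos in auto)
qed

lemma has_field_derivative_g: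
  assumes z: "norm z < 1"
  shows "(g has_field_derivative g z * (2 * z * blaschke n a z / (z\<^sup>2 * blaschke n a z - 1))) (at z)"
proof -
  have "((\<lambda>z. (1 - z / \<zeta>) powr of_real (\<beta> \<zeta>)) has_field_derivative
      (1 - z / \<zeta>) powr of_real (\<beta> \<zeta>) * (of_real (\<beta> \<zeta>) / (z - \<zeta>))) (at z)" if \<zeta>: "\<zeta> \<in> R" for \<zeta>
  proof -
    have re: "Re (1 - z / \<zeta>) > 0"
      using g_factor(2)[OF \<zeta> z] .
    then have nr: "1 - z / \<zeta> \<notin> \<real>\<^sub>\<le>\<^sub>0"
      by (auto simp: complex_nonpos_Reals_iff)
    have z0: "\<zeta> \<noteq> 0" "z \<noteq> \<zeta>"
      using R_unit[OF \<zeta>] z by auto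
    have "((\<lambda>z. (1 - z / \<zeta>) powr of_real (\<beta> \<zeta>)) has_field_derivative
        of_real (\<beta> \<zeta>) * (1 - z / \<zeta>) powr (of_real (\<beta> \<zeta>) - 1) * (- 1 / \<zeta>)) (at z)"
      by (rule DERIV_chain2[where f = "\<lambda>w. w powr of_real (\<beta> \<zeta>)" and g = "\<lambda>z. 1 - z / \<zeta>", OF has_field_derivative_powr[OF nr]])
        (use z0 in \<open>auto intro!: derivative_eq_intros\<close>)
    moreover have "(1 - z / \<zeta>) powr (of_real (\<beta> \<zeta>) - 1) = (1 - z / \<zeta>) powr of_real (\<beta> \<zeta>) / (1 - z / \<zeta>)"
      using re by (subst powr_diff) auto
    moreover have "of_real (\<beta> \<zeta>) * (x / (1 - z / \<zeta>)) * (- 1 / \<zeta>) = x * (of_real (\<beta> \<zeta>) / (z - \<zeta>))" for x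
    proof -
      have "1 - z / \<zeta> = (\<zeta> - z) / \<zeta>"
        using z0 by (simp add: field_simps)
      then show ?thesis
        using z0 by (simp add: field_simps)
    qed
    ultimately show ?thesis
      by simp
  qed
  moreover have "(1 - z / \<zeta>) powr of_real (\<beta> \<zeta>) \<noteq> 0" if "\<zeta> \<in> R" for \<zeta>
    using g_factor(2)[OF that z] by auto
  ultimately have "(g has_field_derivative g z * (\<Sum>\<zeta>\<in>R. (1 - z / \<zeta>) powr of_real (\<beta> \<zeta>) *
      (of_real (\<beta> \<zeta>) / (z - \<zeta>)) / (1 - z / \<zeta>) powr of_real (\<beta> \<zeta>))) (at z)"
    unfolding g_def by (rule has_field_derivative_prod'[rotated])
  also have "(\<Sum>\<zeta>\<in>R. (1 - z / \<zeta>) powr of_real (\<beta> \<zeta>) *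
      (of_real (\<beta> \<zeta>) / (z - \<zeta>)) / (1 - z / \<zeta>) powr of_real (\<beta> \<zeta>)) = (\<Sum>\<zeta>\<in>R. of_real (\<beta> \<zeta>) / (z - \<zeta>))"
    using g_factor(2)[OF _ z] by (intro sum.cong) (auto simp: nonzero_mult_div_cancel_left)
  finally show ?thesis
    unfolding partial_fractions_zB[OF z] .
qed

lemma g_nonzero: "norm z < 1 \<Longrightarrow> g z \<noteq> 0"
  using g_factor(2)[of _ z] finite_R by (force simp: g_def)

lemma g_0: "g 0 = 1"
  by (simp add: g_def)

lemma holomorphic_on_g: "g holomorphic_on ball 0 1"
  unfolding holomorphic_on_open[OF open_ball]
proof
  show "\<exists>f'. (g has_field_derivative f') (at z)" if "z \<in> ball 0 1" for z
    using has_field_derivative_g[of z] that by auto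
qed

lemma deriv_g_0: "deriv g 0 = 0"
  using DERIV_imp_deriv[OF has_field_derivative_g[of 0]] by simp

text \<open>The regular part of \<open>g z / z\<^sup>2\<close>; it has no simple pole at 0 because \<open>g' 0 = 0\<close>.\<close>
definition k :: "complex \<Rightarrow> complex" where
  "k z = (if z = 0 then deriv (\<lambda>z. if z = 0 then 0 else (g z - 1) / z) 0 else (g z - 1) / z\<^sup>2)"

lemma holomorphic_on_k: "k holomorphic_on ball 0 1"
proof -
  define q where "q = (\<lambda>z. if z = 0 then 0 else (g z - 1) / z)"
  have "(\<lambda>z. if z = 0 then deriv g 0 else (g z - g 0) / (z - 0)) holomorphic_on ball 0 1"
    by (rule pole_lemma_open) (auto intro: holomorphic_on_g)
  then have "q holomorphic_on ball 0 1"
    unfolding deriv_g_0 g_0 q_def diff_zero .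
  then have "(\<lambda>z. if z = 0 then deriv q 0 else (q z - q 0) / (z - 0)) holomorphic_on ball 0 1"
    by (rule pole_lemma_open) auto
  also have "(\<lambda>z. if z = 0 then deriv q 0 else (q z - q 0) / (z - 0)) = k"
    by (auto simp: k_def q_def power2_eq_square)
  finally show ?thesis .
qed

lemma continuous_on_k: "continuous_on (cball 0 1) k"
  unfolding continuous_on_eq_continuous_within
proof
  fix z :: complex assume z: "z \<in> cball 0 1"
  show "continuous (at z within cball 0 1) k"
  proof (cases "z = 0")
    case True
    have "continuous_on (ball 0 1) k"
      using holomorphic_on_k by (rule holomorphic_on_imp_continuous_on)
    then have "isCont k 0"
      by (rule continuous_on_interior) simp
    then show ?thesis
      unfolding True by (rule continuous_at_imp_continuous_at_within)
  next
    case False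
    have "continuous (at z within cball 0 1) (\<lambda>z. (g z - 1) / z\<^sup>2)"
      using continuous_on_g z False unfolding continuous_on_eq_continuous_within
      by (intro continuous_intros) auto
    moreover have "eventually (\<lambda>w. (g w - 1) / w\<^sup>2 = k w) (at z within cball 0 1)"
      using eventually_neq_at_within[of 0] by eventually_elim (auto simp: k_def)
    ultimately have "(k \<longlongrightarrow> (g z - 1) / z\<^sup>2) (at z within cball 0 1)"
      unfolding continuous_within by (rule Lim_transform_eventually)
    then show ?thesis
      using False by (simp only: continuous_within k_def if_False)
  qed
qed

text \<open>A primitive relative to the closed disk: \<open>k\<close> is continuous there and
  holomorphic inside, which suffices on a convex set. Thus \<open>F\<close> can be differentiated
  along the boundary circle, pre-vertices included.\<close>

definition h :: "complex \<Rightarrow> complex" where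
  "h = (SOME h. \<forall>z\<in>cball 0 1. (h has_field_derivative k z) (at z within cball 0 1))"

lemma has_field_derivative_h:
  assumes "norm z \<le> 1"
  shows "(h has_field_derivative k z) (at z within cball 0 1)"
proof -
  have "\<exists>h. \<forall>z\<in>cball 0 1. (h has_field_derivative k z) (at z within cball 0 1)"
  proof (rule holomorphic_convex_primitive[of "cball 0 1" "{}" k])
    show "k field_differentiable at x" if "x \<in> interior (cball 0 1) - {}" for x
      using that holomorphic_on_k by (auto simp: holomorphic_on_imp_differentiable_at)
  next
    fix h assume "\<And>x. x \<in> cball 0 1 \<Longrightarrow> (h has_field_derivative k x) (at x within cball 0 1)"
    then show ?thesis
      by blast
  qed (use continuous_on_k in auto)
  then show ?thesis
    unfolding h_def by (rule someI2_ex) (use assms in auto)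
qed

definition F :: "complex \<Rightarrow> complex" where
  "F z = h z - 1 / z"

lemma has_field_derivative_F:
  assumes "norm z \<le> 1" "z \<noteq> 0"
  shows "(F has_field_derivative g z / z\<^sup>2) (at z within cball 0 1)"
proof -
  have "((\<lambda>z. 1 / z) has_field_derivative - (1 / z\<^sup>2)) (at z within cball 0 1)"
    using DERIV_inverse[OF assms(2)] by (simp add: inverse_eq_divide power2_eq_square)
  then have "(F has_field_derivative k z - - (1 / z\<^sup>2)) (at z within cball 0 1)"
    unfolding F_def[abs_def] by (rule DERIV_diff[OF has_field_derivative_h[OF assms(1)]])
  also have "k z = (g z - 1) / z\<^sup>2"
    using assms(2) by (simp only: k_def if_False)
  also have "(g z - 1) / z\<^sup>2 - - (1 / z\<^sup>2) = g z / z\<^sup>2"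
    by (simp add: diff_divide_distrib)
  finally show ?thesis .
qed

lemma continuous_on_F: "continuous_on (cball 0 1 - {0}) F"
  unfolding continuous_on_eq_continuous_within
proof
  fix z :: complex assume "z \<in> cball 0 1 - {0}"
  then have "continuous (at z within cball 0 1) F"
    using DERIV_continuous[OF has_field_derivative_F[of z]] by simp
  then show "continuous (at z within cball 0 1 - {0}) F"
    by (rule continuous_within_subset) auto
qed

lemma has_field_derivative_F_interior:
  assumes "norm z < 1" "z \<noteq> 0"
  shows "(F has_field_derivative g z / z\<^sup>2) (at z)"
proof -
  have "at z within cball 0 1 = at z"
    using assms by (intro at_within_interior) auto
  then show ?thesis
    using has_field_derivative_F[of z] assms by simp
qed

lemma holomorphic_on_F: "F holomorphic_on ball 0 1 - {0}"
  unfolding holomorphic_on_open[OF open_delete[OF open_ball]]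
proof
  show "\<exists>f'. (F has_field_derivative f') (at z)" if "z \<in> ball 0 1 - {0}" for z
    using has_field_derivative_F_interior[of z] that by auto
qed

lemma is_pole_F: "is_pole F 0"
proof -
  have "(h has_field_derivative k 0) (at 0 within ball 0 1)"
    using has_field_derivative_h[of 0] by (auto intro: DERIV_subset)
  then have "isCont h 0"
    using at_within_open[of 0 "ball 0 1"] DERIV_isCont by (metis centre_in_ball open_ball zero_less_one)
  then have "h \<midarrow>0\<rightarrow> h 0"
    by (simp add: isCont_def)
  moreover have "filterlim (\<lambda>z::complex. - inverse z) at_infinity (at 0)"
    using filterlim_inverse_at_infinity[where 'a = complex]
    unfolding filterlim_at_infinity_conv_norm_at_top norm_minus_cancel .
  ultimately have "filterlim (\<lambda>z. h z + - inverse z) at_infinity (at 0)"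
    by (rule tendsto_add_filterlim_at_infinity)
  then show ?thesis
    unfolding is_pole_def F_def by (simp add: inverse_eq_divide)
qed

lemma deriv_F: "norm z < 1 \<Longrightarrow> z \<noteq> 0 \<Longrightarrow> deriv F z = g z / z\<^sup>2"
  by (rule DERIV_imp_deriv[OF has_field_derivative_F_interior])

lemma deriv_F_nonzero: "norm z < 1 \<Longrightarrow> z \<noteq> 0 \<Longrightarrow> deriv F z \<noteq> 0"
  by (simp add: deriv_F g_nonzero)

text \<open>From F' = g / z^2 it follows that z F''/F' = z g'/g - 2 = 2 z^2 B / (z^2 B - 1) -
  2.\<close>

lemma ODE_F:
  assumes z: "norm z < 1" "z \<noteq> 0"
  shows "z * (deriv (deriv F) z / deriv F z) = 2 / (z\<^sup>2 * blaschke n a z - 1)"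
proof -
  define b where "b = blaschke n a z"
  have b: "z\<^sup>2 * b - 1 \<noteq> 0"
    using norm_sq_blaschke_less[OF z(1)] by (auto simp: b_def)
  define q where "q = 2 * z * b / (z\<^sup>2 * b - 1)"
  have "((\<lambda>z. g z / z\<^sup>2) has_field_derivative (g z * q * z\<^sup>2 - g z * (2 * z)) / (z\<^sup>2 * z\<^sup>2)) (at z)"
    unfolding q_def b_def using has_field_derivative_g[OF z(1)] z
    by (intro DERIV_divide) (auto intro!: derivative_eq_intros)
  moreover have "eventually (\<lambda>w. g w / w\<^sup>2 = deriv F w) (nhds z)"
  proof -
    have "eventually (\<lambda>w. w \<in> ball 0 1 - {0}) (nhds z)"
      using z by (intro eventually_nhds_in_open) auto
    then show ?thesis
      by eventually_elim (auto simp: deriv_F)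
  qed
  ultimately have "(deriv F has_field_derivative (g z * q * z\<^sup>2 - g z * (2 * z)) / (z\<^sup>2 * z\<^sup>2)) (at z)"
    by (subst (asm) DERIV_cong_ev) auto
  then have "deriv (deriv F) z = (g z * q * z\<^sup>2 - g z * (2 * z)) / (z\<^sup>2 * z\<^sup>2)"
    by (rule DERIV_imp_deriv)
  moreover have "z * (((G * q * z\<^sup>2 - G * (2 * z)) / (z\<^sup>2 * z\<^sup>2)) / (G / z\<^sup>2)) = z * q - 2" if "G \<noteq> 0" for G
    using that z by (simp add: field_simps power2_eq_square)
  ultimately have "z * (deriv (deriv F) z / deriv F z) = z * q - 2"
    using g_nonzero[OF z(1)] by (simp only: deriv_F[OF z])
  also have "\<dots> = 2 / (z\<^sup>2 * b - 1)"
    unfolding q_def using b by (simp add: field_simps power2_eq_square)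
  finally show ?thesis
    by (simp add: b_def)
qed

end

section \<open>The boundary curve\<close>

text \<open>While \<sigma> decreases within [0, 2 pi], sin \<sigma> passes from nonpositive to
  nonnegative values, so L falls and then rises. A value at t above both ends would, by the mean
  value theorem, produce a positive slope followed by a negative one.\<close>

lemma quasiconvex_of_turning:
  fixes L m \<sigma> :: "real \<Rightarrow> real"
  assumes xty: "x < t" "t < y"
    and cont: "continuous_on {x..y} L"
    and deriv: "\<And>\<xi>. x < \<xi> \<Longrightarrow> \<xi> < y \<Longrightarrow> (L has_real_derivative m \<xi> * sin (\<sigma> \<xi>)) (at \<xi>)"
    and m: "\<And>\<xi>. m \<xi> \<ge> 0"
    and \<sigma>: "\<And>\<xi>. x < \<xi> \<Longrightarrow> \<xi> < y \<Longrightarrow> 0 \<le> \<sigma> \<xi> \<and> \<sigma> \<xi> \<le> 2 * pi"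
    and anti: "\<And>\<xi> \<eta>. x < \<xi> \<Longrightarrow> \<xi> < \<eta> \<Longrightarrow> \<eta> < y \<Longrightarrow> \<sigma> \<eta> \<le> \<sigma> \<xi>"
  shows "L t \<le> max (L x) (L y)"
proof (rule ccontr)
  assume "\<not> L t \<le> max (L x) (L y)"
  then have L: "L x < L t" "L y < L t"
    by auto
  have "continuous_on {x..t} L" "continuous_on {t..y} L"
    using cont xty by (auto intro: continuous_on_subset)
  moreover have "L differentiable (at \<xi>)" if "x < \<xi>" "\<xi> < y" for \<xi>
    using deriv[OF that] real_differentiable_def by blast
  ultimately have "\<exists>l \<xi>. x < \<xi> \<and> \<xi> < t \<and> (L has_real_derivative l) (at \<xi>) \<and> L t - L x = (t - x) * l"
    and "\<exists>l \<eta>. t < \<eta> \<and> \<eta> < y \<and> (L has_real_derivative l) (at \<eta>) \<and> L y - L t = (y - t) * l"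
    using xty by (auto intro!: MVT)
  then obtain \<xi> \<eta> l l' where
    \<xi>: "x < \<xi>" "\<xi> < t" "(L has_real_derivative l) (at \<xi>)" "L t - L x = (t - x) * l" and
    \<eta>: "t < \<eta>" "\<eta> < y" "(L has_real_derivative l') (at \<eta>)" "L y - L t = (y - t) * l'"
    by blast
  have "(t - x) * l > 0" "(y - t) * l' < 0"
    using L \<xi> \<eta> by linarith+
  then have "l > 0" "l' < 0"
    using xty by (auto simp: zero_less_mult_iff mult_less_0_iff)
  moreover have "l = m \<xi> * sin (\<sigma> \<xi>)" "l' = m \<eta> * sin (\<sigma> \<eta>)"
    using DERIV_unique[OF \<xi>(3) deriv] DERIV_unique[OF \<eta>(3) deriv] \<xi> \<eta> xty by auto
  ultimately have s: "sin (\<sigma> \<xi>) > 0" "sin (\<sigma> \<eta>) < 0"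
    using m[of \<xi>] m[of \<eta>] by (auto simp: zero_less_mult_iff mult_less_0_iff)
  have "\<sigma> \<xi> < pi"
  proof (rule ccontr)
    assume "\<not> \<sigma> \<xi> < pi"
    moreover have "\<sigma> \<xi> \<le> 2 * pi"
      using \<sigma>[of \<xi>] \<xi> xty by linarith
    ultimately have "sin (\<sigma> \<xi>) \<le> 0"
      using sin_le_zero[of "\<sigma> \<xi>"] by (cases "\<sigma> \<xi> = 2 * pi") simp_all
    then show False
      using s by simp
  qed
  then have "0 \<le> \<sigma> \<eta>" "\<sigma> \<eta> \<le> pi"
    using anti[of \<xi> \<eta>] \<sigma>[of \<eta>] \<xi> \<eta> by linarith+
  then have "sin (\<sigma> \<eta>) \<ge> 0"
    by (rule sin_ge_zero)
  then show False
    using s by simp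
qed

lemma one_minus_cis_polar:
  "1 - cis u = of_real (2 * sin (u / 2)) * cis ((u - pi) / 2)"
proof -
  have "cos u = 1 - 2 * (sin (u / 2))\<^sup>2" "sin u = 2 * sin (u / 2) * cos (u / 2)"
    using cos_double_sin[of "u / 2"] sin_double[of "u / 2"] by auto
  moreover have "cos ((u - pi) / 2) = sin (u / 2)" "sin ((u - pi) / 2) = - cos (u / 2)"
    by (simp_all add: diff_divide_distrib cos_diff sin_diff)
  ultimately show ?thesis
    by (simp add: complex_eq_iff power2_eq_square)
qed

text \<open>The argument of 1 - e^(iu) grows at rate 1/2 and drops by pi as u passes 0. Multiplied
  by the exponent, this drop becomes the exterior angle at a vertex. Where 1 - e^(iu) = 0 both sides
  are 0.\<close>

lemma one_minus_cis_powr: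
  assumes u: "- 2 * pi \<le> u" "u \<le> 2 * pi" and b: "b > 0"
  shows "(1 - cis u) powr of_real b =
    of_real (norm (1 - cis u) powr b) * cis (b * ((u - pi) / 2 + (if u < 0 then pi else 0)))"
proof (cases "1 - cis u = 0")
  case False
  define \<phi> where "\<phi> = (u - pi) / 2 + (if u < 0 then pi else 0)"
  define r where "r = norm (1 - cis u)"
  have r: "r > 0"
    using False by (simp add: r_def)
  have u0: "u \<noteq> 0" "u \<noteq> 2 * pi" "u \<noteq> - (2 * pi)"
    using False by (auto simp: complex_eq_iff)
  have \<phi>: "- pi < \<phi>" "\<phi> \<le> pi"
    using u u0 by (auto simp: \<phi>_def field_simps)
  have "1 - cis u = of_real r * cis \<phi>"
  proof (cases "u < 0")
    case True
    have "sin (u / 2) < 0"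
      using u u0 True sin_gt_zero[of "- (u / 2)"] by auto
    then have "r = - (2 * sin (u / 2))"
      unfolding r_def one_minus_cis_polar by (simp add: norm_mult)
    moreover have "cis \<phi> = - cis ((u - pi) / 2)"
      using True by (simp add: \<phi>_def cis_mult[symmetric])
    ultimately show ?thesis
      unfolding one_minus_cis_polar by simp
  next
    case False
    have "sin (u / 2) > 0"
      using u u0 False by (intro sin_gt_zero) auto
    then have "r = 2 * sin (u / 2)"
      unfolding r_def one_minus_cis_polar by (simp add: norm_mult)
    then show ?thesis
      unfolding one_minus_cis_polar using False by (simp add: \<phi>_def)
  qed
  also have "\<dots> = exp (of_real (ln r) + \<i> * of_real \<phi>)"
    using r by (simp add: exp_add exp_of_real cis_conv_exp)
  finally have "Ln (1 - cis u) = of_real (ln r) + \<i> * of_real \<phi>"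
    using \<phi> by (intro Ln_unique) auto
  then have "(1 - cis u) powr of_real b = exp (of_real (b * ln r)) * exp (\<i> * of_real (b * \<phi>))"
    using False by (simp add: powr_def exp_add[symmetric] algebra_simps)
  also have "exp (of_real (b * ln r)) = complex_of_real (r powr b)"
    using r by (simp add: powr_def flip: exp_of_real)
  finally show ?thesis
    by (simp only: cis_conv_exp \<phi>_def r_def)
qed (use b in simp)

text \<open>The argument of \<open>\<zeta>\<close> in the half-open interval \<open>(s, s + 2\<pi>]\<close>.\<close>
definition arg_from :: "real \<Rightarrow> complex \<Rightarrow> real" where
  "arg_from s \<zeta> = s + (if Arg2pi (\<zeta> / cis s) = 0 then 2 * pi else Arg2pi (\<zeta> / cis s))"

lemma cis_Arg2pi: "norm z = 1 \<Longrightarrow> cis (Arg2pi z) = z"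
  using Arg2pi_eq[of z] by (simp add: cis_conv_exp)

lemma arg_from:
  assumes "norm \<zeta> = 1"
  shows "s < arg_from s \<zeta>" "arg_from s \<zeta> \<le> s + 2 * pi" "cis (arg_from s \<zeta>) = \<zeta>"
proof -
  show "s < arg_from s \<zeta>" "arg_from s \<zeta> \<le> s + 2 * pi"
    using Arg2pi_ge_0[of "\<zeta> / cis s"] Arg2pi_lt_2pi[of "\<zeta> / cis s"] by (auto simp: arg_from_def)
  have "cis (Arg2pi (\<zeta> / cis s)) = \<zeta> / cis s"
    using assms by (intro cis_Arg2pi) (simp add: norm_divide)
  then show "cis (arg_from s \<zeta>) = \<zeta>"
    by (auto simp: arg_from_def cis_mult[symmetric])
qed

lemma arg_from_unique:
  assumes "s < t" "t \<le> s + 2 * pi"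
  shows "arg_from s (cis t) = t"
proof (cases "t = s + 2 * pi")
  case True
  then show ?thesis
    by (simp add: arg_from_def cis_divide Arg2pi_eq_0)
next
  case False
  have "of_real 1 * exp (\<i> * of_real (t - s)) = cis t / cis s"
    by (simp add: cis_divide cis_conv_exp exp_diff right_diff_distrib)
  then have "Arg2pi (cis t / cis s) = t - s"
    using assms False by (intro Arg2pi_unique[of 1]) auto
  then show ?thesis
    using assms by (simp add: arg_from_def)
qed

context blaschke_zeros
begin

text \<open>The direction of the boundary curve at \<open>cis t\<close>, up to a constant, for
  \<open>t \<in> [s, s + 2\<pi>]\<close>: it turns clockwise by \<open>\<pi> * \<beta> \<zeta>\<close> at each pre-vertex \<open>\<zeta>\<close>.\<close>
definition turning :: "real \<Rightarrow> real \<Rightarrow> real" where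
  "turning s t = (\<Sum>\<zeta> | \<zeta> \<in> R \<and> t < arg_from s \<zeta>. pi * \<beta> \<zeta>)"

definition velocity :: "real \<Rightarrow> complex" where
  "velocity t = \<i> * g (cis t) / cis t"

text \<open>What remains of the argument of the velocity once its dependence on t has cancelled.
  Since \<open>turning s\<close> starts at 2 pi, this is the direction in which the curve leaves the
  point with parameter s, even if that point is a vertex.\<close>

definition direction :: "real \<Rightarrow> complex" where
  "direction s = \<i> * cis (- (\<Sum>\<zeta>\<in>R. \<beta> \<zeta> * arg_from s \<zeta>) / 2 - pi)"

lemma norm_direction: "norm (direction s) = 1"
  by (simp add: direction_def norm_mult)

lemma norm_velocity: "norm (velocity t) = norm (g (cis t))"
  by (simp add: velocity_def norm_mult norm_divide)

lemma g_eq_0_iff: "norm z = 1 \<Longrightarrow> g z = 0 \<longleftrightarrow> z \<in> R"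
  using finite_R R_unit by (fastforce simp: g_def)

lemma has_vector_derivative_boundary:
  "((\<lambda>t. F (cis t)) has_vector_derivative velocity t) (at t within T)"
proof -
  have 1: "(cis has_vector_derivative \<i> * cis t) (at t within T)"
    by (auto simp: has_vector_derivative_complex_iff intro!: derivative_eq_intros)
  have 2: "(F has_field_derivative g (cis t) / (cis t)\<^sup>2) (at (cis t) within cis ` T)"
    using has_field_derivative_F[of "cis t"] by (rule DERIV_subset) auto
  have "\<i> * cis t * (g (cis t) / (cis t)\<^sup>2) = velocity t"
    by (simp add: velocity_def power2_eq_square)
  then show ?thesis
    using field_vector_diff_chain_within[OF 1 2] by (simp add: o_def)
qed

lemma velocity_polar:
  assumes t: "s \<le> t" "t \<le> s + 2 * pi"
  shows "velocity t = norm (g (cis t)) * direction s * cis (turning s t)"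
proof -
  have factor: "(1 - cis t / \<zeta>) powr of_real (\<beta> \<zeta>) =
    of_real (norm (1 - cis t / \<zeta>) powr \<beta> \<zeta>) *
    cis (\<beta> \<zeta> * ((t - arg_from s \<zeta> - pi) / 2) + (if t < arg_from s \<zeta> then pi * \<beta> \<zeta> else 0))"
    if \<zeta>: "\<zeta> \<in> R" for \<zeta>
  proof -
    note \<tau> = arg_from[OF R_unit[OF \<zeta>], of s]
    have "cis t / \<zeta> = cis (t - arg_from s \<zeta>)"
      using \<tau>(3) by (metis cis_divide)
    moreover have "- 2 * pi \<le> t - arg_from s \<zeta>" "t - arg_from s \<zeta> \<le> 2 * pi"
      using \<tau> t by auto
    ultimately show ?thesis
      using one_minus_cis_powr[OF _ _ beta_pos, of "t - arg_from s \<zeta>" \<zeta>]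
      by (simp add: algebra_simps)
  qed
  define X where "X = (\<Prod>\<zeta>\<in>R. norm (1 - cis t / \<zeta>) powr \<beta> \<zeta>)"
  define A where "A = (\<Sum>\<zeta>\<in>R. \<beta> \<zeta> * ((t - arg_from s \<zeta> - pi) / 2) + (if t < arg_from s \<zeta> then pi * \<beta> \<zeta> else 0))"
  have "(\<Prod>\<zeta>\<in>A. cis (f \<zeta>)) = cis (\<Sum>\<zeta>\<in>A. f \<zeta>)" for f :: "complex \<Rightarrow> real" and A
    by (induction A rule: infinite_finite_induct) (auto simp: cis_mult)
  then have g: "g (cis t) = of_real X * cis A"
    unfolding g_def X_def A_def by (simp add: factor prod.distrib)
  have "X \<ge> 0"
    unfolding X_def by (intro prod_nonneg) auto
  then have X: "norm (g (cis t)) = X"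
    unfolding g by (simp add: norm_mult)
  have "A = (\<Sum>\<zeta>\<in>R. \<beta> \<zeta> * ((t - pi) / 2)) - (\<Sum>\<zeta>\<in>R. \<beta> \<zeta> * arg_from s \<zeta>) / 2 + turning s t"
  proof -
    have "A = (\<Sum>\<zeta>\<in>R. \<beta> \<zeta> * ((t - pi) / 2) - \<beta> \<zeta> * arg_from s \<zeta> / 2 + (if t < arg_from s \<zeta> then pi * \<beta> \<zeta> else 0))"
      unfolding A_def by (intro sum.cong) (auto simp: field_simps)
    moreover have "turning s t = (\<Sum>\<zeta>\<in>R. if t < arg_from s \<zeta> then pi * \<beta> \<zeta> else 0)"
      unfolding turning_def using finite_R by (simp add: sum.inter_filter)
    ultimately show ?thesis
      by (simp add: sum.distrib sum_subtractf sum_divide_distrib)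
  qed
  \<comment> \<open>Because the exponents sum to 2, the continuous part of the argument of g is t up
    to a constant, and it cancels against the factor 1 / \<open>cis t\<close> of the velocity. Hence
    the edges are straight.\<close>
  also have "(\<Sum>\<zeta>\<in>R. \<beta> \<zeta> * ((t - pi) / 2)) = t - pi"
    unfolding sum_distrib_right[symmetric] sum_beta by simp
  finally have A: "A = t + (- (\<Sum>\<zeta>\<in>R. \<beta> \<zeta> * arg_from s \<zeta>) / 2 - pi) + turning s t"
    by simp
  have "cis A = cis t * cis (- (\<Sum>\<zeta>\<in>R. \<beta> \<zeta> * arg_from s \<zeta>) / 2 - pi) * cis (turning s t)"
    unfolding A by (simp only: cis_mult)
  then show ?thesis
    unfolding velocity_def direction_def X by (simp add: g)
qed

lemma turning_antimono: "t \<le> t' \<Longrightarrow> turning s t' \<le> turning s t"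
  unfolding turning_def using finite_R beta_pos
  by (intro sum_mono2) (auto simp: less_imp_le)

lemma turning_nonneg: "turning s t \<ge> 0"
  unfolding turning_def using beta_pos by (intro sum_nonneg) (simp add: less_imp_le)

lemma turning_eq_2pi:
  assumes "\<And>\<zeta>. \<zeta> \<in> R \<Longrightarrow> t < arg_from s \<zeta>"
  shows "turning s t = 2 * pi"
proof -
  have "{\<zeta>. \<zeta> \<in> R \<and> t < arg_from s \<zeta>} = R"
    using assms by auto
  then show ?thesis
    by (simp add: turning_def sum_distrib_left[symmetric] sum_beta)
qed

lemma turning_le: "s \<le> t \<Longrightarrow> turning s t \<le> 2 * pi"
  using turning_antimono[of s t s] turning_eq_2pi[of s s] arg_from(1)[OF R_unit] by simp

text \<open>The signed height of the boundary point over the line through \<open>F (cis s)\<close>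
  whose direction is the outgoing tangent turned by \<epsilon>; positive values lie to the
  left.\<close>

definition support :: "real \<Rightarrow> real \<Rightarrow> real \<Rightarrow> real" where
  "support s \<epsilon> t = Im (cnj (direction s * cis \<epsilon>) * (F (cis t) - F (cis s)))"

lemma has_real_derivative_support:
  assumes t: "s \<le> t" "t \<le> s + 2 * pi"
  shows "(support s \<epsilon> has_real_derivative norm (g (cis t)) * sin (turning s t - \<epsilon>)) (at t)"
proof -
  define D where "D = cnj (direction s * cis \<epsilon>)"
  have "((\<lambda>t. D * (F (cis t) - F (cis s))) has_vector_derivative D * velocity t) (at t)"
    by (auto intro!: derivative_eq_intros has_vector_derivative_boundary)
  then have "(support s \<epsilon> has_vector_derivative Im (D * velocity t)) (at t)"
    unfolding support_def D_def by (rule bounded_linear.has_vector_derivative[OF bounded_linear_Im])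
  moreover have "D * velocity t = norm (g (cis t)) * (cnj (direction s) * direction s) * (cis (- \<epsilon>) * cis (turning s t))"
    unfolding velocity_polar[OF t] D_def by (simp add: cis_cnj)
  then have "Im (D * velocity t) = norm (g (cis t)) * sin (turning s t - \<epsilon>)"
    by (simp add: cnj_unit_mult[OF norm_direction] cis_mult)
  ultimately show ?thesis
    by (simp add: has_real_derivative_iff_has_vector_derivative)
qed

lemma support_start: "support s \<epsilon> s = 0" "support s \<epsilon> (s + 2 * pi) = 0"
  by (simp_all add: support_def cis_mult[symmetric])

lemma continuous_on_support: "S \<subseteq> {s..s + 2 * pi} \<Longrightarrow> continuous_on S (support s \<epsilon>)"
  using has_real_derivative_support
  by (intro continuous_at_imp_continuous_on ballI) (meson DERIV_isCont atLeastAtMost_iff subsetD)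

lemma support_quasiconvex:
  assumes "s \<le> x" "x < t" "t < y" "y \<le> s + 2 * pi" "0 \<le> \<epsilon>"
    and "\<And>\<xi>. x < \<xi> \<Longrightarrow> \<xi> < y \<Longrightarrow> \<epsilon> \<le> turning s \<xi>"
  shows "support s \<epsilon> t \<le> max (support s \<epsilon> x) (support s \<epsilon> y)"
proof (rule quasiconvex_of_turning[where L = "support s \<epsilon>" and x = x and t = t and y = y and m = "\<lambda>t. norm (g (cis t))" and \<sigma> = "\<lambda>t. turning s t - \<epsilon>"])
  show "continuous_on {x..y} (support s \<epsilon>)"
    using assms by (intro continuous_on_support) auto
  show "(support s \<epsilon> has_real_derivative norm (g (cis \<xi>)) * sin (turning s \<xi> - \<epsilon>)) (at \<xi>)"
    if "x < \<xi>" "\<xi> < y" for \<xi>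
    using assms that by (intro has_real_derivative_support) auto
  show "0 \<le> turning s \<xi> - \<epsilon> \<and> turning s \<xi> - \<epsilon> \<le> 2 * pi" if "x < \<xi>" "\<xi> < y" for \<xi>
    using assms that turning_le[of s \<xi>] by auto
  show "turning s \<eta> - \<epsilon> \<le> turning s \<xi> - \<epsilon>" if "\<xi> < \<eta>" for \<xi> \<eta>
    using turning_antimono[of \<xi> \<eta> s] that by simp
qed (use assms(2,3) in simp_all)

text \<open>For \<epsilon> = 0 the height is quasiconvex over one full turn and vanishes at both
  ends, so it is never positive: the curve stays to the right of each of its tangents.\<close>

lemma tangent_supports:
  assumes x: "norm x = 1"
  shows "Im (cnj (velocity t) * (F x - F (cis t))) \<le> 0"
proof -
  define u where "u = arg_from t x"
  have u: "t < u" "u \<le> t + 2 * pi" "cis u = x"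
    using arg_from[OF x, of t] by (auto simp: u_def)
  have "support t 0 u \<le> 0"
  proof (cases "u = t + 2 * pi")
    case False
    then show ?thesis
      using support_quasiconvex[of t t u "t + 2 * pi" 0] turning_nonneg u by (simp add: support_start)
  qed (simp add: support_start)
  moreover have "velocity t = norm (g (cis t)) * direction t"
  proof -
    have "turning t t = 2 * pi"
      using arg_from(1)[OF R_unit] by (intro turning_eq_2pi)
    then show ?thesis
      using velocity_polar[of t t] by simp
  qed
  ultimately show ?thesis
    using u by (simp add: support_def mult.assoc mult_nonneg_nonpos)
qed

text \<open>The term 2 that z^2 contributes to the speed keeps every exterior angle at most
  pi.\<close>

lemma beta_le_1: "\<beta> z \<le> 1"
  using speed_ge[of z] by (simp add: \<beta>_def)

text \<open>The untilted tangent contains the whole edge leaving the vertex and gives only weak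
  support. Tilted by half the exterior angle, it makes the height strictly fall at the start and
  strictly rise at the end of the turn.\<close>

lemma vertex_strictly_supported:
  assumes \<zeta>: "\<zeta> \<in> R"
  obtains c where "\<And>x. norm x = 1 \<Longrightarrow> x \<noteq> \<zeta> \<Longrightarrow> Im (c * (F x - F \<zeta>)) < 0"
proof -
  define s where "s = Arg2pi \<zeta>"
  have s: "cis s = \<zeta>"
    using cis_Arg2pi[OF R_unit[OF \<zeta>]] by (simp add: s_def)
  define \<epsilon> where "\<epsilon> = pi * \<beta> \<zeta> / 2"
  have \<epsilon>: "0 < \<epsilon>" "\<epsilon> \<le> pi / 2"
    using beta_pos[of \<zeta>] beta_le_1[of \<zeta>] by (auto simp: \<epsilon>_def)
  \<comment> \<open>The half-open range of \<open>arg_from\<close> puts the vertex at the far end,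
    so its own drop pi \<beta> happens only at s + 2 pi, and \<open>turning s t - \<epsilon>\<close>
    stays nonnegative before.\<close>
  have last: "arg_from s \<zeta> = s + 2 * pi"
    using arg_from_unique[of s "s + 2 * pi"] s by (simp add: cis_mult[symmetric])
  have turn: "\<epsilon> \<le> turning s t" if "t < s + 2 * pi" for t
  proof -
    have "pi * \<beta> \<zeta> \<le> turning s t"
      unfolding turning_def using finite_R \<zeta> last that beta_pos
      by (intro member_le_sum) (auto simp: less_imp_le)
    then show ?thesis
      using \<epsilon> by (simp add: \<epsilon>_def)
  qed
  have neg: "support s \<epsilon> t < 0" if t: "s < t" "t < s + 2 * pi" for t
  proof -
    define T where "T = arg_from s ` (R - {\<zeta>})"
    have T_bounds: "s < \<tau> \<and> \<tau> < s + 2 * pi" if \<tau>: "\<tau> \<in> T" for \<tau>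
    proof -
      obtain \<zeta>' where \<zeta>': "\<zeta>' \<in> R" "\<zeta>' \<noteq> \<zeta>" "\<tau> = arg_from s \<zeta>'"
        using \<tau> by (auto simp: T_def)
      then have \<tau>': "cis \<tau> = \<zeta>'" "s < \<tau>" "\<tau> \<le> s + 2 * pi"
        using arg_from[OF R_unit] by auto
      then have "\<tau> \<noteq> s + 2 * pi"
        using \<zeta>'(2) s by (auto simp: cis_mult[symmetric])
      then show ?thesis
        using \<tau>' by simp
    qed
    have T: "finite T"
      using finite_R by (simp add: T_def)
    \<comment> \<open>\<open>x\<close> precedes t and every other pre-vertex: on (s, x) the angle is
      still 2 pi - \<epsilon>, so the height strictly falls from 0. Between \<open>x\<close> and
      \<open>y\<close> quasiconvexity takes over.\<close>
    obtain x where x: "s < x" "x < t" "\<And>\<tau>. \<tau> \<in> T \<Longrightarrow> x < \<tau>"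
    proof
      define x where "x = (s + Min (insert t T)) / 2"
      have "Min (insert t T) > s"
        using T t T_bounds by (subst Min_gr_iff) auto
      moreover have "Min (insert t T) \<le> t" "\<And>\<tau>. \<tau> \<in> T \<Longrightarrow> Min (insert t T) \<le> \<tau>"
        using T by auto
      ultimately show "s < x" "x < t" "\<And>\<tau>. \<tau> \<in> T \<Longrightarrow> x < \<tau>"
        unfolding x_def by fastforce+
    qed
    \<comment> \<open>Past \<open>y\<close> only the vertex itself is ahead, so
      \<open>turning\<close> is 2 \<epsilon>, the angle is \<epsilon>, and the height strictly rises
      to 0.\<close>
    obtain y where y: "y < s + 2 * pi" "t < y" "\<And>\<tau>. \<tau> \<in> T \<Longrightarrow> \<tau> < y"
    proof
      define y where "y = (s + 2 * pi + Max (insert t T)) / 2"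
      have "Max (insert t T) < s + 2 * pi"
        using T t T_bounds by (subst Max_less_iff) auto
      moreover have "Max (insert t T) \<ge> t" "\<And>\<tau>. \<tau> \<in> T \<Longrightarrow> Max (insert t T) \<ge> \<tau>"
        using T by auto
      ultimately show "y < s + 2 * pi" "t < y" "\<And>\<tau>. \<tau> \<in> T \<Longrightarrow> \<tau> < y"
        unfolding y_def by fastforce+
    qed
    have g0: "norm (g (cis \<xi>)) > 0" if "s < \<xi>" "\<xi> < s + 2 * pi" "\<xi> \<notin> T" for \<xi>
    proof -
      have "cis \<xi> \<notin> R"
      proof
        assume R: "cis \<xi> \<in> R"
        have "arg_from s (cis \<xi>) = \<xi>"
          using that by (intro arg_from_unique) auto
        then show False
          using R that last by (cases "cis \<xi> = \<zeta>") (auto simp: T_def intro: rev_image_eqI[of "cis \<xi>"])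
      qed
      then show ?thesis
        by (simp add: g_eq_0_iff)
    qed
    have "support s \<epsilon> x < support s \<epsilon> s"
    proof (rule DERIV_neg_imp_decreasing_open[OF x(1)])
      fix \<xi> assume \<xi>: "s < \<xi>" "\<xi> < x"
      have "turning s \<xi> = 2 * pi"
      proof (rule turning_eq_2pi)
        fix \<zeta>' assume "\<zeta>' \<in> R"
        then show "\<xi> < arg_from s \<zeta>'"
          using \<xi> x t last by (cases "\<zeta>' = \<zeta>") (force simp: T_def)+
      qed
      moreover have "sin (2 * pi - \<epsilon>) < 0"
        using \<epsilon> by (simp add: sin_diff sin_gt_zero)
      moreover have "norm (g (cis \<xi>)) > 0"
        using \<xi> x t by (intro g0) force+
      ultimately have "norm (g (cis \<xi>)) * sin (turning s \<xi> - \<epsilon>) < 0"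
        by (simp add: mult_pos_neg)
      then show "\<exists>y. (support s \<epsilon> has_real_derivative y) (at \<xi>) \<and> y < 0"
        using has_real_derivative_support[of s \<xi> \<epsilon>] \<xi> x t by auto
    next
      show "continuous_on {s..x} (support s \<epsilon>)"
        using x t by (intro continuous_on_support) auto
    qed
    moreover have "support s \<epsilon> y < support s \<epsilon> (s + 2 * pi)"
    proof (rule DERIV_pos_imp_increasing_open[OF y(1)])
      fix \<xi> assume \<xi>: "y < \<xi>" "\<xi> < s + 2 * pi"
      have "{\<zeta>'. \<zeta>' \<in> R \<and> \<xi> < arg_from s \<zeta>'} = {\<zeta>}"
        using y \<xi> \<zeta> last by (force simp: T_def)
      then have "turning s \<xi> - \<epsilon> = \<epsilon>"
        by (simp add: turning_def \<epsilon>_def)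
      moreover have "sin \<epsilon> > 0"
        using \<epsilon> by (intro sin_gt_zero) auto
      moreover have "norm (g (cis \<xi>)) > 0"
        using \<xi> y t by (intro g0) force+
      ultimately have "norm (g (cis \<xi>)) * sin (turning s \<xi> - \<epsilon>) > 0"
        by simp
      then show "\<exists>y. (support s \<epsilon> has_real_derivative y) (at \<xi>) \<and> y > 0"
        using has_real_derivative_support[of s \<xi> \<epsilon>] \<xi> y t by auto
    next
      show "continuous_on {y..s + 2 * pi} (support s \<epsilon>)"
        using y t by (intro continuous_on_support) auto
    qed
    ultimately show ?thesis
      using support_quasiconvex[of s x t y \<epsilon>] turn x y \<epsilon> by (simp add: support_start)
  qed
  show ?thesis
  proof (rule that)
    fix x :: complex assume x: "norm x = 1" "x \<noteq> \<zeta>"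
    have "arg_from s x \<noteq> s + 2 * pi"
      using arg_from(3)[OF x(1), of s] x(2) s by (auto simp: cis_mult[symmetric])
    then show "Im (cnj (direction s * cis \<epsilon>) * (F x - F \<zeta>)) < 0"
      using neg[of "arg_from s x"] arg_from[OF x(1), of s] by (simp add: support_def s)
  qed
qed

text \<open>Away from the pre-vertices \<open>turning\<close> is locally constant, so the curve
  passes straight through \<open>F z\<close> with positive speed.\<close>

lemma nonvertex_in_open_segment:
  assumes z: "norm z = 1" "z \<notin> R"
  obtains x y where "norm x = 1" "norm y = 1" "F z \<in> open_segment (F x) (F y)"
proof -
  \<comment> \<open>A base point opposite to z keeps a neighbourhood of z inside one period.\<close>
  define s where "s = Arg2pi z - pi"
  have s: "cis (s + pi) = z"
    using cis_Arg2pi[OF z(1)] by (simp add: s_def)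
  define T where "T = arg_from s ` R"
  have T: "finite T" "s + pi \<notin> T"
    using finite_R arg_from(3)[OF R_unit] s z by (force simp: T_def)+
  have "open (- T)"
    using T(1) by (simp add: finite_imp_closed open_Compl)
  then obtain d where d: "d > 0" "ball (s + pi) d \<subseteq> - T"
    using T(2) by (metis ComplI openE)
  define e where "e = min (d / 2) (pi / 2)"
  have e: "0 < e" "e < d" "e < pi"
    using d pi_gt_zero by (auto simp: e_def min_def)
  define I where "I = {s + pi - e..s + pi + e}"
  have I: "u \<notin> T" "s < u" "u < s + 2 * pi" if "u \<in> I" for u
    using that d e by (auto simp: I_def dist_real_def subset_eq)
  have const: "turning s u = turning s (s + pi)" if "u \<in> I" for u
  proof -
    have "\<tau> \<notin> I" if "\<tau> \<in> T" for \<tau>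
      using I(1) that by blast
    then have "u < \<tau> \<longleftrightarrow> s + pi < \<tau>" if "\<tau> \<in> T" for \<tau>
      using that \<open>u \<in> I\<close> e by (force simp: I_def)
    then have "{\<zeta>. \<zeta> \<in> R \<and> u < arg_from s \<zeta>} = {\<zeta>. \<zeta> \<in> R \<and> s + pi < arg_from s \<zeta>}"
      by (auto simp: T_def)
    then show ?thesis
      by (simp add: turning_def)
  qed
  define V where "V = direction s * cis (turning s (s + pi))"
  have V: "norm V = 1"
    by (simp add: V_def norm_mult norm_direction)
  have vel: "velocity u = of_real (norm (g (cis u))) * V" if "u \<in> I" for u
    using velocity_polar[of s u] I[OF that] const[OF that] by (simp add: V_def)
  \<comment> \<open>In coordinates along the edge direction V, the curve near z is real and
    increasing.\<close>
  define G where "G u = cnj V * (F (cis u) - F z)" for u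
  have dG: "(G has_vector_derivative of_real (norm (g (cis u)))) (at u within S)" if "u \<in> I" for u S
  proof -
    have "(G has_vector_derivative cnj V * velocity u) (at u within S)"
      unfolding G_def by (auto intro!: derivative_eq_intros has_vector_derivative_boundary)
    also have "cnj V * velocity u = of_real (norm (g (cis u)))"
      unfolding vel[OF that] using cnj_unit_mult[OF V] by (simp add: mult.left_commute)
    finally show ?thesis .
  qed
  have dRe: "((\<lambda>u. Re (G u)) has_real_derivative norm (g (cis u))) (at u within S)"
    and dIm: "((\<lambda>u. Im (G u)) has_real_derivative 0) (at u within S)" if "u \<in> I" for u S
    using bounded_linear.has_vector_derivative[OF bounded_linear_Re dG[OF that]] bounded_linear.has_vector_derivative[OF bounded_linear_Im dG[OF that]]
    by (simp_all add: has_real_derivative_iff_has_vector_derivative)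
  have G0: "G (s + pi) = 0"
    by (simp add: G_def s)
  have Im: "Im (G u) = 0" if "u \<in> I" for u
  proof -
    have "\<exists>c. \<forall>u\<in>I. Im (G u) = c"
      using dIm by (intro has_field_derivative_zero_constant) (auto simp: I_def)
    moreover have "s + pi \<in> I"
      using e by (simp add: I_def)
    ultimately have "Im (G u) = Im (G (s + pi))"
      using that by metis
    then show ?thesis
      by (simp add: G0)
  qed
  have gpos: "norm (g (cis u)) > 0" if "u \<in> I" for u
  proof -
    have "cis u \<notin> R"
      using I[OF that] arg_from_unique[of s u] by (force simp: T_def)
    then show ?thesis
      by (simp add: g_eq_0_iff)
  qed
  have incr: "Re (G u) < Re (G v)" if "u \<in> I" "v \<in> I" "u < v" for u v
    using that(3)
  proof (rule DERIV_pos_imp_increasing)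
    fix x assume "u \<le> x" "x \<le> v"
    then have "x \<in> I"
      using that by (auto simp: I_def)
    then show "\<exists>y. ((\<lambda>u. Re (G u)) has_real_derivative y) (at x) \<and> 0 < y"
      using dRe gpos by blast
  qed
  define p q where "p = - Re (G (s + pi - e))" and "q = Re (G (s + pi + e))"
  have pq: "p > 0" "q > 0"
    using incr[of "s + pi - e" "s + pi"] incr[of "s + pi" "s + pi + e"] e G0 by (auto simp: p_def q_def I_def)
  have Fu: "F (cis u) = F z + V * of_real (Re (G u))" if "u \<in> I" for u
  proof -
    have "of_real (Re (G u)) = cnj V * (F (cis u) - F z)"
      using Im[OF that] by (simp add: complex_eq_iff G_def)
    then have "V * of_real (Re (G u)) = (cnj V * V) * (F (cis u) - F z)"
      by simp
    then show ?thesis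
      by (simp add: cnj_unit_mult[OF V])
  qed
  have Fx: "F (cis (s + pi - e)) = F z - V * of_real p" and Fy: "F (cis (s + pi + e)) = F z + V * of_real q"
    using Fu[of "s + pi - e"] Fu[of "s + pi + e"] e by (auto simp: I_def p_def q_def)
  show ?thesis
  proof (rule that)
    have "F z = (1 - p / (p + q)) *\<^sub>R (F z - V * of_real p) + (p / (p + q)) *\<^sub>R (F z + V * of_real q)"
    proof -
      have "(1 - w) *\<^sub>R (F z - V * of_real p) + w *\<^sub>R (F z + V * of_real q) = F z + V * of_real (w * (p + q) - p)" for w
        by (simp add: scaleR_conv_of_real algebra_simps)
      moreover have "p / (p + q) * (p + q) - p = 0"
        using pq by simp
      ultimately show ?thesis
        by (simp only: of_real_0 mult_zero_right add_0_right)
    qed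
    moreover have "F z - V * of_real p \<noteq> F z + V * of_real q"
    proof
      assume "F z - V * of_real p = F z + V * of_real q"
      then have "V * of_real (p + q) = 0"
        by (simp add: algebra_simps)
      then show False
        using V pq by (simp only: mult_eq_0_iff of_real_eq_0_iff) auto
    qed
    ultimately show "F z \<in> open_segment (F (cis (s + pi - e))) (F (cis (s + pi + e)))"
      unfolding in_segment Fx Fy using pq by (intro conjI exI[of _ "p / (p + q)"]) auto
  qed auto
qed

end

section \<open>The omitted polygon and univalence\<close>

lemma Im_mult_inner: "Im (c * y) = Complex (Im c) (Re c) \<bullet> y"
  by (simp add: inner_complex_def)

text \<open>The hull is contained in an open half plane together with x, so removing x leaves a
  convex set.\<close>

lemma extreme_point_of_strictly_supported:
  fixes c :: complex
  assumes x: "x \<in> S" and supp: "\<And>y. y \<in> S \<Longrightarrow> y \<noteq> x \<Longrightarrow> Im (c * (y - x)) < 0"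
  shows "x extreme_point_of (convex hull S)"
proof -
  define H where "H = {y. Im (c * (y - x)) < 0}"
  have H: "convex H"
  proof -
    have "H = {y. Complex (Im c) (Re c) \<bullet> y < Complex (Im c) (Re c) \<bullet> x}"
      unfolding H_def Im_mult_inner by (auto simp: inner_diff_right)
    then show ?thesis
      by (simp add: convex_halfspace_lt)
  qed
  have "convex hull S \<subseteq> insert x H"
  proof (cases "S = {x}")
    case False
    then have ne: "S - {x} \<noteq> {}"
      using x by auto
    have sub: "convex hull (S - {x}) \<subseteq> H"
      using H supp by (intro hull_minimal) (auto simp: H_def)
    have "y \<in> insert x H" if "y \<in> convex hull S" for y
    proof -
      have "y \<in> convex hull (insert x (S - {x}))"
        using that x by (simp add: insert_absorb)
      then obtain u v b where u: "u \<ge> 0" "v \<ge> 0" "u + v = 1" and b: "b \<in> convex hull (S - {x})"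
        and y: "y = u *\<^sub>R x + v *\<^sub>R b"
        unfolding convex_hull_insert[OF ne] by blast
      have "y - x = v *\<^sub>R (b - x)"
      proof -
        have u': "u = 1 - v"
          using u by simp
        show ?thesis
          unfolding y u' by (simp add: algebra_simps)
      qed
      then have "Im (c * (y - x)) = v * Im (c * (b - x))"
        by simp
      moreover have "Im (c * (b - x)) < 0"
        using sub b by (auto simp: H_def)
      ultimately show ?thesis
        using u y by (cases "v = 0") (auto simp: H_def mult_pos_neg)
    qed
    then show ?thesis
      by blast
  qed simp
  moreover have "x \<notin> H"
    by (simp add: H_def)
  ultimately have "convex hull S - {x} = convex hull S \<inter> H"
    by auto
  then show ?thesis
    using x H by (simp add: extreme_point_of_stillconvex convex_Int hull_inc)
qed

text \<open>A planar convex set without interior lies on a line, and of three distinct points on a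
  line one is between the other two. It applies to the n + 2 vertices as n \<ge> 1.\<close>

lemma interior_nonempty_if_three_extreme_points:
  fixes P :: "complex set"
  assumes P: "convex P" and fin: "card {v. v extreme_point_of P} \<ge> 3"
  shows "interior P \<noteq> {}"
proof
  assume "interior P = {}"
  then obtain a b where a: "a \<noteq> 0" "P \<subseteq> {x. a \<bullet> x = b}"
    using empty_interior_subset_hyperplane[OF P] by blast
  then have "aff_dim P \<le> 1"
    using aff_dim_subset[OF a(2)] by simp
  then have col: "collinear P"
    by (simp add: collinear_aff_dim)
  obtain T where "T \<subseteq> {v. v extreme_point_of P}" "card T = 3"
    using obtain_subset_with_card_n[OF fin] by metis
  then obtain x y z where xyz: "x \<noteq> y" "y \<noteq> z" "x \<noteq> z"
    "x extreme_point_of P" "y extreme_point_of P" "z extreme_point_of P"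
    by (auto simp: card_3_iff)
  then have mem: "x \<in> P" "y \<in> P" "z \<in> P"
    by (auto simp: extreme_point_of_def)
  have "collinear {x, y, z}"
    using col mem by (auto intro: collinear_subset)
  then have "x \<in> open_segment y z \<or> y \<in> open_segment z x \<or> z \<in> open_segment x y"
    using xyz unfolding collinear_between_cases by (auto simp: between_mem_segment open_segment_def)
  then show False
    using xyz mem by (auto simp: extreme_point_of_def)
qed

lemma circlepath_eq_cis: "circlepath 0 \<rho> x = of_real \<rho> * cis (2 * pi * x)"
  by (simp add: circlepath cis_conv_exp mult_ac)

lemma infinite_unit_circle: "infinite (cis ` {0<..<1})"
proof -
  have "inj_on cis {0<..<1}"
  proof (rule inj_onI)
    fix x y :: real assume xy: "x \<in> {0<..<1}" "y \<in> {0<..<1}" "cis x = cis y"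
    have "arg_from 0 (cis x) = x" "arg_from 0 (cis y) = y"
      using xy(1,2) pi_ge_two by (auto intro!: arg_from_unique)
    then show "x = y"
      unfolding xy(3) by simp
  qed
  then show ?thesis
    using infinite_Ioo[of 0 "1::real"] by (simp add: finite_image_iff)
qed

context blaschke_zeros
begin

definition polygon :: "complex set" where
  "polygon = convex hull (F ` sphere 0 1)"

lemma continuous_on_F_sphere: "continuous_on (sphere 0 1) F"
  by (rule continuous_on_subset[OF continuous_on_F]) auto

lemma compact_F_sphere: "compact (F ` sphere 0 1)"
  by (intro compact_continuous_image continuous_on_F_sphere) simp

lemma compact_polygon: "compact polygon"
  unfolding polygon_def by (intro compact_convex_hull compact_F_sphere)

lemma convex_polygon_set: "convex polygon"
  by (simp add: polygon_def)

lemma F_sphere_in_polygon: "norm z = 1 \<Longrightarrow> F z \<in> polygon"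
  unfolding polygon_def by (intro hull_inc) auto

lemma F_eq_vertex_iff:
  assumes "\<zeta> \<in> R" "norm z = 1"
  shows "F z = F \<zeta> \<longleftrightarrow> z = \<zeta>"
proof -
  obtain c where c: "\<And>x. norm x = 1 \<Longrightarrow> x \<noteq> \<zeta> \<Longrightarrow> Im (c * (F x - F \<zeta>)) < 0"
    using vertex_strictly_supported[OF assms(1)] by blast
  from c[of z] show ?thesis
    using assms(2) by (cases "z = \<zeta>") auto
qed

lemma extreme_points_polygon: "{v. v extreme_point_of polygon} = F ` R"
proof (intro equalityI subsetI)
  fix v assume "v \<in> {v. v extreme_point_of polygon}"
  then have v: "v extreme_point_of polygon"
    by simp
  then have "v \<in> F ` sphere 0 1"
    unfolding polygon_def by (rule extreme_point_of_convex_hull)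
  then obtain z where z: "norm z = 1" "v = F z"
    by auto
  have "z \<in> R"
  proof (rule ccontr)
    assume "z \<notin> R"
    then obtain x y where "norm x = 1" "norm y = 1" "F z \<in> open_segment (F x) (F y)"
      using nonvertex_in_open_segment z by blast
    then show False
      using v z F_sphere_in_polygon by (auto simp: extreme_point_of_def)
  qed
  then show "v \<in> F ` R"
    using z by simp
next
  fix v assume "v \<in> F ` R"
  then obtain \<zeta> where \<zeta>: "\<zeta> \<in> R" "v = F \<zeta>"
    by blast
  obtain c where c: "\<And>x. norm x = 1 \<Longrightarrow> x \<noteq> \<zeta> \<Longrightarrow> Im (c * (F x - F \<zeta>)) < 0"
    using vertex_strictly_supported[OF \<zeta>(1)] by blast
  have "F \<zeta> extreme_point_of polygon"
    unfolding polygon_def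
  proof (rule extreme_point_of_strictly_supported)
    show "F \<zeta> \<in> F ` sphere 0 1"
      using R_unit[OF \<zeta>(1)] by auto
    show "Im (c * (y - F \<zeta>)) < 0" if "y \<in> F ` sphere 0 1" "y \<noteq> F \<zeta>" for y
      using that c by (metis imageE mem_sphere_0)
  qed
  then show "v \<in> {v. v extreme_point_of polygon}"
    using \<zeta> by simp
qed

lemma card_extreme_points_polygon: "card {v. v extreme_point_of polygon} = n + 2"
proof -
  have "inj_on F R"
    using F_eq_vertex_iff R_unit by (auto simp: inj_on_def)
  then show ?thesis
    unfolding extreme_points_polygon by (simp add: card_image card_R)
qed

lemma polytope_polygon: "polytope polygon"
  unfolding polytope_def
  using Krein_Milman_Minkowski[OF compact_polygon convex_polygon_set] finite_R
  by (metis extreme_points_polygon finite_imageI)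

lemma convex_polygon_polygon:
  assumes "n \<ge> 1"
  shows "convex_polygon (n + 2) polygon" "interior polygon \<noteq> {}"
proof -
  show "interior polygon \<noteq> {}"
    using assms by (intro interior_nonempty_if_three_extreme_points convex_polygon_set)
      (simp add: card_extreme_points_polygon)
  then show "convex_polygon (n + 2) polygon"
    by (simp add: convex_polygon_def polytope_polygon card_extreme_points_polygon)
qed

section \<open>The winding number of the boundary curve\<close>

definition loop :: "real \<Rightarrow> real \<Rightarrow> complex" where
  "loop \<rho> x = F (of_real \<rho> * cis (2 * pi * x))"

lemma loop_eq: "loop \<rho> = F \<circ> circlepath 0 \<rho>"
  by (auto simp: loop_def circlepath_eq_cis)

lemma has_vector_derivative_loop:
  "(loop 1 has_vector_derivative of_real (2 * pi) * velocity (2 * pi * x)) (at x)"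
proof -
  have "((\<lambda>x. 2 * pi * x) has_vector_derivative 2 * pi) (at x)"
    by (auto intro!: derivative_eq_intros)
  from vector_diff_chain_at[OF this has_vector_derivative_boundary]
  show ?thesis
    by (simp add: o_def loop_def[abs_def] scaleR_conv_of_real)
qed

lemma continuous_on_velocity: "continuous_on S velocity"
proof -
  have "continuous_on S (\<lambda>t. g (cis t))"
    by (rule continuous_on_compose2[OF continuous_on_g]) (auto intro!: continuous_intros)
  then show ?thesis
    unfolding velocity_def[abs_def] by (intro continuous_intros) auto
qed

lemma continuous_on_velocity_loop: "continuous_on S (\<lambda>x. of_real (2 * pi) * velocity (2 * pi * x))"
  by (intro continuous_intros continuous_on_compose2[OF continuous_on_velocity[of UNIV]]) auto

lemma valid_path_loop: "valid_path (loop 1)"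
  unfolding valid_path_def
proof (rule C1_differentiable_imp_piecewise)
  show "loop 1 C1_differentiable_on {0..1}"
    unfolding C1_differentiable_on_def
    using has_vector_derivative_loop continuous_on_velocity_loop
    by (intro exI[of _ "\<lambda>x. of_real (2 * pi) * velocity (2 * pi * x)"]) blast
qed

lemma pathfinish_loop: "pathfinish (loop \<rho>) = pathstart (loop \<rho>)"
  by (simp add: pathfinish_def pathstart_def loop_def)

lemma path_image_loop: "path_image (loop 1) = F ` sphere 0 1"
  unfolding loop_eq path_image_compose by simp

lemma winding_number_loop_outside:
  assumes "w \<notin> polygon"
  shows "winding_number (loop 1) w = 0"
proof (rule winding_number_zero_outside[where s = polygon])
  show "path_image (loop 1) \<subseteq> polygon"
    unfolding path_image_loop using F_sphere_in_polygon by auto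
qed (use assms valid_path_loop valid_path_imp_path convex_polygon_set pathfinish_loop in auto)

lemma polygon_supported:
  assumes "w \<in> polygon"
  shows "Im (cnj (velocity t) * (w - F (cis t))) \<le> 0"
proof -
  define d where "d = Complex (Im (cnj (velocity t))) (Re (cnj (velocity t)))"
  have eq: "Im (cnj (velocity t) * (w - F (cis t))) = d \<bullet> w - d \<bullet> F (cis t)" for w
    unfolding Im_mult_inner d_def by (simp add: inner_diff_right)
  have "d \<bullet> F x \<le> d \<bullet> F (cis t)" if "norm x = 1" for x
    using tangent_supports[OF that, of t] unfolding eq by simp
  then have "polygon \<subseteq> {w. d \<bullet> w \<le> d \<bullet> F (cis t)}"
    unfolding polygon_def by (intro hull_minimal) (auto simp: convex_halfspace_le)
  then show ?thesis
    unfolding eq using assms by auto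
qed

lemma interior_polygon_supported:
  assumes w: "w \<in> interior polygon" and t: "velocity t \<noteq> 0"
  shows "Im (cnj (velocity t) * (w - F (cis t))) < 0"
proof -
  define v where "v = velocity t"
  obtain e where e: "e > 0" "cball w e \<subseteq> polygon"
    using w by (meson mem_interior_cball)
  have v: "norm v > 0"
    using t by (simp add: v_def)
  \<comment> \<open>w is moved by the distance e to the left of the tangent. It stays in the polygon
    and gains e |v|, which makes the weak inequality strict at w.\<close>
  define w' where "w' = w + of_real (e / norm v) * \<i> * v"
  have "w' \<in> cball w e"
    using e v by (simp add: w'_def dist_norm norm_mult norm_divide)
  then have "Im (cnj v * (w' - F (cis t))) \<le> 0"
    using e polygon_supported unfolding v_def by blast
  moreover have "cnj v * (w' - F (cis t)) = cnj v * (w - F (cis t)) + of_real (e / norm v) * \<i> * (v * cnj v)"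
    by (simp add: w'_def algebra_simps)
  then have "Im (cnj v * (w' - F (cis t))) = Im (cnj v * (w - F (cis t))) + e / norm v * (norm v)\<^sup>2"
    by (simp only: complex_norm_square[symmetric]) simp
  moreover have "e / norm v * (norm v)\<^sup>2 > 0"
    using e v by simp
  ultimately show ?thesis
    unfolding v_def by linarith
qed

text \<open>Up to the factor 2 pi, the real part is the integral of the angular speed f of the curve
  about w, and f is nonpositive because the polygon lies to the right of each tangent.\<close>

lemma winding_number_loop_inside:
  assumes w: "w \<in> interior polygon" "w \<notin> F ` sphere 0 1"
  shows "Re (winding_number (loop 1) w) < 0"
proof -
  define f where "f x = Im (1 / (loop 1 x - w) * (of_real (2 * pi) * velocity (2 * pi * x)))" for x
  have ne: "loop 1 x \<noteq> w" for x
    using w(2) by (auto simp: loop_def)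
  have f: "f x = 2 * pi / (norm (loop 1 x - w))\<^sup>2 * Im (cnj (velocity (2 * pi * x)) * (w - loop 1 x))" for x
  proof -
    have "1 / (loop 1 x - w) * (of_real (2 * pi) * velocity (2 * pi * x)) =
        of_real (2 * pi / (norm (loop 1 x - w))\<^sup>2) * (cnj (loop 1 x - w) * velocity (2 * pi * x))"
      using complex_div_cnj[of 1 "loop 1 x - w"] by (simp add: divide_inverse mult_ac)
    then have "f x = 2 * pi / (norm (loop 1 x - w))\<^sup>2 * Im (cnj (loop 1 x - w) * velocity (2 * pi * x))"
      unfolding f_def by (simp only: scaleR_conv_of_real[symmetric] scaleR_complex.sel)
    moreover have "Im (cnj (loop 1 x - w) * velocity (2 * pi * x)) = Im (cnj (velocity (2 * pi * x)) * (w - loop 1 x))"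
      by (simp add: algebra_simps)
    ultimately show ?thesis
      by simp
  qed
  have f_le: "f x \<le> 0" for x
    unfolding f using polygon_supported[of w "2 * pi * x"] w interior_subset[of polygon]
    by (intro mult_nonneg_nonpos) (auto simp: loop_def)
  have "((\<lambda>x. 1 / (loop 1 x - w) * vector_derivative (loop 1) (at x)) has_integral
      2 * pi * \<i> * winding_number (loop 1) w) {0..1}"
    using has_contour_integral_winding_number[OF valid_path_loop, of w] w(2)
    by (simp add: path_image_loop has_contour_integral)
  then have "(f has_integral Im (2 * pi * \<i> * winding_number (loop 1) w)) {0..1}"
    unfolding f_def[abs_def] vector_derivative_at[OF has_vector_derivative_loop] by (rule has_integral_Im)
  then have int: "((\<lambda>x. - f x) has_integral - (2 * pi * Re (winding_number (loop 1) w))) (cbox 0 1)"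
    by (simp add: has_integral_neg)
  then have "0 \<le> - (2 * pi * Re (winding_number (loop 1) w))"
    using f_le by (intro has_integral_nonneg[OF int]) simp
  then have le: "Re (winding_number (loop 1) w) \<le> 0"
    using mult_pos_pos[of "2 * pi" "Re (winding_number (loop 1) w)"] pi_gt_zero by linarith
  have "Re (winding_number (loop 1) w) \<noteq> 0"
  proof
    assume "Re (winding_number (loop 1) w) = 0"
    then have int0: "((\<lambda>x. - f x) has_integral 0) (cbox 0 1)"
      using int by simp
    have cont: "continuous_on (cbox 0 1) (\<lambda>x. - f x)"
      unfolding f_def using ne valid_path_imp_path[OF valid_path_loop]
      by (intro continuous_intros continuous_on_velocity_loop[unfolded of_real_mult of_real_numeral]
          continuous_on_compose2[OF continuous_on_velocity[of UNIV]]) (auto simp: path_def)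
    \<comment> \<open>A continuous function of constant sign with integral 0 vanishes. The velocity
      would then be 0 along a whole arc, but \<open>g\<close> has only finitely many zeros on the
      circle.\<close>
    have "cis x \<in> R" if "x \<in> {0<..<1}" for x
    proof -
      have "x / (2 * pi) \<in> cbox 0 1"
        using that pi_ge_two by (auto simp: divide_simps)
      then have "- f (x / (2 * pi)) = 0"
        using f_le by (intro has_integral_0_cbox_imp_0[OF cont _ int0]) auto
      then have "Im (cnj (velocity x) * (w - F (cis x))) = 0"
        using ne unfolding f by (auto simp: loop_def)
      then have "velocity x = 0"
        using interior_polygon_supported[OF w(1), of x] by fastforce
      then have "g (cis x) = 0"
        using norm_velocity[of x] by simp
      then show ?thesis
        by (simp add: g_eq_0_iff)
    qed
    then have "finite (cis ` {0<..<1})"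
      by (intro finite_subset[OF _ finite_R]) auto
    then show False
      using infinite_unit_circle by blast
  qed
  then show ?thesis
    using le by simp
qed


text \<open>Uniform continuity near the circle. The estimate has two uses: \<open>F\<close> omits w
  on the annulus, and the images of the circles of radius \<rho> and 1 wind equally often about
  w.\<close>

lemma annulus_radius:
  assumes w: "w \<notin> F ` sphere 0 1"
  obtains \<rho> where "0 < \<rho>" "\<rho> < 1"
    "\<And>s t. \<rho> \<le> s \<Longrightarrow> s \<le> 1 \<Longrightarrow> norm (F (of_real s * cis t) - F (cis t)) < norm (F (cis t) - w)"
proof -
  obtain d where d: "d > 0" "\<And>y. y \<in> F ` sphere 0 1 \<Longrightarrow> d \<le> dist w y"
    using separate_point_closed[OF compact_imp_closed[OF compact_F_sphere] w] by blast
  define A where "A = cball 0 1 - ball (0::complex) (1/2)"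
  have "uniformly_continuous_on A F"
    unfolding A_def
    by (intro compact_uniformly_continuous continuous_on_subset[OF continuous_on_F] compact_diff) auto
  then obtain e where e: "e > 0" "\<And>x y. x \<in> A \<Longrightarrow> y \<in> A \<Longrightarrow> dist y x < e \<Longrightarrow> dist (F y) (F x) < d"
    using d(1) unfolding uniformly_continuous_on_def by metis
  define \<rho> where "\<rho> = max (1/2) (1 - e/2)"
  show ?thesis
  proof
    show "0 < \<rho>" "\<rho> < 1"
      using e by (auto simp: \<rho>_def)
    fix s t :: real assume s: "\<rho> \<le> s" "s \<le> 1"
    have "of_real s * cis t - cis t = of_real (s - 1) * cis t"
      by (simp add: algebra_simps)
    then have "norm (of_real s * cis t - cis t) = 1 - s"
      using s by (simp only: norm_mult norm_of_real norm_cis) simp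
    also have "\<dots> < e"
      using s e(1) by (auto simp: \<rho>_def)
    finally have "dist (of_real s * cis t) (cis t) < e"
      by (simp add: dist_norm)
    moreover have "of_real s * cis t \<in> A" "cis t \<in> A"
      using s by (auto simp: A_def norm_mult \<rho>_def)
    ultimately have "dist (F (of_real s * cis t)) (F (cis t)) < d"
      using e(2) by blast
    also have "d \<le> dist w (F (cis t))"
      using d(2) by auto
    finally show "norm (F (of_real s * cis t) - F (cis t)) < norm (F (cis t) - w)"
      by (simp add: dist_norm norm_minus_commute)
  qed
qed

section \<open>Counting preimages by the argument principle\<close>

lemma zorder_preimage:
  assumes z: "norm z < 1" "z \<noteq> 0"
  shows "zorder (\<lambda>u. F u - F z) z = 1"
proof -
  define q where "q = (\<lambda>u. if u = z then deriv F z else (F u - F z) / (u - z))"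
  show ?thesis
  proof (rule zorder_eqI[where S = "ball 0 1 - {0}" and g = q])
    show "q holomorphic_on ball 0 1 - {0}"
      unfolding q_def by (intro pole_lemma_open holomorphic_on_F open_delete open_ball)
    show "q z \<noteq> 0"
      using deriv_F_nonzero[OF z] by (simp add: q_def)
  qed (use z in \<open>auto simp: q_def open_delete\<close>)
qed

text \<open>\<open>F - w\<close> multiplied by \<open>z\<close>, to remove the simple pole at 0.\<close>

definition cleared :: "complex \<Rightarrow> complex \<Rightarrow> complex" where
  "cleared w z = z * h z - 1 - z * w"

lemma cleared_eq: "z \<noteq> 0 \<Longrightarrow> cleared w z = z * (F z - w)"
  by (simp add: cleared_def F_def field_simps)

lemma holomorphic_on_cleared: "cleared w holomorphic_on ball 0 1"
proof -
  have "(h has_field_derivative k z) (at z)" if "norm z < 1" for z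
    using has_field_derivative_h[of z] at_within_interior[of z "cball 0 1"] that by simp
  then have "h holomorphic_on ball 0 1"
    unfolding holomorphic_on_open[OF open_ball] by (metis mem_ball_0)
  then show ?thesis
    unfolding cleared_def[abs_def] by (intro holomorphic_intros)
qed

lemma zorder_pole_F: "zorder (\<lambda>z. F z - w) 0 = -1"
  by (rule zorder_eqI[where S = "ball 0 1" and g = "cleared w"])
     (auto simp: holomorphic_on_cleared cleared_eq power_int_minus field_simps, simp_all add: cleared_def)

lemma is_pole_F_diff: "is_pole (\<lambda>z. F z - w) 0"
proof -
  have "filterlim (\<lambda>z. F z + - w) at_infinity (at 0)"
    using is_pole_F unfolding is_pole_def
    by (intro tendsto_add_filterlim_at_infinity'[OF _ tendsto_const])
  then show ?thesis
    by (simp add: is_pole_def)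
qed

lemma F_nonconstant: "\<not> F constant_on ball 0 1 - {0}"
proof
  assume "F constant_on ball 0 1 - {0}"
  then obtain c where c: "\<And>z. z \<in> ball 0 1 - {0} \<Longrightarrow> F z = c"
    by (auto simp: constant_on_def)
  have "deriv F (1/2) = deriv (\<lambda>_. c) (1/2)"
  proof (rule deriv_cong_ev)
    have "eventually (\<lambda>z. z \<in> ball 0 1 - {0}) (nhds (1/2 :: complex))"
      by (intro eventually_nhds_in_open) auto
    then show "eventually (\<lambda>z. F z = c) (nhds (1/2))"
      by eventually_elim (rule c)
  qed simp
  then show False
    using deriv_F_nonzero[of "1/2"] by simp
qed

text \<open>Each solution of F z = w is a simple zero and counts +1, the simple pole at 0 counts -1.
  The logarithmic integral is taken over a circle of radius \<rho> < 1, where \<open>F\<close> is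
  holomorphic.\<close>

lemma card_preimages:
  assumes w: "w \<notin> F ` sphere 0 1"
  defines "Z \<equiv> {z \<in> ball 0 1 - {0}. F z = w}"
  shows "finite Z" "of_nat (card Z) = 1 + winding_number (loop 1) w"
proof -
  obtain \<rho> where \<rho>: "0 < \<rho>" "\<rho> < 1"
    "\<And>s t. \<rho> \<le> s \<Longrightarrow> s \<le> 1 \<Longrightarrow> norm (F (of_real s * cis t) - F (cis t)) < norm (F (cis t) - w)"
    using annulus_radius[OF w] by blast
  have ne: "F z \<noteq> w" if z: "\<rho> \<le> norm z" "norm z \<le> 1" for z
  proof -
    have "z = of_real (norm z) * cis (Arg z)"
      using rcis_cmod_Arg[of z] by (simp add: rcis_def)
    then show ?thesis
      using \<rho>(3)[OF z, of "Arg z"] by (metis norm_minus_commute order_less_irrefl)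
  qed
  moreover obtain r where r: "r > 0" "\<And>z. z \<noteq> 0 \<Longrightarrow> norm z < r \<Longrightarrow> F z - w \<noteq> 0"
    using non_zero_neighbour_pole[OF is_pole_F_diff[of w]] by (auto simp: eventually_at)
  \<comment> \<open>Solutions stay away from the circle and from the pole, hence lie in a compact
    annulus.\<close>
  ultimately have "Z \<subseteq> {z \<in> cball 0 \<rho> - ball 0 r. F z - w = 0}"
    by (force simp: Z_def not_less)
  moreover have "finite {z \<in> cball 0 \<rho> - ball 0 r. F z - w = 0}"
  proof (rule holomorphic_compact_finite_zeros[where S = "ball 0 1 - {0}"])
    show "(\<lambda>z. F z - w) holomorphic_on ball 0 1 - {0}"
      by (intro holomorphic_intros holomorphic_on_F)
    show "\<not> (\<lambda>z. F z - w) constant_on ball 0 1 - {0}"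
    proof
      assume "(\<lambda>z. F z - w) constant_on ball 0 1 - {0}"
      then have "F constant_on ball 0 1 - {0}"
        unfolding constant_on_def by (metis diff_eq_eq)
      then show False
        using F_nonconstant by simp
    qed
    show "connected (ball 0 1 - {0 :: complex})"
      by (intro connected_open_delete) auto
  qed (use r \<rho> in \<open>auto simp: compact_diff\<close>)
  ultimately show fin: "finite Z"
    by (rule finite_subset)
  have img: "path_image (circlepath 0 \<rho>) = sphere 0 \<rho>"
    using \<rho> by simp
  have "winding_number (loop \<rho>) w = winding_number (loop 1) w"
  proof (rule winding_number_nearby_loops_eq)
    show "path (loop \<rho>)"
      unfolding loop_eq using \<rho>
      by (intro path_continuous_image continuous_on_subset[OF continuous_on_F]) auto
    show "norm (loop \<rho> t - loop 1 t) < norm (loop 1 t - w)" for t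
      using \<rho>(3)[of \<rho> "2 * pi * t"] \<rho> by (simp add: loop_def)
  qed (use valid_path_imp_path[OF valid_path_loop] pathfinish_loop in auto)
  moreover have "winding_number (loop \<rho>) w = 1 / (2 * pi * \<i>) * contour_integral (loop \<rho>) (\<lambda>z. 1 / (z - w))"
  proof (rule winding_number_valid_path)
    show "valid_path (loop \<rho>)"
      unfolding loop_eq using \<rho>
      by (intro valid_path_compose_holomorphic[OF _ holomorphic_on_F]) auto
    show "w \<notin> path_image (loop \<rho>)"
      unfolding loop_eq path_image_compose img using ne \<rho> by force
  qed
  moreover have "contour_integral (loop \<rho>) (\<lambda>z. 1 / (z - w)) =
      contour_integral (circlepath 0 \<rho>) (\<lambda>z. deriv F z * (1 / (F z - w)))"
    unfolding loop_eq
  proof (rule contour_integral_comp_analyticW[where s = "ball 0 1 - {0}"])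
    show "F analytic_on ball 0 1 - {0}"
      using holomorphic_on_F by (simp only: analytic_on_open[OF open_delete[OF open_ball]])
  qed (use \<rho> in auto)
  moreover have "contour_integral (circlepath 0 \<rho>) (\<lambda>z. deriv F z * (1 / (F z - w))) =
      contour_integral (circlepath 0 \<rho>) (\<lambda>z. deriv (\<lambda>z. F z - w) z * 1 / (F z - w))"
  proof (rule contour_integral_eq)
    fix z assume "z \<in> path_image (circlepath 0 \<rho>)"
    then have "norm z < 1" "z \<noteq> 0"
      using img \<rho> by auto
    then have "deriv (\<lambda>z. F z - w) z = deriv F z"
      using has_field_derivative_F_interior[of z] deriv_F[of z]
      by (intro DERIV_imp_deriv) (auto intro!: derivative_eq_intros)
    then show "deriv F z * (1 / (F z - w)) = deriv (\<lambda>z. F z - w) z * 1 / (F z - w)"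
      by simp
  qed
  moreover have "contour_integral (circlepath 0 \<rho>) (\<lambda>z. deriv (\<lambda>z. F z - w) z * 1 / (F z - w)) =
      2 * pi * \<i> * (of_nat (card Z) - 1)"
  proof -
    define pz where "pz = {z \<in> ball 0 1. F z - w = 0 \<or> z \<in> {0}}"
    have pz: "pz = insert 0 Z"
      by (auto simp: pz_def Z_def)
    have inner: "norm z < \<rho>" if "z \<in> pz" for z
      using that ne[of z] \<rho> by (fastforce simp: pz Z_def)
    have "contour_integral (circlepath 0 \<rho>) (\<lambda>z. deriv (\<lambda>z. F z - w) z * 1 / (F z - w)) =
      2 * pi * \<i> * (\<Sum>p\<in>pz. winding_number (circlepath 0 \<rho>) p * 1 * zorder (\<lambda>z. F z - w) p)"
      unfolding pz_def
    proof (rule argument_principle)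
      show "(\<lambda>z. F z - w) holomorphic_on ball 0 1 - {0}"
        by (intro holomorphic_intros holomorphic_on_F)
      show "path_image (circlepath 0 \<rho>) \<subseteq> ball 0 1 - {z \<in> ball 0 1. F z - w = 0 \<or> z \<in> {0}}"
        using inner \<rho> unfolding pz_def[symmetric] img by fastforce
      show "\<forall>z. z \<notin> ball 0 1 \<longrightarrow> winding_number (circlepath 0 \<rho>) z = 0"
      proof (intro allI impI)
        fix z :: complex assume "z \<notin> ball 0 1"
        then show "winding_number (circlepath 0 \<rho>) z = 0"
          using \<rho> by (intro winding_number_zero_outside[where s = "cball 0 \<rho>"]) auto
      qed
      show "finite {z \<in> ball 0 1. F z - w = 0 \<or> z \<in> {0}}"
        unfolding pz_def[symmetric] pz using fin by simp
      show "\<forall>p\<in>ball 0 1 \<inter> {0}. is_pole (\<lambda>z. F z - w) p"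
        using is_pole_F_diff by auto
    qed auto
    also have "(\<Sum>p\<in>pz. winding_number (circlepath 0 \<rho>) p * 1 * zorder (\<lambda>z. F z - w) p)
       = (\<Sum>p\<in>pz. of_int (zorder (\<lambda>z. F z - w) p))"
      using inner by (intro sum.cong) (auto simp: winding_number_circlepath)
    also have "\<dots> = of_int (zorder (\<lambda>z. F z - w) 0) + (\<Sum>p\<in>Z. of_int (zorder (\<lambda>z. F z - w) p))"
      unfolding pz using fin by (subst sum.insert) (auto simp: Z_def)
    also have "(\<Sum>p\<in>Z. of_int (zorder (\<lambda>z. F z - w) p)) = (\<Sum>p\<in>Z. (1 :: complex))"
      using zorder_preimage by (intro sum.cong) (auto simp: Z_def)
    finally show ?thesis
      by (simp add: zorder_pole_F)
  qed
  ultimately have "of_nat (card Z) - 1 = winding_number (loop 1) w"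
    by simp
  then show "of_nat (card Z) = 1 + winding_number (loop 1) w"
    by (simp only: diff_eq_eq add.commute)
qed

lemma unique_preimage:
  assumes "w \<notin> polygon"
  shows "\<exists>!z. z \<in> ball 0 1 - {0} \<and> F z = w"
proof -
  have "w \<notin> F ` sphere 0 1"
    using assms F_sphere_in_polygon by auto
  from card_preimages(2)[OF this] winding_number_loop_outside[OF assms]
  have "card {z \<in> ball 0 1 - {0}. F z = w} = 1"
    by (metis add_0_right of_nat_1 of_nat_eq_iff)
  then show ?thesis
  proof (rule card_1_singletonE)
    fix x assume "{z \<in> ball 0 1 - {0}. F z = w} = {x}"
    then have "\<forall>z. z \<in> ball 0 1 - {0} \<and> F z = w \<longleftrightarrow> z = x"
      unfolding set_eq_iff mem_Collect_eq singleton_iff .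
    then show ?thesis
      by metis
  qed
qed

lemma no_preimage_interior:
  assumes w: "w \<in> interior polygon" and z: "z \<in> ball 0 1 - {0}"
  shows "F z \<noteq> w"
proof
  assume Fz: "F z = w"
  \<comment> \<open>A boundary value in the interior would have velocity 0 by strict support, so it
    would be a vertex; but extreme points are not interior.\<close>
  have "F (cis t) \<noteq> w" for t
  proof
    assume t: "F (cis t) = w"
    have "velocity t = 0"
      using interior_polygon_supported[OF w, of t] t by fastforce
    then have R: "cis t \<in> R"
      using norm_velocity[of t] by (simp add: g_eq_0_iff)
    then have "w extreme_point_of polygon"
      using extreme_points_polygon t by blast
    then show False
      using w extreme_point_not_in_interior by blast
  qed
  then have sph: "w \<notin> F ` sphere 0 1"
    using cis_Arg2pi by (metis imageE mem_sphere_0)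
  have "real (card {z \<in> ball 0 1 - {0}. F z = w}) < 1"
    using winding_number_loop_inside[OF w sph] arg_cong[OF card_preimages(2)[OF sph], of Re] by simp
  moreover have "card {z \<in> ball 0 1 - {0}. F z = w} \<noteq> 0"
    using card_preimages(1)[OF sph] Fz z by auto
  ultimately show False
    by linarith
qed

lemma F_image:
  assumes "n \<ge> 1"
  shows "F ` (ball 0 1 - {0}) = - polygon"
proof (intro equalityI subsetI)
  fix w assume "w \<in> - polygon"
  then have "\<exists>z. z \<in> ball 0 1 - {0} \<and> F z = w"
    by (intro ex1_implies_ex unique_preimage) simp
  then show "w \<in> F ` (ball 0 1 - {0})"
    by blast
next
  have op: "open (F ` (ball 0 1 - {0}))"
    using holomorphic_on_F F_nonconstant
    by (intro open_mapping_thm[where S = "ball 0 1 - {0}"] connected_open_delete) (auto simp: open_delete)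
  fix w assume w: "w \<in> F ` (ball 0 1 - {0})"
  show "w \<in> - polygon"
  proof
    assume "w \<in> polygon"
    \<comment> \<open>The count leaves the boundary of the polygon open. The image is an open set
      that misses the interior, so it also misses the closure of the interior, which contains the
      polygon.\<close>
    then have "w \<in> closure (interior polygon)"
      using convex_closure_interior[OF convex_polygon_set convex_polygon_polygon(2)[OF assms]] closure_subset
      by blast
    then have "F ` (ball 0 1 - {0}) \<inter> interior polygon \<noteq> {}"
      using w op open_Int_closure_eq_empty[OF op] by blast
    then show False
      using no_preimage_interior by blast
  qed
qed

lemma inj_on_F:
  assumes "n \<ge> 1"
  shows "inj_on F (ball 0 1 - {0})"
proof (rule inj_onI)
  fix x y assume xy: "x \<in> ball 0 1 - {0}" "y \<in> ball 0 1 - {0}" "F x = F y"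
  have "F x \<notin> polygon"
    using F_image[OF assms] xy(1) by blast
  then show "x = y"
    using unique_preimage[of "F x"] xy by metis
qed

theorem sc_mapping_F:
  assumes "n \<ge> 1"
  shows "sc_mapping n a F"
proof -
  have ext: "sc_exterior_map (n + 2) F"
    unfolding sc_exterior_map_def
    by (intro conjI exI[of _ polygon] holomorphic_on_F is_pole_F inj_on_F F_image convex_polygon_polygon assms)
  show ?thesis
    unfolding sc_mapping_def
  proof (intro conjI ballI ext)
    show "norm (a k) < 1" if "k \<in> {1..n}" for k
      using zeros_in_disk that .
    show "z * (deriv (deriv F) z / deriv F z) = 2 / (z\<^sup>2 * blaschke n a z - 1)"
      if "z \<in> ball 0 1 - {0}" for z
      using that by (intro ODE_F) auto
  qed
qed

end

section \<open>Pre-vertices of an arbitrary mapping and their separation\<close>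

lemma constant_of_zero_derivative:
  fixes q :: "complex \<Rightarrow> complex"
  assumes "open S" "connected S" and q: "\<And>z. z \<in> S \<Longrightarrow> (q has_field_derivative 0) (at z)"
  obtains c where "\<And>z. z \<in> S \<Longrightarrow> q z = c"
proof (rule DERIV_zero_connected_constant[OF assms(2,1) finite.emptyI, of q])
  show "continuous_on S q"
    using q by (intro continuous_at_imp_continuous_on ballI) (rule DERIV_isCont)
qed (use q in auto)

lemma extreme_point_of_affine_image:
  fixes c d :: complex
  assumes "c \<noteq> 0"
  shows "(c * x + d) extreme_point_of ((\<lambda>x. c * x + d) ` P) \<longleftrightarrow> x extreme_point_of P"
proof -
  have "(\<lambda>x. c * x + d) ` P = (\<lambda>x. d + x) ` ((\<lambda>x. c * x) ` P)"
    by (simp add: image_image add.commute)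
  then have "(c * x + d) extreme_point_of ((\<lambda>x. c * x + d) ` P) \<longleftrightarrow> (c * x) extreme_point_of ((\<lambda>x. c * x) ` P)"
    by (simp only: add.commute[of "c * x" d] extreme_point_of_translation_eq)
  also have "\<dots> \<longleftrightarrow> (\<lambda>x. c * x) ` {x} face_of (\<lambda>x. c * x) ` P"
    by (simp add: face_of_singleton)
  also have "\<dots> \<longleftrightarrow> {x} face_of P"
    using assms by (intro face_of_linear_image) (auto simp: linear_times inj_def)
  also have "\<dots> \<longleftrightarrow> x extreme_point_of P"
    by (rule face_of_singleton)
  finally show ?thesis .
qed

lemma cis_double_eq_1_iff: "cis (2 * x) = 1 \<longleftrightarrow> (\<exists>m::int. x = of_int m * pi)"
proof
  assume "cis (2 * x) = 1"
  then have "cos (2 * x) = 1"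
    by (simp add: complex_eq_iff)
  then show "\<exists>m::int. x = of_int m * pi"
    by (auto simp: cos_one_2pi_int)
next
  assume "\<exists>m::int. x = of_int m * pi"
  then obtain m :: int where m: "2 * x = 2 * pi * of_int m"
    by auto
  show "cis (2 * x) = 1"
    unfolding m by (simp only: complex_eq_iff cis.sel cos_int_2pin sin_int_2pin) simp
qed

lemma separation_rotate: "norm z = 1 \<Longrightarrow> 0 \<le> s \<Longrightarrow> s < 2 * pi \<Longrightarrow> separation z (z * cis s) = s"
  unfolding separation_def using cnj_unit_mult[of z]
  by (intro Arg2pi_unique[of 1]) (auto simp: cis_conv_exp mult.assoc[symmetric])

lemma rotate_separation:
  assumes "norm z = 1" "norm w = 1"
  shows "w = z * cis (separation z w)"
proof -
  have "cis (separation z w) = cnj z * w"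
    unfolding separation_def using assms by (intro cis_Arg2pi) (simp add: norm_mult)
  then have "z * cis (separation z w) = (cnj z * z) * w"
    by simp
  then show ?thesis
    by (simp add: cnj_unit_mult[OF assms(1)])
qed

lemma half_separation_bounds:
  assumes "norm z = 1" "norm w = 1" "z \<noteq> w"
  shows "0 < separation z w / 2" "separation z w / 2 < pi"
proof -
  have "separation z w \<noteq> 0"
    using rotate_separation[OF assms(1,2)] assms(3) by auto
  moreover have "0 \<le> separation z w" "separation z w < 2 * pi"
    unfolding separation_def by (rule Arg2pi_ge_0, rule Arg2pi_lt_2pi)
  ultimately show "0 < separation z w / 2" "separation z w / 2 < pi"
    by auto
qed

context blaschke_zeros
begin

text \<open>Equal f''/f' make f'/F' constant on the connected punctured disk, and a second
  integration gives f. Injectivity ensures f' \<noteq> 0.\<close>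

lemma sc_mapping_affine:
  assumes n: "n \<ge> 1" and f: "sc_mapping n a f"
  obtains c d where "c \<noteq> 0" "\<And>z. z \<in> ball 0 1 - {0} \<Longrightarrow> f z = c * F z + d"
proof -
  define S where "S = ball 0 1 - {0 :: complex}"
  have S: "open S" "connected S"
    unfolding S_def by (auto intro: connected_open_delete)
  have f: "f holomorphic_on S" "inj_on f S"
    "\<And>z. z \<in> S \<Longrightarrow> z * (deriv (deriv f) z / deriv f z) = 2 / (z\<^sup>2 * blaschke n a z - 1)"
    using f by (auto simp: sc_mapping_def sc_exterior_map_def S_def)
  have F: "F holomorphic_on S" "\<And>z. z \<in> S \<Longrightarrow> deriv F z \<noteq> 0"
    using holomorphic_on_F deriv_F_nonzero by (auto simp: S_def)
  have f': "deriv f z \<noteq> 0" if "z \<in> S" for z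
    using holomorphic_injective_imp_regular[OF f(1) S(1) f(2) that] .
  define q where "q z = deriv f z / deriv F z" for z
  have dq: "(q has_field_derivative 0) (at z)" if z: "z \<in> S" for z
  proof -
    have d: "(deriv f has_field_derivative deriv (deriv f) z) (at z)" "(deriv F has_field_derivative deriv (deriv F) z) (at z)"
      using holomorphic_derivI[OF holomorphic_deriv[OF f(1) S(1)] S(1) z]
        holomorphic_derivI[OF holomorphic_deriv[OF F(1) S(1)] S(1) z] by auto
    have "z * (deriv (deriv f) z / deriv f z) = z * (deriv (deriv F) z / deriv F z)"
      using f(3)[OF z] ODE_F[of z] z by (simp add: S_def)
    then have "deriv (deriv f) z * deriv F z - deriv f z * deriv (deriv F) z = 0"
      using f'[OF z] F(2)[OF z] z by (simp add: S_def field_simps)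
    then show ?thesis
      unfolding q_def[abs_def] using DERIV_divide[OF d F(2)[OF z]] by simp
  qed
  obtain c where c: "\<And>z. z \<in> S \<Longrightarrow> q z = c"
    using constant_of_zero_derivative[OF S dq] by blast
  have df: "deriv f z = c * deriv F z" if "z \<in> S" for z
    using c[OF that] F(2)[OF that] by (simp add: q_def field_simps)
  have dfF: "((\<lambda>z. f z - c * F z) has_field_derivative 0) (at z)" if z: "z \<in> S" for z
    using DERIV_diff[OF holomorphic_derivI[OF f(1) S(1) z] DERIV_cmult[OF holomorphic_derivI[OF F(1) S(1) z]], of c]
    by (simp add: df[OF z])
  obtain d where d: "\<And>z. z \<in> S \<Longrightarrow> f z - c * F z = d"
    using constant_of_zero_derivative[OF S dfF] by blast
  have "1/2 \<in> S"
    by (simp add: S_def)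
  then have "c \<noteq> 0"
    using df f' by force
  then show ?thesis
    using d that by (simp add: S_def algebra_simps)
qed

lemma F_tendsto_boundary:
  assumes z: "norm z = 1"
  shows "(F \<longlongrightarrow> F z) (at z within ball 0 1)"
proof -
  have "(F \<longlongrightarrow> F z) (at z within cball 0 1 - {0})"
    using continuous_on_F z by (auto simp: continuous_on_def)
  then have "(F \<longlongrightarrow> F z) (at z within ball 0 1 - {0})"
    by (rule tendsto_within_subset) auto
  moreover have "at z within ball 0 1 - {0} = at z within ball 0 1"
    using z by (intro at_within_nhd[of _ "- {0}"]) auto
  ultimately show ?thesis
    by simp
qed

text \<open>An affine bijection carries the polygon, its extreme points and the boundary limits of
  \<open>F\<close> to those of f.\<close>

lemma pre_vertices_eq:
  assumes n: "n \<ge> 1" and f: "sc_mapping n a f"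
  shows "pre_vertices f = R"
proof -
  obtain c d where c: "c \<noteq> 0" and fF: "\<And>z. z \<in> ball 0 1 - {0} \<Longrightarrow> f z = c * F z + d"
    using sc_mapping_affine[OF n f] by blast
  define L where "L = (\<lambda>x. c * x + d)"
  have bij: "bij L"
    unfolding L_def using c
    by (intro bij_betw_byWitness[where f' = "\<lambda>y. (y - d) / c"]) auto
  have "f ` (ball 0 1 - {0}) = L ` (F ` (ball 0 1 - {0}))"
    using fF by (auto simp: L_def image_image intro!: image_cong)
  then have omitted: "- (f ` (ball 0 1 - {0})) = L ` polygon"
    using bij F_image[OF n] by (simp add: bij_image_Compl_eq[symmetric])
  have "z \<in> pre_vertices f \<longleftrightarrow> z \<in> R" if z: "norm z = 1" for z
  proof -
    have lim: "(f \<longlongrightarrow> L (F z)) (at z within ball 0 1)"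
    proof (rule Lim_transform_eventually)
      show "((\<lambda>z. L (F z)) \<longlongrightarrow> L (F z)) (at z within ball 0 1)"
        unfolding L_def by (intro tendsto_intros F_tendsto_boundary z)
      have "eventually (\<lambda>x. x \<noteq> 0) (at z within ball 0 1)"
        by (rule eventually_neq_at_within)
      moreover have "eventually (\<lambda>x. x \<in> ball 0 1) (at z within ball 0 1)"
        by (simp add: eventually_at_filter)
      ultimately show "eventually (\<lambda>x. L (F x) = f x) (at z within ball 0 1)"
        by eventually_elim (use fF in \<open>auto simp: L_def\<close>)
    qed
    have "\<not> trivial_limit (at z within ball 0 1)"
      using z by (simp add: trivial_limit_within islimpt_ball)
    then have "(f \<longlongrightarrow> v) (at z within ball 0 1) \<longleftrightarrow> v = L (F z)" for v
      using lim tendsto_unique by blast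
    then have "z \<in> pre_vertices f \<longleftrightarrow> L (F z) extreme_point_of (L ` polygon)"
      unfolding pre_vertices_def omitted using z by auto
    also have "\<dots> \<longleftrightarrow> F z extreme_point_of polygon"
      unfolding L_def by (rule extreme_point_of_affine_image[OF c])
    also have "\<dots> \<longleftrightarrow> F z \<in> F ` R"
      using extreme_points_polygon by auto
    also have "\<dots> \<longleftrightarrow> z \<in> R"
      using F_eq_vertex_iff z by blast
    finally show ?thesis .
  qed
  moreover have "norm z = 1" if "z \<in> pre_vertices f" for z
    using that by (simp add: pre_vertices_def)
  ultimately show ?thesis
    using R_unit by blast
qed

section \<open>The phase of z^2 B(z) and consecutive pre-vertices\<close>

definition phase :: "complex \<Rightarrow> real \<Rightarrow> real" where
  "phase z \<delta> = 2 * \<delta> + (\<Sum>k=1..n. half_phase (a k) z \<delta>)"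

lemma blaschke_rotate:
  assumes "norm z = 1" "0 < \<delta>" "\<delta> < pi"
  shows "(z * cis (2 * \<delta>))\<^sup>2 * blaschke n a (z * cis (2 * \<delta>)) = z\<^sup>2 * blaschke n a z * cis (2 * phase z \<delta>)"
proof -
  have prod_cis: "(\<Prod>k\<in>A. cis (f k)) = cis (\<Sum>k\<in>A. f k)" for f :: "nat \<Rightarrow> real" and A
    by (induction A rule: infinite_finite_induct) (auto simp: cis_mult)
  have "blaschke n a (z * cis (2 * \<delta>)) = (\<Prod>k=1..n. (z - a k) / (1 - cnj (a k) * z) * cis (2 * half_phase (a k) z \<delta>))"
    unfolding blaschke_def using assms zeros_in_disk by (intro prod.cong blaschke_factor_rotate) auto
  also have "\<dots> = blaschke n a z * cis (\<Sum>k=1..n. 2 * half_phase (a k) z \<delta>)"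
    unfolding blaschke_def prod.distrib prod_cis ..
  also have "(\<Sum>k=1..n. 2 * half_phase (a k) z \<delta>) = 2 * phase z \<delta> - 4 * \<delta>"
    by (simp add: phase_def sum_distrib_left)
  finally have "(z * cis (2 * \<delta>))\<^sup>2 * blaschke n a (z * cis (2 * \<delta>)) =
      z\<^sup>2 * blaschke n a z * (cis (2 * \<delta>) * cis (2 * \<delta>) * cis (2 * phase z \<delta> - 4 * \<delta>))"
    by (simp only: power2_eq_square mult_ac)
  also have "cis (2 * \<delta>) * cis (2 * \<delta>) * cis (2 * phase z \<delta> - 4 * \<delta>) = cis (2 * phase z \<delta>)"
    by (simp only: cis_mult) simp
  finally show ?thesis .
qed

lemma rotate_in_R_iff:
  assumes "z \<in> R" "0 < \<delta>" "\<delta> < pi"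
  shows "z * cis (2 * \<delta>) \<in> R \<longleftrightarrow> (\<exists>m::int. phase z \<delta> = of_int m * pi)"
  using blaschke_rotate[of z \<delta>] assms R_unit[OF assms(1)] cis_double_eq_1_iff[of "phase z \<delta>"]
  by (simp add: R_def)

lemma phase_gt: "2 * \<delta> \<le> phase z \<delta>"
proof -
  have "(\<Sum>k=1..n. half_phase (a k) z \<delta>) \<ge> 0"
    by (intro sum_nonneg less_imp_le half_phase_bounds)
  then show ?thesis
    by (simp add: phase_def)
qed

lemma phase_strict_mono:
  assumes "norm z = 1" "0 < x" "x < y" "y < pi"
  shows "phase z x < phase z y"
proof -
  have "(\<Sum>k=1..n. half_phase (a k) z x) \<le> (\<Sum>k=1..n. half_phase (a k) z y)"
    using half_phase_strict_mono[OF zeros_in_disk assms] by (intro sum_mono) (auto intro: less_imp_le)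
  then show ?thesis
    using assms by (simp add: phase_def)
qed

lemma continuous_on_phase: "continuous_on {0<..<pi} (phase z)"
  unfolding phase_def using zeros_in_disk by (intro continuous_intros continuous_on_half_phase) auto

lemma phase_tendsto_0:
  assumes "norm z = 1"
  shows "(phase z \<longlongrightarrow> 0) (at_right 0)"
proof -
  have "(phase z \<longlongrightarrow> 2 * 0 + (\<Sum>k=1..n. 0)) (at_right 0)"
    unfolding phase_def using zeros_in_disk assms by (intro tendsto_intros half_phase_tendsto_0) auto
  then show ?thesis
    by simp
qed

text \<open>At a pre-vertex the phase is a positive multiple of pi. If it exceeded pi, the
  intermediate value theorem would produce an earlier pre-vertex.\<close>

lemma consecutive_imp_phase:
  assumes c: "consecutive R z w"
  shows "phase z (separation z w / 2) = pi"
proof -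
  define \<delta> where "\<delta> = separation z w / 2"
  have zw: "z \<in> R" "w \<in> R" "z \<noteq> w" "\<And>u. u \<in> R - {z} \<Longrightarrow> separation z w \<le> separation z u"
    using c by (auto simp: consecutive_def)
  have z1: "norm z = 1" "norm w = 1"
    using zw R_unit by auto
  have \<delta>: "0 < \<delta>" "\<delta> < pi"
    using half_separation_bounds[OF z1 zw(3)] by (auto simp: \<delta>_def)
  have "w = z * cis (2 * \<delta>)"
    using rotate_separation[OF z1] by (simp add: \<delta>_def)
  then obtain m :: int where m: "phase z \<delta> = of_int m * pi"
    using rotate_in_R_iff[OF zw(1) \<delta>] zw(2) by auto
  have "phase z \<delta> > 0"
    using phase_gt[of \<delta> z] \<delta> by linarith
  then have "m \<ge> 1"
    using m by (simp add: zero_less_mult_iff)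
  then have ge: "phase z \<delta> \<ge> pi"
    unfolding m by (metis mult_le_cancel_right1 of_int_1_le_iff pi_ge_zero linorder_not_le)
  have "\<not> phase z \<delta> > pi"
  proof
    assume gt: "phase z \<delta> > pi"
    \<comment> \<open>Continuity is known only on the open interval, so the intermediate value
      theorem starts at a small positive point, supplied by the limit at 0.\<close>
    have "eventually (\<lambda>x. phase z x < pi) (at_right 0)"
      using phase_tendsto_0[OF z1(1)] by (rule order_tendstoD) simp
    moreover have "eventually (\<lambda>x. 0 < x \<and> x < \<delta>) (at_right 0)"
      using eventually_at_right_real[OF \<delta>(1)] by simp
    ultimately have "eventually (\<lambda>x. phase z x < pi \<and> 0 < x \<and> x < \<delta>) (at_right 0)"
      by eventually_elim auto
    then obtain \<epsilon> where \<epsilon>: "phase z \<epsilon> < pi" "0 < \<epsilon>" "\<epsilon> < \<delta>"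
      using eventually_happens[of _ "at_right (0::real)"] by auto
    have "continuous_on {\<epsilon>..\<delta>} (phase z)"
      by (rule continuous_on_subset[OF continuous_on_phase]) (use \<epsilon> \<delta> in auto)
    then obtain x where x: "\<epsilon> \<le> x" "x \<le> \<delta>" "phase z x = pi"
      using IVT'[of "phase z" \<epsilon> pi \<delta>] \<epsilon> gt by auto
    then have x': "0 < x" "x < \<delta>"
      using \<epsilon> gt by (auto simp: less_le)
    have "z * cis (2 * x) \<in> R"
      using rotate_in_R_iff[OF zw(1), of x] x x' \<delta> by (auto intro!: exI[of _ 1])
    moreover have sep: "separation z (z * cis (2 * x)) = 2 * x"
      using x' \<delta> by (intro separation_rotate z1) auto
    moreover have "z * cis (2 * x) \<noteq> z"
      using sep separation_rotate[OF z1(1), of 0] x' by auto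
    ultimately have "separation z w \<le> 2 * x"
      using zw(4) by force
    then show False
      using x' by (simp add: \<delta>_def)
  qed
  then show ?thesis
    using ge by (simp add: \<delta>_def)
qed

lemma consecutive_rotate:
  assumes z: "z \<in> R" and \<delta>: "0 < \<delta>" "\<delta> < pi" and p: "phase z \<delta> = pi"
  shows "consecutive R z (z * cis (2 * \<delta>))"
  unfolding consecutive_def
proof (intro conjI ballI z)
  have z1: "norm z = 1"
    using R_unit[OF z] .
  have sep: "separation z (z * cis (2 * \<delta>)) = 2 * \<delta>"
    using \<delta> by (intro separation_rotate z1) auto
  show "z * cis (2 * \<delta>) \<in> R"
    using rotate_in_R_iff[OF z \<delta>] p by (auto intro!: exI[of _ 1])
  show "z \<noteq> z * cis (2 * \<delta>)"
    using sep separation_rotate[OF z1, of 0] \<delta> by auto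
  fix u assume u: "u \<in> R - {z}"
  define \<delta>' where "\<delta>' = separation z u / 2"
  have u1: "norm u = 1"
    using R_unit u by auto
  have \<delta>': "0 < \<delta>'" "\<delta>' < pi"
    using half_separation_bounds[OF z1 u1] u by (auto simp: \<delta>'_def)
  have "u = z * cis (2 * \<delta>')"
    using rotate_separation[OF z1 u1] by (simp add: \<delta>'_def)
  then obtain m :: int where m: "phase z \<delta>' = of_int m * pi"
    using rotate_in_R_iff[OF z \<delta>'] u by auto
  have "phase z \<delta>' > 0"
    using phase_gt[of \<delta>' z] \<delta>' by linarith
  then have "m \<ge> 1"
    using m by (simp add: zero_less_mult_iff)
  then have "phase z \<delta>' \<ge> phase z \<delta>"
    unfolding m p by (metis mult_le_cancel_right1 of_int_1_le_iff pi_ge_zero linorder_not_le)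
  then have "\<delta> \<le> \<delta>'"
    using phase_strict_mono[OF z1 \<delta>'(1), of \<delta>] \<delta> by force
  then show "separation z (z * cis (2 * \<delta>)) \<le> separation z u"
    unfolding sep by (simp add: \<delta>'_def)
qed

end

section \<open>Extremal configurations\<close>

lemma extremal_phase_mono:
  assumes "\<bar>\<rho>\<bar> < 1" "0 \<le> x" "x \<le> y" "y < pi"
  shows "extremal_phase \<rho> x \<le> extremal_phase \<rho> y"
proof -
  have "tan (x / 2) \<le> tan (y / 2)"
    using assms by (intro tan_mono_le) auto
  then have "(1 + \<rho>) / (1 - \<rho>) * tan (x / 2) \<le> (1 + \<rho>) / (1 - \<rho>) * tan (y / 2)"
    using assms by (intro mult_left_mono) auto
  then show ?thesis
    unfolding extremal_phase_def by (simp add: arctan_le_iff)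
qed

text \<open>One predicate for both equations: \<rho> = r belongs to the minimum, \<rho> = -r to the
  maximum.\<close>

definition phase_root :: "nat \<Rightarrow> real \<Rightarrow> real \<Rightarrow> bool" where
  "phase_root n \<rho> \<theta> \<longleftrightarrow> \<theta> \<in> {0<..<pi/2} \<and> pi = 2 * \<theta> + real n * extremal_phase \<rho> \<theta>"

lemma min_root_iff: "min_root n r \<theta> \<longleftrightarrow> phase_root n r \<theta>"
  by (simp add: min_root_def phase_root_def extremal_phase_def mult_ac)

lemma max_root_iff: "max_root n r \<psi> \<longleftrightarrow> phase_root n (-r) \<psi>"
  by (simp add: max_root_def phase_root_def extremal_phase_def mult_ac)

lemma root_function_strict_mono:
  assumes "\<bar>\<rho>\<bar> < 1" "0 \<le> x" "x < y" "y < pi"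
  shows "2 * x + real n * extremal_phase \<rho> x < 2 * y + real n * extremal_phase \<rho> y"
  using mult_left_mono[OF extremal_phase_mono[of \<rho> x y], of "real n"] assms by simp

lemma ex1_phase_root:
  assumes n: "n \<ge> 1" and r: "\<bar>\<rho>\<bar> < 1"
  shows "\<exists>!\<theta>. phase_root n \<rho> \<theta>"
proof -
  define \<phi> where "\<phi> x = 2 * x + real n * extremal_phase \<rho> x" for x
  have "cos (x / 2) \<noteq> 0" if "x \<in> {0..pi/2}" for x
    using that cos_gt_zero_pi[of "x / 2"] pi_gt_zero by auto
  then have cont: "continuous_on {0..pi/2} \<phi>"
    unfolding \<phi>_def extremal_phase_def by (intro continuous_intros) auto
  have "extremal_phase \<rho> (pi/2) > 0"
  proof -
    have "tan (pi / 2 / 2) > 0"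
      by (intro tan_gt_zero) auto
    then show ?thesis
      unfolding extremal_phase_def using r by (auto simp: zero_less_arctan_iff intro!: mult_pos_pos divide_pos_pos)
  qed
  \<comment> \<open>At pi/2 the linear term alone is pi; with n \<ge> 1 the sum exceeds it, so the
    root lies strictly below pi/2.\<close>
  then have "real n * extremal_phase \<rho> (pi/2) > 0"
    using n by (intro mult_pos_pos) auto
  then have end2: "\<phi> (pi/2) > pi"
    by (simp add: \<phi>_def)
  have end1: "\<phi> 0 = 0"
    by (simp add: \<phi>_def extremal_phase_def)
  obtain \<theta> where \<theta>: "0 \<le> \<theta>" "\<theta> \<le> pi/2" "\<phi> \<theta> = pi"
    using IVT'[of \<phi> 0 pi "pi/2"] cont end1 end2 by auto
  have "\<theta> \<noteq> 0" "\<theta> \<noteq> pi/2"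
    using \<theta>(3) end1 end2 by (metis pi_neq_zero, metis order_less_irrefl)
  then have "phase_root n \<rho> \<theta>"
    using \<theta> by (auto simp: phase_root_def \<phi>_def)
  moreover have "x = y" if "phase_root n \<rho> x" "phase_root n \<rho> y" for x y
    using root_function_strict_mono[OF r, of x y n] root_function_strict_mono[OF r, of y x n] that
    unfolding phase_root_def by (cases x y rule: linorder_cases) auto
  ultimately show ?thesis
    by blast
qed

text \<open>A zero on the line through 0 and c is symmetric under reflection in that line, so the
  half arc from c to c e^(i \<theta>) collects half of its contribution.\<close>

lemma half_phase_midpoint:
  assumes c: "norm c = 1" and r: "\<bar>\<rho>\<bar> < 1" and \<theta>: "0 < \<theta>" "\<theta> < pi"
  shows "half_phase (of_real \<rho> * c) c (\<theta> / 2) = extremal_phase \<rho> \<theta> / 2"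
proof -
  have 1: "of_real \<rho> * c * cnj c = of_real \<rho>"
    using cnj_unit_mult[OF c] by (simp add: mult.assoc mult.commute[of c])
  define T where "T = (1 + \<rho>) / (1 - \<rho>) * tan (\<theta> / 2)"
  have "tan (\<theta> / 2) > 0"
    using \<theta> by (intro tan_gt_zero) auto
  then have T: "T > 0"
    unfolding T_def using r by (intro mult_pos_pos divide_pos_pos) auto
  have "(1 + \<rho>\<^sup>2 - 2 * \<rho>) / (1 - \<rho>\<^sup>2) = (1 - \<rho>) / (1 + \<rho>)"
  proof -
    have "1 + \<rho>\<^sup>2 - 2 * \<rho> = (1 - \<rho>) * (1 - \<rho>)" "1 - \<rho>\<^sup>2 = (1 + \<rho>) * (1 - \<rho>)"
      by (simp_all add: power2_eq_square algebra_simps)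
    then show ?thesis
      using r by simp
  qed
  then have "half_phase (of_real \<rho> * c) c (\<theta> / 2) = pi / 2 - arctan ((1 - \<rho>) / (1 + \<rho>) * cot (\<theta> / 2))"
    using \<theta> c by (subst half_phase_cot_form) (simp_all only: 1, simp_all add: norm_mult)
  also have "(1 - \<rho>) / (1 + \<rho>) * cot (\<theta> / 2) = 1 / T"
    by (simp add: T_def tan_def cot_def)
  also have "arctan (1 / T) = pi / 2 - arctan T"
    using arctan_inverse[of T] T by (simp add: inverse_eq_divide)
  finally show ?thesis
    by (simp add: extremal_phase_def T_def)
qed

context blaschke_zeros
begin

text \<open>Each factor with zero \<rho> c takes the value c at c, which gives c^(n+2) there. From c
  to the end of the arc the phase is pi/2, a factor -1. Thus the end of the arc is a pre-vertex
  exactly when c^(n+2) = -1.\<close>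

lemma blaschke_extremal:
  assumes a: "\<And>k. k \<in> {1..n} \<Longrightarrow> a k = of_real \<rho> * c" and c: "norm c = 1" and r: "\<bar>\<rho>\<bar> < 1"
    and \<theta>: "phase_root n \<rho> \<theta>"
  shows "(c * cis \<theta>)\<^sup>2 * blaschke n a (c * cis \<theta>) = - (c ^ (n + 2))"
proof -
  have \<theta>': "0 < \<theta>" "\<theta> < pi" "pi = 2 * \<theta> + real n * extremal_phase \<rho> \<theta>"
    using \<theta> by (auto simp: phase_root_def)
  have "blaschke n a c = (\<Prod>k=1..n. c)"
    unfolding blaschke_def
  proof (rule prod.cong)
    fix k assume k: "k \<in> {1..n}"
    have "cnj (a k) * c = of_real \<rho> * (cnj c * c)"
      by (simp add: a[OF k])
    then have "1 - cnj (a k) * c = of_real (1 - \<rho>)"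
      by (simp add: cnj_unit_mult[OF c])
    moreover have "c - a k = c * of_real (1 - \<rho>)"
      by (simp add: a[OF k] algebra_simps)
    moreover have "complex_of_real (1 - \<rho>) \<noteq> 0"
      using r by (simp only: of_real_eq_0_iff)
    ultimately show "(c - a k) / (1 - cnj (a k) * c) = c"
      by (metis nonzero_mult_div_cancel_right)
  qed simp
  then have B: "c\<^sup>2 * blaschke n a c = c ^ (n + 2)"
    by (simp add: power_add mult.commute power2_eq_square)
  have "phase c (\<theta> / 2) = \<theta> + (\<Sum>k=1..n. extremal_phase \<rho> \<theta> / 2)"
    unfolding phase_def using a half_phase_midpoint[OF c r \<theta>'(1,2)] by simp
  then have "2 * phase c (\<theta> / 2) = pi"
    using \<theta>'(3) by simp
  then show ?thesis
    using blaschke_rotate[OF c, of "\<theta> / 2"] \<theta>'(1,2) B by simp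
qed

lemma consecutive_extremal:
  assumes a: "\<And>k. k \<in> {1..n} \<Longrightarrow> a k = of_real \<rho> * c" and c: "c ^ (n + 2) = -1" "norm c = 1" and r: "\<bar>\<rho>\<bar> < 1"
    and \<theta>: "phase_root n \<rho> \<theta>"
  shows "consecutive R (cis (-\<theta>) * c) (cis \<theta> * c)" "separation (cis (-\<theta>) * c) (cis \<theta> * c) = 2 * \<theta>"
proof -
  define z where "z = cis (-\<theta>) * c"
  have \<theta>': "0 < \<theta>" "\<theta> < pi" "pi = 2 * \<theta> + real n * extremal_phase \<rho> \<theta>"
    using \<theta> by (auto simp: phase_root_def)
  have z1: "norm z = 1"
    by (simp add: z_def norm_mult c)
  have zc: "z * cis \<theta> = c" and w: "z * cis (2 * \<theta>) = cis \<theta> * c"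
    by (simp_all add: z_def mult.commute mult.left_commute cis_mult)
  have phase: "phase z \<theta> = pi"
  proof -
    have "half_phase (a k) z \<theta> = extremal_phase \<rho> \<theta>" if "k \<in> {1..n}" for k
      using half_phase_extremal[OF z1 r \<theta>'(1,2)] by (simp add: a[OF that] zc)
    then show ?thesis
      using \<theta>'(3) by (simp add: phase_def)
  qed
  \<comment> \<open>From z to the other end the phase is pi, a full turn of z^2 B(z), so both ends
    give the same value.\<close>
  have "z\<^sup>2 * blaschke n a z * cis (2 * phase z \<theta>) = - (c ^ (n + 2))"
    using blaschke_rotate[OF z1 \<theta>'(1,2)] blaschke_extremal[OF a c(2) r \<theta>]
    unfolding w by (simp only: mult.commute[of c])
  then have "z\<^sup>2 * blaschke n a z = 1"
    unfolding c(1) phase by simp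
  then have "z \<in> R"
    by (simp add: R_def)
  from consecutive_rotate[OF this \<theta>'(1,2) phase]
  show "consecutive R (cis (-\<theta>) * c) (cis \<theta> * c)"
    unfolding w by (simp add: z_def)
  show "separation (cis (-\<theta>) * c) (cis \<theta> * c) = 2 * \<theta>"
    using separation_rotate[OF z1, of "2 * \<theta>"] \<theta>' unfolding w by (simp add: z_def)
qed

lemma extremal_configuration:
  assumes zw: "consecutive R z w" and sep: "separation z w = 2 * \<theta>" and r: "\<bar>\<rho>\<bar> < 1"
    and \<theta>: "phase_root n \<rho> \<theta>" and a: "\<And>k. k \<in> {1..n} \<Longrightarrow> a k = of_real \<rho> * (z * cis \<theta>)"
  shows "\<exists>c. c ^ (n + 2) = -1 \<and> (\<forall>k\<in>{1..n}. a k = of_real \<rho> * c) \<and> z = cis (-\<theta>) * c \<and> w = cis \<theta> * c"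
proof (intro exI conjI ballI)
  have zR: "z \<in> R" "w \<in> R" and z1: "norm z = 1" "norm w = 1"
    using zw R_unit by (auto simp: consecutive_def)
  show w: "w = cis \<theta> * (z * cis \<theta>)"
    using rotate_separation[OF z1] unfolding sep by (simp add: mult.left_commute cis_mult)
  show "z = cis (-\<theta>) * (z * cis \<theta>)"
    by (simp add: mult.left_commute cis_mult)
  show "a k = of_real \<rho> * (z * cis \<theta>)" if "k \<in> {1..n}" for k
    using a[OF that] .
  have "w\<^sup>2 * blaschke n a w = - ((z * cis \<theta>) ^ (n + 2))"
    using blaschke_extremal[OF a _ r \<theta>] z1 w by (simp only: mult.commute[of "cis \<theta>"] norm_mult norm_cis mult_1_right)
  then show "(z * cis \<theta>) ^ (n + 2) = -1"
    using zR(2) by (simp add: R_def minus_equation_iff)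
qed

text \<open>Termwise bounds give pi \<le>
  \<open>2 * \<delta> + real n * extremal_phase r \<delta>\<close>, and this function is increasing
  with value pi at \<theta>. Under equality each summand is extremal, which pins down every
  zero.\<close>

lemma separation_lower_bound:
  assumes a: "\<And>k. k \<in> {1..n} \<Longrightarrow> norm (a k) \<le> r" and r: "0 \<le> r" "r < 1"
    and \<theta>: "phase_root n r \<theta>" and zw: "consecutive R z w"
  shows "2 * \<theta> \<le> separation z w"
    and "separation z w = 2 * \<theta> \<Longrightarrow>
      \<exists>c. c ^ (n + 2) = -1 \<and> (\<forall>k\<in>{1..n}. a k = of_real r * c) \<and> z = cis (-\<theta>) * c \<and> w = cis \<theta> * c"
proof -
  define \<delta> where "\<delta> = separation z w / 2"
  have z1: "norm z = 1" "norm w = 1" "z \<noteq> w"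
    using zw R_unit by (auto simp: consecutive_def)
  have \<delta>: "0 < \<delta>" "\<delta> < pi" and phase: "phase z \<delta> = pi"
    using half_separation_bounds[OF z1] consecutive_imp_phase[OF zw] by (auto simp: \<delta>_def)
  note bound = half_phase_le[OF z1(1) a r(2) \<delta>]
  have root: "0 < \<theta>" "\<theta> < pi" "pi = 2 * \<theta> + real n * extremal_phase r \<theta>"
    using \<theta> by (auto simp: phase_root_def)
  have "(\<Sum>k=1..n. half_phase (a k) z \<delta>) \<le> (\<Sum>k=1..n. extremal_phase r \<delta>)"
    by (intro sum_mono bound)
  then have "pi \<le> 2 * \<delta> + real n * extremal_phase r \<delta>"
    using phase by (simp add: phase_def)
  then have "\<theta> \<le> \<delta>"
    using root_function_strict_mono[of r \<delta> \<theta> n] \<delta> root r by force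
  then show "2 * \<theta> \<le> separation z w"
    by (simp add: \<delta>_def)
  assume eq: "separation z w = 2 * \<theta>"
  then have "\<delta> = \<theta>"
    by (simp add: \<delta>_def)
  have sum_eq: "(\<Sum>k=1..n. half_phase (a k) z \<delta>) = (\<Sum>k=1..n. extremal_phase r \<delta>)"
    using phase root(3) unfolding \<open>\<delta> = \<theta>\<close> by (simp add: phase_def)
  have "half_phase (a k) z \<delta> = extremal_phase r \<delta>" if "k \<in> {1..n}" for k
    using sum_mono_inv[OF sum_eq bound(1) that] by simp
  then have "a k = of_real r * (z * cis \<theta>)" if "k \<in> {1..n}" for k
    using bound(2)[OF that] that unfolding \<open>\<delta> = \<theta>\<close> by blast
  then show "\<exists>c. c ^ (n + 2) = -1 \<and> (\<forall>k\<in>{1..n}. a k = of_real r * c) \<and> z = cis (-\<theta>) * c \<and> w = cis \<theta> * c"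
    using extremal_configuration[OF zw eq _ \<theta>] r by simp
qed

lemma separation_upper_bound:
  assumes a: "\<And>k. k \<in> {1..n} \<Longrightarrow> norm (a k) \<le> r" and r: "0 \<le> r" "r < 1"
    and \<theta>: "phase_root n (-r) \<theta>" and zw: "consecutive R z w"
  shows "separation z w \<le> 2 * \<theta>"
    and "separation z w = 2 * \<theta> \<Longrightarrow>
      \<exists>c. c ^ (n + 2) = -1 \<and> (\<forall>k\<in>{1..n}. a k = of_real (-r) * c) \<and> z = cis (-\<theta>) * c \<and> w = cis \<theta> * c"
proof -
  define \<delta> where "\<delta> = separation z w / 2"
  have z1: "norm z = 1" "norm w = 1" "z \<noteq> w"
    using zw R_unit by (auto simp: consecutive_def)
  have \<delta>: "0 < \<delta>" "\<delta> < pi" and phase: "phase z \<delta> = pi"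
    using half_separation_bounds[OF z1] consecutive_imp_phase[OF zw] by (auto simp: \<delta>_def)
  note bound = half_phase_le[OF z1(1) a r(2) \<delta>]
  have root: "0 < \<theta>" "\<theta> < pi" "pi = 2 * \<theta> + real n * extremal_phase (-r) \<theta>"
    using \<theta> by (auto simp: phase_root_def)
  have "(\<Sum>k=1..n. extremal_phase (-r) \<delta>) \<le> (\<Sum>k=1..n. half_phase (a k) z \<delta>)"
    by (intro sum_mono bound)
  then have "2 * \<delta> + real n * extremal_phase (-r) \<delta> \<le> pi"
    using phase by (simp add: phase_def)
  then have "\<delta> \<le> \<theta>"
    using root_function_strict_mono[of "-r" \<theta> \<delta> n] \<delta> root r by force
  then show "separation z w \<le> 2 * \<theta>"
    by (simp add: \<delta>_def)
  assume eq: "separation z w = 2 * \<theta>"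
  then have "\<delta> = \<theta>"
    by (simp add: \<delta>_def)
  have sum_eq: "(\<Sum>k=1..n. extremal_phase (-r) \<delta>) = (\<Sum>k=1..n. half_phase (a k) z \<delta>)"
    using phase root(3) unfolding \<open>\<delta> = \<theta>\<close> by (simp add: phase_def)
  have "half_phase (a k) z \<delta> = extremal_phase (-r) \<delta>" if "k \<in> {1..n}" for k
    using sum_mono_inv[OF sum_eq bound(3) that] by simp
  then have "a k = of_real (-r) * (z * cis \<theta>)" if "k \<in> {1..n}" for k
    using bound(4)[OF that] that unfolding \<open>\<delta> = \<theta>\<close> by blast
  then show "\<exists>c. c ^ (n + 2) = -1 \<and> (\<forall>k\<in>{1..n}. a k = of_real (-r) * c) \<and> z = cis (-\<theta>) * c \<and> w = cis \<theta> * c"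
    using extremal_configuration[OF zw eq _ \<theta>] r by simp
qed

end

section \<open>Sharpness and bounds for all mappings\<close>

lemma norm_eq_1_if_power:
  fixes c :: "'a::real_normed_div_algebra"
  assumes "norm (c ^ m) = 1" "m > 0"
  shows "norm c = 1"
proof -
  have "norm c ^ m = 1 ^ m"
    using assms by (simp only: norm_power power_one)
  then show ?thesis
    by (rule power_eq_imp_eq_base) (use assms in auto)
qed

lemma sc_mapping_blaschke_zeros: "sc_mapping n a f \<Longrightarrow> blaschke_zeros n a"
  by unfold_locales (simp add: sc_mapping_def)

lemma extremal_mapping:
  assumes n: "n \<ge> 1" and r: "\<bar>\<rho>\<bar> < 1" and \<theta>: "phase_root n \<rho> \<theta>"
    and c: "c ^ (n + 2) = -1" and a: "\<forall>k\<in>{1..n}. a k = of_real \<rho> * c"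
  shows "\<exists>f. sc_mapping n a f"
    and "sc_mapping n a f \<Longrightarrow> consecutive (pre_vertices f) (cis (-\<theta>) * c) (cis \<theta> * c)"
    and "separation (cis (-\<theta>) * c) (cis \<theta> * c) = 2 * \<theta>"
proof -
  have c1: "norm c = 1"
    by (rule norm_eq_1_if_power[of _ "n + 2"]) (simp_all only: c, simp_all)
  interpret blaschke_zeros n a
    using a r by unfold_locales (simp add: norm_mult c1)
  show "\<exists>f. sc_mapping n a f"
    using sc_mapping_F[OF n] by blast
  have a': "\<And>k. k \<in> {1..n} \<Longrightarrow> a k = of_real \<rho> * c"
    using a by blast
  note E = consecutive_extremal[OF a' c c1 r \<theta>]
  show "consecutive (pre_vertices f) (cis (-\<theta>) * c) (cis \<theta> * c)" if "sc_mapping n a f"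
    unfolding pre_vertices_eq[OF n that] by (rule E(1))
  show "separation (cis (-\<theta>) * c) (cis \<theta> * c) = 2 * \<theta>"
    by (rule E(2))
qed

lemma exists_power_eq_minus_1: "\<exists>c::complex. c ^ (n + 2) = -1"
proof
  have "cis (pi / real (n + 2)) ^ (n + 2) = cis (real (n + 2) * (pi / real (n + 2)))"
    by (rule Complex.DeMoivre)
  also have "real (n + 2) * (pi / real (n + 2)) = pi"
    by simp
  finally show "cis (pi / real (n + 2)) ^ (n + 2) = -1"
    by (simp only: cis_pi)
qed

lemma extremal_separation_mem:
  assumes n: "n \<ge> 1" and r: "\<bar>\<rho>\<bar> \<le> r" "r < 1" and \<theta>: "phase_root n \<rho> \<theta>"
  shows "2 * \<theta> \<in> separations n r"
proof -
  obtain c :: complex where c: "c ^ (n + 2) = -1"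
    using exists_power_eq_minus_1 by blast
  define a where "a = (\<lambda>k::nat. of_real \<rho> * c)"
  have \<rho>: "\<bar>\<rho>\<bar> < 1"
    using r by simp
  have a: "\<forall>k\<in>{1..n}. a k = of_real \<rho> * c"
    by (simp add: a_def)
  obtain f where f: "sc_mapping n a f"
    using extremal_mapping(1)[OF n \<rho> \<theta> c a] by blast
  have "\<forall>k\<in>{1..n}. norm (a k) \<le> r"
    using r norm_eq_1_if_power[of c "n + 2"] unfolding c by (simp add: a_def norm_mult)
  then show ?thesis
    unfolding separations_def
    using f extremal_mapping(2)[OF n \<rho> \<theta> c a f] extremal_mapping(3)[OF n \<rho> \<theta> c a] by force
qed

lemma separation_min:
  assumes n: "n \<ge> 1" and r: "0 \<le> r" "r < 1" and \<theta>: "phase_root n r \<theta>"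
    and f: "sc_mapping n a f" "\<forall>k\<in>{1..n}. norm (a k) \<le> r" and zw: "consecutive (pre_vertices f) z w"
  shows "2 * \<theta> \<le> separation z w"
    and "separation z w = 2 * \<theta> \<Longrightarrow>
      \<exists>c. c ^ (n + 2) = -1 \<and> (\<forall>k\<in>{1..n}. a k = of_real r * c) \<and> z = cis (-\<theta>) * c \<and> w = cis \<theta> * c"
proof -
  interpret blaschke_zeros n a
    using sc_mapping_blaschke_zeros[OF f(1)] .
  have a: "\<And>k. k \<in> {1..n} \<Longrightarrow> norm (a k) \<le> r"
    using f(2) by blast
  note b = separation_lower_bound[OF a r \<theta> zw[unfolded pre_vertices_eq[OF n f(1)]]]
  show "2 * \<theta> \<le> separation z w"
    by (rule b(1))
  show "\<exists>c. c ^ (n + 2) = -1 \<and> (\<forall>k\<in>{1..n}. a k = of_real r * c) \<and> z = cis (-\<theta>) * c \<and> w = cis \<theta> * c"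
    if "separation z w = 2 * \<theta>"
    by (intro b(2) that)
qed

lemma separation_max:
  assumes n: "n \<ge> 1" and r: "0 \<le> r" "r < 1" and \<theta>: "phase_root n (-r) \<theta>"
    and f: "sc_mapping n a f" "\<forall>k\<in>{1..n}. norm (a k) \<le> r" and zw: "consecutive (pre_vertices f) z w"
  shows "separation z w \<le> 2 * \<theta>"
    and "separation z w = 2 * \<theta> \<Longrightarrow>
      \<exists>c. c ^ (n + 2) = -1 \<and> (\<forall>k\<in>{1..n}. a k = of_real (-r) * c) \<and> z = cis (-\<theta>) * c \<and> w = cis \<theta> * c"
proof -
  interpret blaschke_zeros n a
    using sc_mapping_blaschke_zeros[OF f(1)] .
  have a: "\<And>k. k \<in> {1..n} \<Longrightarrow> norm (a k) \<le> r"
    using f(2) by blast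
  note b = separation_upper_bound[OF a r \<theta> zw[unfolded pre_vertices_eq[OF n f(1)]]]
  show "separation z w \<le> 2 * \<theta>"
    by (rule b(1))
  show "\<exists>c. c ^ (n + 2) = -1 \<and> (\<forall>k\<in>{1..n}. a k = of_real (-r) * c) \<and> z = cis (-\<theta>) * c \<and> w = cis \<theta> * c"
    if "separation z w = 2 * \<theta>"
    by (intro b(2) that)
qed

lemma pre_vertices_roots:
  assumes n: "n \<ge> 1" and f: "sc_mapping n a f"
  shows "pre_vertices f = {z. z\<^sup>2 * blaschke n a z = 1}" "card (pre_vertices f) = n + 2"
proof -
  interpret blaschke_zeros n a
    using sc_mapping_blaschke_zeros[OF f] .
  show "pre_vertices f = {z. z\<^sup>2 * blaschke n a z = 1}" "card (pre_vertices f) = n + 2"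
    using pre_vertices_eq[OF n f] card_R by (simp_all add: R_def)
qed

theorem theorem8:
  fixes n :: nat and r :: real
  assumes "n \<ge> 1" and "0 \<le> r" and "r < 1"
  shows
    "(\<forall>f a. sc_mapping n a f \<and> (\<forall>k\<in>{1..n}. norm (a k) \<le> r) \<longrightarrow>
        pre_vertices f = {z. z\<^sup>2 * blaschke n a z = 1} \<and> card (pre_vertices f) = n + 2)
   \<and> (\<exists>!\<theta>. min_root n r \<theta>)
   \<and> (\<forall>\<theta>. min_root n r \<theta> \<longrightarrow>
        is_minimum (separations n r) (2 * \<theta>)
      \<and> (\<forall>c a. c ^ (n + 2) = -1 \<and> (\<forall>k\<in>{1..n}. a k = of_real r * c) \<longrightarrow>
           (\<exists>f. sc_mapping n a f) \<and>
           (\<forall>f. sc_mapping n a f \<longrightarrow>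
              consecutive (pre_vertices f) (cis (-\<theta>) * c) (cis \<theta> * c)
            \<and> separation (cis (-\<theta>) * c) (cis \<theta> * c) = 2 * \<theta>
            \<and> (r > 0 \<longrightarrow> (\<forall>z w. consecutive (pre_vertices f) z w \<and>
                   (z, w) \<noteq> (cis (-\<theta>) * c, cis \<theta> * c) \<longrightarrow> separation z w > 2 * \<theta>))))
      \<and> (\<forall>f a z w. sc_mapping n a f \<and> (\<forall>k\<in>{1..n}. norm (a k) \<le> r) \<and>
             consecutive (pre_vertices f) z w \<and> separation z w = 2 * \<theta> \<longrightarrow>
           (\<exists>c. c ^ (n + 2) = -1 \<and> (\<forall>k\<in>{1..n}. a k = of_real r * c) \<and>
              z = cis (-\<theta>) * c \<and> w = cis \<theta> * c)))
   \<and> (\<exists>!\<psi>. max_root n r \<psi>)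
   \<and> (\<forall>\<psi>. max_root n r \<psi> \<longrightarrow>
        is_maximum (separations n r) (2 * \<psi>)
      \<and> (\<forall>d a. d ^ (n + 2) = (-1) ^ (n + 1) \<and> (\<forall>k\<in>{1..n}. a k = of_real r * d) \<longrightarrow>
           (\<exists>f. sc_mapping n a f) \<and>
           (\<forall>f. sc_mapping n a f \<longrightarrow>
              consecutive (pre_vertices f) (- cis (-\<psi>) * d) (- cis \<psi> * d)
            \<and> separation (- cis (-\<psi>) * d) (- cis \<psi> * d) = 2 * \<psi>
            \<and> (r > 0 \<longrightarrow> (\<forall>z w. consecutive (pre_vertices f) z w \<and>
                   (z, w) \<noteq> (- cis (-\<psi>) * d, - cis \<psi> * d) \<longrightarrow> separation z w < 2 * \<psi>))))
      \<and> (\<forall>f a z w. sc_mapping n a f \<and> (\<forall>k\<in>{1..n}. norm (a k) \<le> r) \<and>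
             consecutive (pre_vertices f) z w \<and> separation z w = 2 * \<psi> \<longrightarrow>
           (\<exists>d. d ^ (n + 2) = (-1) ^ (n + 1) \<and> (\<forall>k\<in>{1..n}. a k = of_real r * d) \<and>
              z = - cis (-\<psi>) * d \<and> w = - cis \<psi> * d)))"
proof (intro conjI)
  note n = \<open>n \<ge> 1\<close> and r = \<open>0 \<le> r\<close> \<open>r < 1\<close>
  have abs_r: "\<bar>r\<bar> < 1" "\<bar>-r\<bar> < 1"
    using r by auto
  have norm_le: "\<forall>k\<in>{1..n}. norm (a k) \<le> r"
    if "c ^ (n + 2) = -1 \<or> c ^ (n + 2) = (-1) ^ (n + 1)" "\<forall>k\<in>{1..n}. a k = of_real r * c" for c :: complex and a
  proof -
    have "norm (c ^ (n + 2)) = 1"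
      using that(1) by (elim disjE) (metis norm_minus_cancel norm_one norm_power power_one)+
    then have "norm c = 1"
      by (rule norm_eq_1_if_power) simp
    then show ?thesis
      using that(2) r by (simp add: norm_mult)
  qed
  show "\<forall>f a. sc_mapping n a f \<and> (\<forall>k\<in>{1..n}. norm (a k) \<le> r) \<longrightarrow>
        pre_vertices f = {z. z\<^sup>2 * blaschke n a z = 1} \<and> card (pre_vertices f) = n + 2"
    using pre_vertices_roots[OF n] by blast
  show "\<exists>!\<theta>. min_root n r \<theta>" "\<exists>!\<psi>. max_root n r \<psi>"
    unfolding min_root_iff max_root_iff by (intro ex1_phase_root n abs_r)+
  show "\<forall>\<theta>. min_root n r \<theta> \<longrightarrow>
        is_minimum (separations n r) (2 * \<theta>)
      \<and> (\<forall>c a. c ^ (n + 2) = -1 \<and> (\<forall>k\<in>{1..n}. a k = of_real r * c) \<longrightarrow>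
           (\<exists>f. sc_mapping n a f) \<and>
           (\<forall>f. sc_mapping n a f \<longrightarrow>
              consecutive (pre_vertices f) (cis (-\<theta>) * c) (cis \<theta> * c)
            \<and> separation (cis (-\<theta>) * c) (cis \<theta> * c) = 2 * \<theta>
            \<and> (r > 0 \<longrightarrow> (\<forall>z w. consecutive (pre_vertices f) z w \<and>
                   (z, w) \<noteq> (cis (-\<theta>) * c, cis \<theta> * c) \<longrightarrow> separation z w > 2 * \<theta>))))
      \<and> (\<forall>f a z w. sc_mapping n a f \<and> (\<forall>k\<in>{1..n}. norm (a k) \<le> r) \<and>
             consecutive (pre_vertices f) z w \<and> separation z w = 2 * \<theta> \<longrightarrow>
           (\<exists>c. c ^ (n + 2) = -1 \<and> (\<forall>k\<in>{1..n}. a k = of_real r * c) \<and>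
              z = cis (-\<theta>) * c \<and> w = cis \<theta> * c))"
  proof (intro allI impI conjI)
    fix \<theta> assume "min_root n r \<theta>"
    then have \<theta>: "phase_root n r \<theta>"
      by (simp add: min_root_iff)
    note min = separation_min[OF n r \<theta>]
    show "is_minimum (separations n r) (2 * \<theta>)"
      unfolding is_minimum_def
    proof (intro conjI ballI)
      show "2 * \<theta> \<in> separations n r"
        using extremal_separation_mem[OF n _ r(2) \<theta>] r by simp
      show "2 * \<theta> \<le> s" if "s \<in> separations n r" for s
        using that min(1) unfolding separations_def by blast
    qed
    show "\<exists>c. c ^ (n + 2) = -1 \<and> (\<forall>k\<in>{1..n}. a k = of_real r * c) \<and> z = cis (-\<theta>) * c \<and> w = cis \<theta> * c"
      if "sc_mapping n a f \<and> (\<forall>k\<in>{1..n}. norm (a k) \<le> r) \<and>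
             consecutive (pre_vertices f) z w \<and> separation z w = 2 * \<theta>" for f a z w
      using that by (intro min(2)) auto
    fix c :: complex and a assume ca: "c ^ (n + 2) = -1 \<and> (\<forall>k\<in>{1..n}. a k = of_real r * c)"
    note ext = extremal_mapping[OF n abs_r(1) \<theta> conjunct1[OF ca] conjunct2[OF ca]]
    show "\<exists>f. sc_mapping n a f"
      by (rule ext(1))
    fix f assume f: "sc_mapping n a f"
    show "consecutive (pre_vertices f) (cis (-\<theta>) * c) (cis \<theta> * c)"
      using f by (rule ext(2))
    show "separation (cis (-\<theta>) * c) (cis \<theta> * c) = 2 * \<theta>"
      by (rule ext(3))
    fix z w assume "r > 0" and zw: "consecutive (pre_vertices f) z w \<and> (z, w) \<noteq> (cis (-\<theta>) * c, cis \<theta> * c)"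
    have a: "\<forall>k\<in>{1..n}. norm (a k) \<le> r"
      using ca by (intro norm_le) auto
    have "separation z w \<noteq> 2 * \<theta>"
    proof
      assume "separation z w = 2 * \<theta>"
      then obtain c' where c': "\<forall>k\<in>{1..n}. a k = of_real r * c'" "z = cis (-\<theta>) * c'" "w = cis \<theta> * c'"
        using min(2)[OF f a conjunct1[OF zw]] by blast
      \<comment> \<open>The common zero determines c only for r > 0. For r = 0 the pre-vertices are
        equally spaced and every consecutive pair attains the bound.\<close>
      have "of_real r * c' = of_real r * c"
        using c'(1) ca n by (metis atLeastAtMost_iff order_refl)
      then show False
        using \<open>r > 0\<close> c' zw by simp
    qed
    then show "separation z w > 2 * \<theta>"
      using min(1)[OF f a conjunct1[OF zw]] by simp
  qed
  show "\<forall>\<psi>. max_root n r \<psi> \<longrightarrow>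
        is_maximum (separations n r) (2 * \<psi>)
      \<and> (\<forall>d a. d ^ (n + 2) = (-1) ^ (n + 1) \<and> (\<forall>k\<in>{1..n}. a k = of_real r * d) \<longrightarrow>
           (\<exists>f. sc_mapping n a f) \<and>
           (\<forall>f. sc_mapping n a f \<longrightarrow>
              consecutive (pre_vertices f) (- cis (-\<psi>) * d) (- cis \<psi> * d)
            \<and> separation (- cis (-\<psi>) * d) (- cis \<psi> * d) = 2 * \<psi>
            \<and> (r > 0 \<longrightarrow> (\<forall>z w. consecutive (pre_vertices f) z w \<and>
                   (z, w) \<noteq> (- cis (-\<psi>) * d, - cis \<psi> * d) \<longrightarrow> separation z w < 2 * \<psi>))))
      \<and> (\<forall>f a z w. sc_mapping n a f \<and> (\<forall>k\<in>{1..n}. norm (a k) \<le> r) \<and>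
             consecutive (pre_vertices f) z w \<and> separation z w = 2 * \<psi> \<longrightarrow>
           (\<exists>d. d ^ (n + 2) = (-1) ^ (n + 1) \<and> (\<forall>k\<in>{1..n}. a k = of_real r * d) \<and>
              z = - cis (-\<psi>) * d \<and> w = - cis \<psi> * d))"
  proof (intro allI impI conjI)
    fix \<psi> assume "max_root n r \<psi>"
    then have \<psi>: "phase_root n (-r) \<psi>"
      by (simp add: max_root_iff)
    note max = separation_max[OF n r \<psi>]
    \<comment> \<open>The passage between c and d = -c: the zeros (-r) c become r d, and c^(n+2) =
      -1 becomes d^(n+2) = (-1)^(n+1).\<close>
    have neg: "(- d) ^ (n + 2) = (-1) ^ n * d ^ (n + 2)" for d :: complex
      using power_minus[of d "n + 2"] by simp
    show "is_maximum (separations n r) (2 * \<psi>)"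
      unfolding is_maximum_def
    proof (intro conjI ballI)
      show "2 * \<psi> \<in> separations n r"
        using extremal_separation_mem[OF n _ r(2) \<psi>] r by simp
      show "s \<le> 2 * \<psi>" if "s \<in> separations n r" for s
        using that max(1) unfolding separations_def by blast
    qed
    show "\<exists>d. d ^ (n + 2) = (-1) ^ (n + 1) \<and> (\<forall>k\<in>{1..n}. a k = of_real r * d) \<and>
        z = - cis (-\<psi>) * d \<and> w = - cis \<psi> * d"
      if prem: "sc_mapping n a f \<and> (\<forall>k\<in>{1..n}. norm (a k) \<le> r) \<and>
             consecutive (pre_vertices f) z w \<and> separation z w = 2 * \<psi>" for f a z w
    proof -
      obtain c where c: "c ^ (n + 2) = -1" "\<forall>k\<in>{1..n}. a k = of_real (-r) * c" "z = cis (-\<psi>) * c" "w = cis \<psi> * c"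
        using max(2)[of a f z w] prem by blast
      have "(- c) ^ (n + 2) = (-1) ^ (n + 1)"
        unfolding neg c(1) by simp
      then show ?thesis
        using c by (intro exI[of _ "-c"]) simp
    qed
    fix d :: complex and a assume da: "d ^ (n + 2) = (-1) ^ (n + 1) \<and> (\<forall>k\<in>{1..n}. a k = of_real r * d)"
    have c: "(- d) ^ (n + 2) = -1" and a': "\<forall>k\<in>{1..n}. a k = of_real (-r) * (- d)"
      using da unfolding neg by (simp_all add: power_add[symmetric])
    note ext = extremal_mapping[OF n abs_r(2) \<psi> c a']
    have minus: "- x * d = x * (- d)" for x :: complex
      by simp
    show "\<exists>f. sc_mapping n a f"
      by (rule ext(1))
    fix f assume f: "sc_mapping n a f"
    show "consecutive (pre_vertices f) (- cis (-\<psi>) * d) (- cis \<psi> * d)"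
      unfolding minus using f by (rule ext(2))
    show "separation (- cis (-\<psi>) * d) (- cis \<psi> * d) = 2 * \<psi>"
      unfolding minus by (rule ext(3))
    fix z w assume "r > 0" and zw: "consecutive (pre_vertices f) z w \<and> (z, w) \<noteq> (- cis (-\<psi>) * d, - cis \<psi> * d)"
    have a: "\<forall>k\<in>{1..n}. norm (a k) \<le> r"
      using da by (intro norm_le) auto
    have "separation z w \<noteq> 2 * \<psi>"
    proof
      assume "separation z w = 2 * \<psi>"
      then obtain c' where c': "\<forall>k\<in>{1..n}. a k = of_real (-r) * c'" "z = cis (-\<psi>) * c'" "w = cis \<psi> * c'"
        using max(2)[OF f a conjunct1[OF zw]] by blast
      have "of_real (-r) * c' = of_real r * d"
        using c'(1) da n by (metis atLeastAtMost_iff order_refl)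
      then have "of_real r * (- c') = of_real r * d"
        by simp
      then have "- c' = d"
        using \<open>r > 0\<close> by (simp only: mult_cancel_left of_real_eq_0_iff) simp
      then have "c' = - d"
        by auto
      then show False
        using c' zw by simp
    qed
    then show "separation z w < 2 * \<psi>"
      using max(1)[OF f a conjunct1[OF zw]] by simp
  qed
qed

end
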